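(* Fix an integer $p>1$. There is a 1-parameter family of complete rotationally symmetric steady gradient Ricci Yang-Mills solitons $(\Sigma^2_\lambda, g_\lambda, F_\lambda, f_\lambda)$, $\lambda\in[-2/p,\infty)$, on two-dimensional surfaces $\Sigma^2_\lambda$ each containing an orbifold point of type $\mathbb{R}^2/\mathbb{Z}_p$ (which is the base point for pointed convergence), with the following properties. The family $(\Sigma^2_\lambda,g_\lambda)$ converges: (1) in the pointed Cheeger-Gromov sense to $2p$ times the quotient of the Hamilton cigar soliton metric on $\mathbb{R}^2/\mathbb{Z}_p$, as $\lambda\to(-2/p)^+$; (2) in the pointed Cheeger-Gromov sense to a cusp soliton, as $\lambda\to 0^-$; (3) in the pointed Gromov-Hausdorff sense to a cusp soliton, as $\lambda\to 0^+$; (4) in the Gromov-Hausdorff sense, after a rescaling, to $S^2_{p,p}$ with the quotient round metric, as $\lambda\to\infty$. Moreover: (5) for each integer $q>p$, the metric $g_\lambda$ with $\lambda=\frac{2}{q-p}$ is defined on the orbifold $S^2_{p,q}$ (i.e. it is an orbifold metric on $S^2_{p,q}$).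
   Context: Let $(M^n,g)$ be a Riemannian manifold, and let $L\to M$ be a $U(1)$-line bundle with connection $A$ and curvature 2-form $F$ (regarded as a real 2-form). Let $f$ be a smooth function on $M$. The tuple $(M^n,g,F,f)$ is a gradient Ricci Yang-Mills soliton if, for some constant $\hat\lambda$, $$\operatorname{Rc}(g)-\tfrac12 F^2+\nabla^2 f=\hat\lambda g,\qquad \operatorname{div}(e^{-f}F)=0,$$ where $(F^2)_{ij}=g^{kl}F_{ik}F_{jl}$. It is steady if $\hat\lambda=0$. The definition extends to orbifolds by requiring the data to be smooth and invariant in local uniformizing charts. (The index $\lambda$ of the family is a parameter, different from $\hat\lambda$.) Rotationally symmetric here means that $g=dr^2+\varphi(r)^2d\theta^2$, $\theta\in[0,2\pi]/\!\sim$, on an interval $0<r<b$ (with $b\le\infty$) with $\varphi>0$, and $F$, $f$ are invariant under rotation in $\theta$. An orbifold point of type $\mathbb{R}^2/\mathbb{Z}_p$ at $r=0$ corresponds to $\varphi(0)=0$, $\varphi'(0)=1/p$. When the surface closes up at a finite $r=b$ with $\varphi(b)=0$, it is compact and the metric may have a cone point there; it is an orbifold point of order $q$ when $\varphi'(b)=-1/q$. For positive integers $p,q$, $S^2_{p,q}$ denotes the two-sphere orbifold with exactly two distinguished points, of types $\mathbb{R}^2/\mathbb{Z}_p$ and $\mathbb{R}^2/\mathbb{Z}_q$ (the football). The quotient round metric on $S^2_{p,p}$ is the quotient of the round unit sphere by rotations by multiples of $2\pi/p$, i.e. $dr^2+\frac1{p^2}\sin^2 r\,d\theta^2$, $0\le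 r\le\pi$. The Hamilton cigar metric on $\mathbb{R}^2$ is $ds^2+\tanh^2 s\,d\theta^2$; its quotient on $\mathbb{R}^2/\mathbb{Z}_p$ is $ds^2+\frac1{p^2}\tanh^2 s\,d\theta^2$, $s\ge 0$. The cusp soliton is the metric $dr^2+\left(\frac{r}{p+r^2/2}\right)^2d\theta^2$, $r\in[0,\infty)$, on $\mathbb{R}^2/\mathbb{Z}_p$. *)

theory Defs
  imports "HOL-Analysis.Analysis"
begin

section \<open>Tensor calculus in a coordinate domain of \<open>real ^ 'n\<close>\<close>

definition pdv :: "'n::finite \<Rightarrow> (real ^ 'n \<Rightarrow> real) \<Rightarrow> real ^ 'n \<Rightarrow> real" where
  "pdv i h x = deriv (\<lambda>t. h (x + t *\<^sub>R axis i 1)) 0"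

definition pdvs :: "'n::finite list \<Rightarrow> (real ^ 'n \<Rightarrow> real) \<Rightarrow> real ^ 'n \<Rightarrow> real" where
  "pdvs is h = foldr pdv is h"

text \<open>For open \<open>U\<close> this is \<open>C\<close>-infinity: all iterated partial derivatives are
  differentiable, hence continuous, on \<open>U\<close>.\<close>

definition smooth_fun :: "(real ^ 'n::finite) set \<Rightarrow> (real ^ 'n \<Rightarrow> real) \<Rightarrow> bool" where
  "smooth_fun U h \<longleftrightarrow> (\<forall>is. pdvs is h differentiable_on U)"

definition smooth_vec :: "(real ^ 'n::finite) set \<Rightarrow> (real ^ 'n \<Rightarrow> real ^ 'm) \<Rightarrow> bool" where
  "smooth_vec U X \<longleftrightarrow> (\<forall>i. smooth_fun U (\<lambda>x. X x $ i))"

definition smooth_tensor :: "(real ^ 'n::finite) set \<Rightarrow> (real ^ 'n \<Rightarrow> real ^ 'n ^ 'n) \<Rightarrow> bool" where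
  "smooth_tensor U T \<longleftrightarrow> (\<forall>i j. smooth_fun U (\<lambda>x. T x $ i $ j))"

definition riemannian_metric :: "(real ^ 'n::finite) set \<Rightarrow> (real ^ 'n \<Rightarrow> real ^ 'n ^ 'n) \<Rightarrow> bool" where
  "riemannian_metric U g \<longleftrightarrow> smooth_tensor U g \<and>
     (\<forall>x\<in>U. transpose (g x) = g x \<and> (\<forall>v. v \<noteq> 0 \<longrightarrow> 0 < v \<bullet> (g x *v v)))"

definition two_form :: "(real ^ 'n::finite) set \<Rightarrow> (real ^ 'n \<Rightarrow> real ^ 'n ^ 'n) \<Rightarrow> bool" where
  "two_form U F \<longleftrightarrow> smooth_tensor U F \<and> (\<forall>x\<in>U. transpose (F x) = - F x)"

definition ext_deriv :: "(real ^ 'n::finite \<Rightarrow> real ^ 'n) \<Rightarrow> real ^ 'n \<Rightarrow> real ^ 'n ^ 'n" where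
  "ext_deriv A x = (\<chi> i j. pdv i (\<lambda>y. A y $ j) x - pdv j (\<lambda>y. A y $ i) x)"

text \<open>\<open>christoffel g k i j\<close> is the symbol with upper index \<open>k\<close> and lower indices \<open>i\<close>, \<open>j\<close>.\<close>

definition christoffel ::
    "(real ^ 'n::finite \<Rightarrow> real ^ 'n ^ 'n) \<Rightarrow> 'n \<Rightarrow> 'n \<Rightarrow> 'n \<Rightarrow> real ^ 'n \<Rightarrow> real" where
  "christoffel g k i j x =
     (1/2) * (\<Sum>l\<in>UNIV. matrix_inv (g x) $ k $ l *
        (pdv i (\<lambda>y. g y $ j $ l) x + pdv j (\<lambda>y. g y $ i $ l) x - pdv l (\<lambda>y. g y $ i $ j) x))"

text \<open>The sign is the one for which round spheres have positive Ricci tensor.\<close>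

definition ricci :: "(real ^ 'n::finite \<Rightarrow> real ^ 'n ^ 'n) \<Rightarrow> real ^ 'n \<Rightarrow> real ^ 'n ^ 'n" where
  "ricci g x = (\<chi> i j.
     (\<Sum>k\<in>UNIV. pdv k (christoffel g k i j) x - pdv j (christoffel g k i k) x) +
     (\<Sum>k\<in>UNIV. \<Sum>l\<in>UNIV. christoffel g k k l x * christoffel g l i j x
                        - christoffel g k j l x * christoffel g l i k x))"

definition hessian ::
    "(real ^ 'n::finite \<Rightarrow> real ^ 'n ^ 'n) \<Rightarrow> (real ^ 'n \<Rightarrow> real) \<Rightarrow> real ^ 'n \<Rightarrow> real ^ 'n ^ 'n" where
  "hessian g f x = (\<chi> i j. pdv i (pdv j f) x - (\<Sum>k\<in>UNIV. christoffel g k i j x * pdv k f x))"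

definition form_square ::
    "(real ^ 'n::finite \<Rightarrow> real ^ 'n ^ 'n) \<Rightarrow> (real ^ 'n \<Rightarrow> real ^ 'n ^ 'n) \<Rightarrow> real ^ 'n \<Rightarrow> real ^ 'n ^ 'n" where
  "form_square g F x = (\<chi> i j. \<Sum>k\<in>UNIV. \<Sum>l\<in>UNIV. matrix_inv (g x) $ k $ l * F x $ i $ k * F x $ j $ l)"

definition cov_deriv ::
    "(real ^ 'n::finite \<Rightarrow> real ^ 'n ^ 'n) \<Rightarrow> (real ^ 'n \<Rightarrow> real ^ 'n ^ 'n) \<Rightarrow> 'n \<Rightarrow> 'n \<Rightarrow> 'n \<Rightarrow> real ^ 'n \<Rightarrow> real" where
  "cov_deriv g T k i j x = pdv k (\<lambda>y. T y $ i $ j) x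
     - (\<Sum>l\<in>UNIV. christoffel g l k i x * T x $ l $ j + christoffel g l k j x * T x $ i $ l)"

definition divergence ::
    "(real ^ 'n::finite \<Rightarrow> real ^ 'n ^ 'n) \<Rightarrow> (real ^ 'n \<Rightarrow> real ^ 'n ^ 'n) \<Rightarrow> real ^ 'n \<Rightarrow> real ^ 'n" where
  "divergence g T x = (\<chi> j. \<Sum>k\<in>UNIV. \<Sum>i\<in>UNIV. matrix_inv (g x) $ k $ i * cov_deriv g T k i j x)"

definition gradient_rym_soliton ::
    "(real ^ 'n::finite) set \<Rightarrow> (real ^ 'n \<Rightarrow> real ^ 'n ^ 'n) \<Rightarrow> (real ^ 'n \<Rightarrow> real ^ 'n ^ 'n)
      \<Rightarrow> (real ^ 'n \<Rightarrow> real) \<Rightarrow> real \<Rightarrow> bool" where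
  "gradient_rym_soliton U g F f \<kappa> \<longleftrightarrow>
     riemannian_metric U g \<and> two_form U F \<and> smooth_fun U f \<and>
     (\<forall>x\<in>U. ricci g x - (1/2) *\<^sub>R form_square g F x + hessian g f x = \<kappa> *\<^sub>R g x \<and>
             divergence g (\<lambda>y. exp (- f y) *\<^sub>R F y) x = 0)"

definition steady_rym_soliton where
  "steady_rym_soliton U g F f \<longleftrightarrow> gradient_rym_soliton U g F f 0"

definition pullback ::
    "(real ^ 'n::finite \<Rightarrow> real ^ 'n) \<Rightarrow> (real ^ 'n \<Rightarrow> real ^ 'n ^ 'n) \<Rightarrow> real ^ 'n \<Rightarrow> real ^ 'n ^ 'n" where
  "pullback \<Phi> T x = transpose (jacobian \<Phi> (at x)) ** T (\<Phi> x) ** jacobian \<Phi> (at x)"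


section \<open>Rotationally symmetric surfaces\<close>

text \<open>A surface is given in coordinates \<open>x $ 1 = r\<close>, \<open>x $ 2 = \<theta>\<close> on the universal cover
  of its regular part \<open>0 < r < b\<close>, with \<open>b \<le> \<infinity>\<close>. A circle \<open>r = 0\<close> or \<open>r = b\<close> on which
  the length element of the \<open>\<theta>\<close>-circle vanishes is collapsed to one point (a tip) and
  belongs to the surface.\<close>

definition warped :: "(real \<Rightarrow> real) \<Rightarrow> real ^ 2 \<Rightarrow> real ^ 2 ^ 2" where
  "warped \<phi> x = vector [vector [1, 0], vector [0, (\<phi> (x $ 1))\<^sup>2]]"

definition annulus :: "ereal \<Rightarrow> (real ^ 2) set" where
  "annulus b = {x. 0 < x $ 1 \<and> ereal (x $ 1) < b}"

definition strip :: "ereal \<Rightarrow> (real ^ 2 \<Rightarrow> real ^ 2 ^ 2) \<Rightarrow> (real ^ 2) set" where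
  "strip b g = annulus b \<union> {x. (x $ 1 = 0 \<or> ereal (x $ 1) = b) \<and> g x $ 2 $ 2 = 0}"

definition same_point :: "ereal \<Rightarrow> (real ^ 2 \<Rightarrow> real ^ 2 ^ 2) \<Rightarrow> (real ^ 2) rel" where
  "same_point b g = {(x, y). x \<in> strip b g \<and> y \<in> strip b g \<and> x $ 1 = y $ 1 \<and>
     (g x $ 2 $ 2 = 0 \<or> (\<exists>k::int. x $ 2 - y $ 2 = 2 * pi * of_int k))}"

definition points :: "ereal \<Rightarrow> (real ^ 2 \<Rightarrow> real ^ 2 ^ 2) \<Rightarrow> (real ^ 2) set set" where
  "points b g = strip b g // same_point b g"

definition base_point :: "ereal \<Rightarrow> (real ^ 2 \<Rightarrow> real ^ 2 ^ 2) \<Rightarrow> (real ^ 2) set" where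
  "base_point b g = {x \<in> strip b g. x $ 1 = 0}"

definition speed :: "(real ^ 2 \<Rightarrow> real ^ 2 ^ 2) \<Rightarrow> (real \<Rightarrow> real ^ 2) \<Rightarrow> real \<Rightarrow> real" where
  "speed g \<gamma> t = sqrt (vector_derivative \<gamma> (at t) \<bullet> (g (\<gamma> t) *v vector_derivative \<gamma> (at t)))"

text \<open>Integrability of the speed is needed: the library's piecewise \<open>C1\<close> curves may have
  infinite length near a break point, and the integral would then be the default value 0.
  Curves through a tip are covered, since \<open>\<theta>\<close> can be turned there at no cost.\<close>

definition curve_between ::
    "ereal \<Rightarrow> (real ^ 2 \<Rightarrow> real ^ 2 ^ 2) \<Rightarrow> (real ^ 2) set \<Rightarrow> (real ^ 2) set \<Rightarrow> (real \<Rightarrow> real ^ 2) \<Rightarrow> bool" where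
  "curve_between b g P Q \<gamma> \<longleftrightarrow> \<gamma> piecewise_C1_differentiable_on {0..1} \<and>
     \<gamma> ` {0..1} \<subseteq> strip b g \<and> \<gamma> 0 \<in> P \<and> \<gamma> 1 \<in> Q \<and> speed g \<gamma> integrable_on {0..1}"

definition riem_dist ::
    "ereal \<Rightarrow> (real ^ 2 \<Rightarrow> real ^ 2 ^ 2) \<Rightarrow> (real ^ 2) set \<Rightarrow> (real ^ 2) set \<Rightarrow> real" where
  "riem_dist b g P Q =
     (if P \<in> points b g \<and> Q \<in> points b g
      then Inf {integral {0..1} (speed g \<gamma>) | \<gamma>. curve_between b g P Q \<gamma>} else 0)"

definition complete_surface :: "ereal \<Rightarrow> (real ^ 2 \<Rightarrow> real ^ 2 ^ 2) \<Rightarrow> bool" where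
  "complete_surface b g \<longleftrightarrow> Metric_space.mcomplete (points b g) (riem_dist b g)"


section \<open>Uniformizing charts at the tips\<close>

definition disc :: "ereal \<Rightarrow> (real ^ 2) set" where
  "disc b = {z. ereal (norm z) < b}"

definition polar :: "real ^ 2 \<Rightarrow> real ^ 2" where
  "polar x = vector [x $ 1 * cos (x $ 2), x $ 1 * sin (x $ 2)]"

definition rot :: "real \<Rightarrow> real ^ 2 ^ 2" where
  "rot a = vector [vector [cos a, - sin a], vector [sin a, cos a]]"

text \<open>The chart of order \<open>m\<close> at a tip is the \<open>m\<close>-fold map from the disc of radius \<open>b\<close> onto the
  surface minus the opposite tip; here it is written from polar coordinates on the disc to
  the coordinates \<open>(r, \<theta>)\<close>. The tip is at \<open>r = 0\<close>, respectively at \<open>r = B\<close>.\<close>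

definition near_chart :: "nat \<Rightarrow> real ^ 2 \<Rightarrow> real ^ 2" where
  "near_chart m x = vector [x $ 1, real m * x $ 2]"

definition far_chart :: "real \<Rightarrow> nat \<Rightarrow> real ^ 2 \<Rightarrow> real ^ 2" where
  "far_chart B m x = vector [B - x $ 1, real m * x $ 2]"

definition lifts_tensor ::
    "ereal \<Rightarrow> (real ^ 2 \<Rightarrow> real ^ 2) \<Rightarrow> (real ^ 2 \<Rightarrow> real ^ 2 ^ 2) \<Rightarrow> (real ^ 2 \<Rightarrow> real ^ 2 ^ 2) \<Rightarrow> bool" where
  "lifts_tensor b Q T T' \<longleftrightarrow> (\<forall>x\<in>annulus b. pullback polar T' x = pullback Q T x)"

text \<open>A lift is determined by the data on the surface. When the latter have period \<open>2\<pi>\<close> in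
  \<open>\<theta>\<close>, it is automatically invariant under the rotations of the disc by multiples of
  \<open>2\<pi>/m\<close>. What has to be required is smoothness across the centre.\<close>

definition metric_lift ::
    "ereal \<Rightarrow> (real ^ 2 \<Rightarrow> real ^ 2) \<Rightarrow> (real ^ 2 \<Rightarrow> real ^ 2 ^ 2) \<Rightarrow> (real ^ 2 \<Rightarrow> real ^ 2 ^ 2) \<Rightarrow> bool" where
  "metric_lift b Q g G \<longleftrightarrow> riemannian_metric (disc b) G \<and> lifts_tensor b Q g G"

definition potential_lift ::
    "ereal \<Rightarrow> (real ^ 2 \<Rightarrow> real ^ 2) \<Rightarrow> (real ^ 2 \<Rightarrow> real) \<Rightarrow> (real ^ 2 \<Rightarrow> real) \<Rightarrow> bool" where
  "potential_lift b Q f h \<longleftrightarrow> smooth_fun (disc b) h \<and> (\<forall>x\<in>annulus b. h (polar x) = f (Q x))"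

text \<open>The lift \<open>H\<close> of \<open>F\<close> is the curvature of a connection on a \<open>U(1)\<close>-bundle over the disc,
  which is trivial; \<open>A\<close> is the (real) connection form, invariant under the local group.\<close>

definition curvature_lift ::
    "ereal \<Rightarrow> (real ^ 2 \<Rightarrow> real ^ 2) \<Rightarrow> nat \<Rightarrow> (real ^ 2 \<Rightarrow> real ^ 2 ^ 2) \<Rightarrow> (real ^ 2 \<Rightarrow> real ^ 2 ^ 2) \<Rightarrow> bool" where
  "curvature_lift b Q m F H \<longleftrightarrow> two_form (disc b) H \<and> lifts_tensor b Q F H \<and>
     (\<exists>A. smooth_vec (disc b) A \<and>
          (\<forall>z\<in>disc b. ext_deriv A z = H z) \<and>
          (\<forall>z\<in>disc b. transpose (rot (2 * pi / real m)) *v A (rot (2 * pi / real m) *v z) = A z))"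


section \<open>Rotationally symmetric steady solitons\<close>

record rot_rym =
  radius :: ereal
  warp :: "real \<Rightarrow> real"
  curv :: "real ^ 2 \<Rightarrow> real ^ 2 ^ 2"
  pot :: "real ^ 2 \<Rightarrow> real"

definition metric_of :: "rot_rym \<Rightarrow> real ^ 2 \<Rightarrow> real ^ 2 ^ 2" where
  "metric_of S = warped (warp S)"

definition orbifold_tip_near :: "rot_rym \<Rightarrow> nat \<Rightarrow> bool" where
  "orbifold_tip_near S m \<longleftrightarrow> 1 \<le> m \<and> warp S 0 = 0 \<and>
     (warp S has_real_derivative 1 / real m) (at 0 within {0..}) \<and>
     (\<exists>G. metric_lift (radius S) (near_chart m) (metric_of S) G)"

definition orbifold_tip_far :: "rot_rym \<Rightarrow> nat \<Rightarrow> bool" where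
  "orbifold_tip_far S m \<longleftrightarrow> 1 \<le> m \<and> (\<exists>B. radius S = ereal B \<and> warp S B = 0 \<and>
     (warp S has_real_derivative - 1 / real m) (at B within {..B}) \<and>
     (\<exists>G. metric_lift (radius S) (far_chart B m) (metric_of S) G))"

definition rot_symmetric :: "rot_rym \<Rightarrow> bool" where
  "rot_symmetric S \<longleftrightarrow> 0 < radius S \<and>
     (\<forall>r. 0 < r \<and> ereal r < radius S \<longrightarrow> 0 < warp S r) \<and>
     (\<forall>x\<in>annulus (radius S). \<forall>y\<in>annulus (radius S). x $ 1 = y $ 1 \<longrightarrow>
        curv S x = curv S y \<and> pot S x = pot S y)"

definition cone_point_if_closed :: "rot_rym \<Rightarrow> bool" where
  "cone_point_if_closed S \<longleftrightarrow> (\<forall>B. radius S = ereal B \<and> warp S B = 0 \<longrightarrow>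
     (\<exists>c>0. (warp S has_real_derivative - c) (at B within {..B})))"

text \<open>A soliton on a surface with an orbifold point of order \<open>p\<close> at \<open>r = 0\<close>. The equations
  are imposed on the regular part and extend to the centre of a uniformizing chart by
  continuity. At a closing point \<open>r = B\<close> which is not an orbifold point only a cone point is
  required.\<close>

definition rot_steady_soliton :: "nat \<Rightarrow> rot_rym \<Rightarrow> bool" where
  "rot_steady_soliton p S \<longleftrightarrow>
     rot_symmetric S \<and> cone_point_if_closed S \<and>
     steady_rym_soliton (annulus (radius S)) (metric_of S) (curv S) (pot S) \<and>
     orbifold_tip_near S p \<and>
     (\<exists>h. potential_lift (radius S) (near_chart p) (pot S) h) \<and>
     (\<exists>H. curvature_lift (radius S) (near_chart p) p (curv S) H) \<and>
     (\<forall>q B. orbifold_tip_far S q \<and> radius S = ereal B \<longrightarrow>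
        (\<exists>h. potential_lift (radius S) (far_chart B q) (pot S) h) \<and>
        (\<exists>H. curvature_lift (radius S) (far_chart B q) q (curv S) H))"

definition football_orbifold :: "nat \<Rightarrow> nat \<Rightarrow> rot_rym \<Rightarrow> bool" where
  "football_orbifold p q S \<longleftrightarrow> rot_symmetric S \<and> orbifold_tip_near S p \<and> orbifold_tip_far S q"

definition continuous_family :: "real set \<Rightarrow> (real \<Rightarrow> rot_rym) \<Rightarrow> bool" where
  "continuous_family I S \<longleftrightarrow>
     continuous_on I (\<lambda>l. radius (S l)) \<and>
     (let D = {(l, x). l \<in> I \<and> x \<in> annulus (radius (S l))} in
        continuous_on D (\<lambda>(l, x). metric_of (S l) x) \<and>
        continuous_on D (\<lambda>(l, x). curv (S l) x) \<and>
        continuous_on D (\<lambda>(l, x). pot (S l) x))"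

definition cigar_quotient :: "nat \<Rightarrow> real ^ 2 \<Rightarrow> real ^ 2 ^ 2" where
  "cigar_quotient p = warped (\<lambda>s. tanh s / real p)"

definition cusp_metric :: "nat \<Rightarrow> real ^ 2 \<Rightarrow> real ^ 2 ^ 2" where
  "cusp_metric p = warped (\<lambda>r. r / (real p + r\<^sup>2 / 2))"

definition round_football :: "nat \<Rightarrow> real ^ 2 \<Rightarrow> real ^ 2 ^ 2" where
  "round_football p = warped (\<lambda>r. sin r / real p)"


section \<open>Convergence\<close>

text \<open>Smooth orbifold embeddings, given by their lifts to the charts of order \<open>p\<close> at the base
  points. The integer \<open>k\<close> allows for an automorphism of the local group.\<close>

definition orbifold_embedding ::
    "nat \<Rightarrow> (real ^ 2) set \<Rightarrow> (real ^ 2) set \<Rightarrow> (real ^ 2 \<Rightarrow> real ^ 2) \<Rightarrow> bool" where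
  "orbifold_embedding p U V \<Phi> \<longleftrightarrow>
     open U \<and> 0 \<in> U \<and> (\<forall>z\<in>U. rot (2 * pi / real p) *v z \<in> U) \<and>
     smooth_vec U \<Phi> \<and> inj_on \<Phi> U \<and> (\<forall>z\<in>U. det (jacobian \<Phi> (at z)) \<noteq> 0) \<and>
     \<Phi> ` U \<subseteq> V \<and> \<Phi> 0 = 0 \<and>
     (\<exists>k::int. \<forall>z\<in>U. \<Phi> (rot (2 * pi / real p) *v z) = rot (2 * pi * of_int k / real p) *v \<Phi> z)"

text \<open>Pointed Cheeger-Gromov convergence of a family of smooth orbifolds to the orbifold
  \<open>(b', g')\<close>, all with base point the tip of order \<open>p\<close> at \<open>r = 0\<close>: the limit is exhausted by
  open sets carrying pointed embeddings into the members of the family, along which the metrics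
  converge with all derivatives, uniformly on compact sets.\<close>

definition cheeger_gromov_conv ::
    "nat \<Rightarrow> (real \<Rightarrow> rot_rym) \<Rightarrow> ereal \<Rightarrow> (real ^ 2 \<Rightarrow> real ^ 2 ^ 2) \<Rightarrow> real filter \<Rightarrow> bool" where
  "cheeger_gromov_conv p S b' g' \<F> \<longleftrightarrow>
     (\<forall>\<^sub>F l in \<F>. \<forall>B. radius (S l) = ereal B \<and> warp (S l) B = 0 \<longrightarrow> (\<exists>q. orbifold_tip_far (S l) q)) \<and>
     (\<exists>G G' U \<Phi>.
        metric_lift b' (near_chart p) g' G' \<and>
        (\<forall>\<^sub>F l in \<F>. metric_lift (radius (S l)) (near_chart p) (metric_of (S l)) (G l) \<and>
            U l \<subseteq> disc b' \<and> orbifold_embedding p (U l) (disc (radius (S l))) (\<Phi> l)) \<and>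
        (\<forall>K. compact K \<and> K \<subseteq> disc b' \<longrightarrow>
            (\<forall>\<^sub>F l in \<F>. K \<subseteq> U l) \<and>
            (\<forall>is i j. uniform_limit K (\<lambda>l. pdvs is (\<lambda>z. pullback (\<Phi> l) (G l) z $ i $ j))
                         (pdvs is (\<lambda>z. G' z $ i $ j)) \<F>)))"

text \<open>Pointed Gromov-Hausdorff convergence in the form of Burago-Burago-Ivanov, Definition 8.1.1.\<close>

definition pointed_gh_conv ::
    "('i \<Rightarrow> 'a set) \<Rightarrow> ('i \<Rightarrow> 'a \<Rightarrow> 'a \<Rightarrow> real) \<Rightarrow> ('i \<Rightarrow> 'a) \<Rightarrow>
      'b set \<Rightarrow> ('b \<Rightarrow> 'b \<Rightarrow> real) \<Rightarrow> 'b \<Rightarrow> 'i filter \<Rightarrow> bool" where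
  "pointed_gh_conv X dX x0 Y dY y0 \<F> \<longleftrightarrow>
     (\<forall>R>0. \<forall>\<epsilon>>0. \<forall>\<^sub>F l in \<F>. \<exists>h.
        (let Ball = {x \<in> X l. dX l (x0 l) x < R} in
          h ` Ball \<subseteq> Y \<and> h (x0 l) = y0 \<and>
          (\<forall>x\<in>Ball. \<forall>x'\<in>Ball. \<bar>dY (h x) (h x') - dX l x x'\<bar> < \<epsilon>) \<and>
          (\<forall>y\<in>Y. dY y0 y < R - \<epsilon> \<longrightarrow> (\<exists>x\<in>Ball. dY (h x) y < \<epsilon>))))"

text \<open>The infimum of the Hausdorff distances of \<open>X\<close> and \<open>Y\<close> over all metrics on their disjoint
  union which extend the given ones.\<close>

definition gh_dist :: "'a set \<Rightarrow> ('a \<Rightarrow> 'a \<Rightarrow> real) \<Rightarrow> 'b set \<Rightarrow> ('b \<Rightarrow> 'b \<Rightarrow> real) \<Rightarrow> ennreal" where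
  "gh_dist X dX Y dY = Inf {ennreal r | r. 0 < r \<and> (\<exists>d. Metric_space (X <+> Y) d \<and>
     (\<forall>x\<in>X. \<forall>x'\<in>X. d (Inl x) (Inl x') = dX x x') \<and>
     (\<forall>y\<in>Y. \<forall>y'\<in>Y. d (Inr y) (Inr y') = dY y y') \<and>
     (\<forall>x\<in>X. \<exists>y\<in>Y. d (Inl x) (Inr y) < r) \<and>
     (\<forall>y\<in>Y. \<exists>x\<in>X. d (Inl x) (Inr y) < r))}"

definition pointed_gh_surfaces ::
    "(real \<Rightarrow> rot_rym) \<Rightarrow> ereal \<Rightarrow> (real ^ 2 \<Rightarrow> real ^ 2 ^ 2) \<Rightarrow> real filter \<Rightarrow> bool" where
  "pointed_gh_surfaces S b' g' \<F> \<longleftrightarrow>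
     pointed_gh_conv
       (\<lambda>l. points (radius (S l)) (metric_of (S l)))
       (\<lambda>l. riem_dist (radius (S l)) (metric_of (S l)))
       (\<lambda>l. base_point (radius (S l)) (metric_of (S l)))
       (points b' g') (riem_dist b' g') (base_point b' g') \<F>"

text \<open>The metrics of the family rescaled by the factors \<open>c\<close>. The tensors are scaled in the
  fixed coordinates, so the coordinate range stays the same.\<close>

definition rescaled_gh_surfaces ::
    "(real \<Rightarrow> real) \<Rightarrow> (real \<Rightarrow> rot_rym) \<Rightarrow> ereal \<Rightarrow> (real ^ 2 \<Rightarrow> real ^ 2 ^ 2) \<Rightarrow> real filter \<Rightarrow> bool" where
  "rescaled_gh_surfaces c S b' g' \<F> \<longleftrightarrow>
     ((\<lambda>l. gh_dist
         (points (radius (S l)) (\<lambda>x. c l *\<^sub>R metric_of (S l) x))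
         (riem_dist (radius (S l)) (\<lambda>x. c l *\<^sub>R metric_of (S l) x))
         (points b' g') (riem_dist b' g')) \<longlongrightarrow> 0) \<F>"

end

theory Submission
  imports Defs
begin

text \<open>
  On a surface \<open>dr\<^sup>2 + \<phi>\<^sup>2 d\<theta>\<^sup>2\<close> with rotation invariant data, the equation for \<open>F\<close> says that \<open>F\<close> is
  a constant \<open>c\<close> times \<open>e\<^sup>f\<close> times the area form, and the trace-free part of the equation for \<open>g\<close>
  says that \<open>f'\<close> is a constant multiple of \<open>\<phi>\<close>, which can be normalized to \<open>f' = - \<phi>\<close>. In terms
  of \<open>v = exp (- f)\<close> the remaining scalar equation becomes linear after one integration:
  \<open>v'' = 1/p - l (v - 1)\<close> with a free constant \<open>l\<close>, where \<open>v(0) = 1\<close>, \<open>v'(0) = 0\<close>, and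
  \<open>c\<^sup>2 = 2 (2/p + l)\<close>, whence \<open>l \<ge> - 2/p\<close>. So \<open>v = 1 + vers l r / p\<close>, where \<open>vers l r\<close> is
  \<open>(1 - cos (\<surd>l r)) / l\<close>, its limit \<open>r\<^sup>2 / 2\<close> or its hyperbolic analogue, and \<open>\<phi> = v' / v\<close>. As
  \<open>v \<ge> 1\<close> always, \<open>\<phi>\<close> stays positive up to the first zero of \<open>v'\<close>: for \<open>l \<le> 0\<close> there is none and
  the surface is \<open>\<real>\<^sup>2 / \<int>\<^sub>p\<close>, for \<open>l > 0\<close> it closes up at \<open>r = \<pi> / \<surd>l\<close> with slope
  \<open>- l / (p l + 2)\<close>. This slope is \<open>- 1 / q\<close> exactly for \<open>l = 2 / (q - p)\<close>.

  Smoothness at the tips and in the parameter comes from Stumpff functions, which are entire: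
  \<open>vers l r\<close> is \<open>r\<^sup>2\<close> times an entire function of \<open>l r\<^sup>2\<close>, and \<open>v'\<close> is \<open>r\<close> times such a function. Hence
  the metric, the curvature form, a connection form and the potential lift to expressions in \<open>x\<close>,
  \<open>y\<close> and entire functions of \<open>l (x\<^sup>2 + y\<^sup>2)\<close> (\<open>metric_lift_chart_metric\<close>,
  \<open>curvature_lift_area_form\<close>); a reflection of the interval brings the second tip to the same normal
  form. All members with \<open>l \<le> 0\<close> live on one chart \<open>\<real>\<^sup>2\<close>, and their derivatives of all orders are
  continuous in \<open>l\<close>, which gives both Cheeger-Gromov limits (\<open>cheeger_gromov_soliton\<close>): the member at
  \<open>l = - 2/p\<close> is the cigar and the member at \<open>l = 0\<close> is the cusp.

  The other two limits and completeness concern the distance. A rotationally symmetric surface is a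
  complete metric space, in which coordinates bound the distance from above and from below
  (\<open>riem_dist_le_coords\<close>, \<open>riem_dist_radial\<close>, \<open>riem_dist_pos\<close>), and a pointwise comparison of two
  warping functions up to a factor compares the distances (\<open>riem_dist_affine_chart\<close>). For \<open>l \<rightarrow> 0\<close>
  the quotient of the warping functions tends to 1 uniformly on bounded intervals. For \<open>l \<rightarrow> \<infinity>\<close> the
  rescaled metric \<open>l g\<close> has, in the coordinate \<open>\<rho> = \<surd>l r\<close>, the warping function \<open>sin \<rho> / (p v)\<close> with
  \<open>1 \<le> v \<le> 1 + 2 / (p l)\<close>, and a bound \<open>dX \<le> dY \<le> dX + \<delta>\<close> under a bijection bounds the
  Gromov-Hausdorff distance (\<open>gh_dist_le\<close>).
\<close>

section \<open>Stumpff functions\<close>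

text \<open>At \<open>t = x\<^sup>2\<close> the Stumpff functions of order 0, 1, 2 are \<open>cos x\<close>, \<open>sin x / x\<close> and
  \<open>(1 - cos x) / x\<^sup>2\<close>; at \<open>t = - x\<^sup>2\<close> they are the hyperbolic counterparts. Since they are entire in
  \<open>t\<close>, formulas written with them hold for all signs of \<open>t\<close> and depend smoothly on \<open>t\<close> at \<open>0\<close>.\<close>

definition stumpff_coeff :: "nat \<Rightarrow> nat \<Rightarrow> real" where
  "stumpff_coeff k n = (- 1) ^ n / fact (2 * n + k)"

definition stumpff :: "nat \<Rightarrow> real \<Rightarrow> real" where
  "stumpff k t = (\<Sum>n. stumpff_coeff k n * t ^ n)"

lemma summable_stumpff: "summable (\<lambda>n. stumpff_coeff k n * t ^ n)"
proof (rule summable_comparison_test')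
  show "summable (\<lambda>n. inverse (fact n) * \<bar>t\<bar> ^ n)"
    by (rule summable_exp)
  fix n :: nat
  have "(fact n :: real) \<le> fact (2 * n + k)" by (rule fact_mono) simp
  then have "inverse (fact (2 * n + k)) \<le> (inverse (fact n) :: real)"
    by (rule le_imp_inverse_le) simp
  then show "norm (stumpff_coeff k n * t ^ n) \<le> inverse (fact n) * \<bar>t\<bar> ^ n"
    by (simp add: stumpff_coeff_def abs_mult power_abs divide_inverse mult_right_mono)
qed

lemma stumpff_sums: "(\<lambda>n. stumpff_coeff k n * t ^ n) sums stumpff k t"
  unfolding stumpff_def by (rule summable_sums[OF summable_stumpff])

lemma stumpff_0 [simp]: "stumpff k 0 = 1 / fact k"
  using powser_zero[of "stumpff_coeff k"] by (simp add: stumpff_def stumpff_coeff_def)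

lemma stumpff_rec: "stumpff k t = 1 / fact k - t * stumpff (k + 2) t"
proof -
  have "(\<lambda>n. stumpff_coeff k (Suc n) * t ^ Suc n) sums (- t * stumpff (k + 2) t)"
    using sums_mult[OF stumpff_sums, of "- t" "k + 2" t]
    by (simp add: stumpff_coeff_def algebra_simps)
  then have "(\<lambda>n. stumpff_coeff k n * t ^ n) sums (- t * stumpff (k + 2) t + stumpff_coeff k 0 * t ^ 0)"
    by (rule sums_Suc)
  then show ?thesis
    using stumpff_sums[of k t] sums_unique2 by (fastforce simp: stumpff_coeff_def)
qed

definition entire_series :: "(nat \<Rightarrow> real) \<Rightarrow> bool" where
  "entire_series a \<longleftrightarrow> (\<forall>t. summable (\<lambda>n. a n * t ^ n))"

lemma entire_series_diffs: "entire_series a \<Longrightarrow> entire_series (diffs a)"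
  unfolding entire_series_def using termdiff_converges_all by blast

lemma DERIV_entire_series:
  "entire_series a \<Longrightarrow> DERIV (\<lambda>t. \<Sum>n. a n * t ^ n) t :> (\<Sum>n. diffs a n * t ^ n)"
  unfolding entire_series_def by (rule termdiffs_strong_converges_everywhere) blast

lemma entire_series_stumpff: "entire_series (stumpff_coeff k)"
  unfolding entire_series_def using summable_stumpff by blast

definition stumpff' :: "nat \<Rightarrow> real \<Rightarrow> real" where
  "stumpff' k t = (\<Sum>n. diffs (stumpff_coeff k) n * t ^ n)"

lemma DERIV_stumpff: "DERIV (stumpff k) t :> stumpff' k t"
  using DERIV_entire_series[OF entire_series_stumpff]
  unfolding stumpff'_def stumpff_def[abs_def] .

text \<open>On coefficients this is \<open>2n / (2n + k + 1)! = 1 / (2n + k)! - (k + 1) / (2n + k + 1)!\<close>.\<close>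

lemma stumpff'_eq: "2 * t * stumpff' (Suc k) t = stumpff k t - Suc k * stumpff (Suc k) t"
proof -
  have "(\<lambda>n. diffs (stumpff_coeff (Suc k)) n * t ^ n) sums stumpff' (Suc k) t"
    unfolding stumpff'_def using entire_series_diffs[OF entire_series_stumpff]
    by (intro summable_sums) (simp add: entire_series_def)
  from sums_mult[OF this, of "2 * t"]
  have "(\<lambda>n. 2 * of_nat (Suc n) * stumpff_coeff (Suc k) (Suc n) * t ^ Suc n)
      sums (2 * t * stumpff' (Suc k) t)"
    by (simp add: diffs_def algebra_simps)
  then have "(\<lambda>n. 2 * of_nat n * stumpff_coeff (Suc k) n * t ^ n)
      sums (2 * t * stumpff' (Suc k) t + 2 * of_nat 0 * stumpff_coeff (Suc k) 0 * t ^ 0)"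
    by (rule sums_Suc)
  then have 1: "(\<lambda>n. 2 * of_nat n * stumpff_coeff (Suc k) n * t ^ n) sums (2 * t * stumpff' (Suc k) t)"
    by simp
  have "(\<lambda>n. 2 * of_nat n * stumpff_coeff (Suc k) n * t ^ n
          + Suc k * (stumpff_coeff (Suc k) n * t ^ n)) sums
        (2 * t * stumpff' (Suc k) t + Suc k * stumpff (Suc k) t)"
    by (intro sums_add 1 sums_mult stumpff_sums)
  moreover have "2 * of_nat n * stumpff_coeff (Suc k) n * t ^ n
      + Suc k * (stumpff_coeff (Suc k) n * t ^ n) = stumpff_coeff k n * t ^ n" for n
    by (simp add: stumpff_coeff_def divide_simps) (simp add: algebra_simps)
  ultimately show ?thesis
    using stumpff_sums[of k t] sums_unique2 by fastforce
qed

lemma sums_even_part: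
  assumes "f sums (s::real)" and "\<And>n. odd n \<Longrightarrow> f n = 0"
  shows "(\<lambda>n. f (2 * n)) sums s"
proof -
  have "strict_mono (\<lambda>n::nat. 2 * n)" by (simp add: strict_mono_def)
  moreover have "f n = 0" if "n \<notin> range (\<lambda>n. 2 * n)" for n
    using that assms(2)[of n] by (auto elim: evenE)
  ultimately show ?thesis using sums_mono_reindex[of "\<lambda>n. 2 * n" f s] assms(1) by blast
qed

lemma sums_odd_part:
  assumes "f sums (s::real)" and "\<And>n. even n \<Longrightarrow> f n = 0"
  shows "(\<lambda>n. f (2 * n + 1)) sums s"
proof -
  have "strict_mono (\<lambda>n::nat. 2 * n + 1)" by (simp add: strict_mono_def)
  moreover have "f n = 0" if "n \<notin> range (\<lambda>n. 2 * n + 1)" for n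
    using that assms(2)[of n] by (metis oddE rangeI)
  ultimately show ?thesis using sums_mono_reindex[of "\<lambda>n. 2 * n + 1" f s] assms(1) by blast
qed

lemma stumpff_cos: "stumpff 0 (x\<^sup>2) = cos x"
proof -
  have "(\<lambda>n. stumpff_coeff 0 n * (x\<^sup>2) ^ n) sums cos x"
    using cos_paired[of x] by (simp add: stumpff_coeff_def power_mult)
  then show ?thesis using stumpff_sums sums_unique2 by blast
qed

lemma stumpff_sin: "x * stumpff 1 (x\<^sup>2) = sin x"
proof -
  have "(\<lambda>n. x * (stumpff_coeff 1 n * (x\<^sup>2) ^ n)) sums sin x"
    using sin_paired[of x] by (simp add: stumpff_coeff_def power_mult mult_ac flip: power_mult)
  then show ?thesis using sums_mult[OF stumpff_sums] sums_unique2 by blast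
qed

lemma stumpff_cosh: "stumpff 0 (- x\<^sup>2) = cosh x"
proof -
  have "(\<lambda>n. x ^ (2 * n) / fact (2 * n)) sums cosh x"
    using sums_even_part[OF cosh_converges[of x]] by (simp add: field_simps)
  moreover have "x ^ (2 * n) / fact (2 * n) = stumpff_coeff 0 n * (- x\<^sup>2) ^ n" for n
    by (simp add: stumpff_coeff_def power_mult power_minus[of "x\<^sup>2"])
  ultimately show ?thesis using stumpff_sums[of 0 "- x\<^sup>2"] sums_unique2 by fastforce
qed

lemma stumpff_sinh: "x * stumpff 1 (- x\<^sup>2) = sinh x"
proof -
  have "(\<lambda>n. x ^ (2 * n + 1) / fact (2 * n + 1)) sums sinh x"
    using sums_odd_part[OF sinh_converges[of x]] by (simp add: field_simps)
  moreover have "x ^ (2 * n + 1) / fact (2 * n + 1) = x * (stumpff_coeff 1 n * (- x\<^sup>2) ^ n)" for n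
    by (simp add: stumpff_coeff_def power_mult power_minus[of "x\<^sup>2"])
  ultimately have "(\<lambda>n. x * (stumpff_coeff 1 n * (- x\<^sup>2) ^ n)) sums sinh x" by simp
  then show ?thesis using sums_mult[OF stumpff_sums] sums_unique2 by blast
qed

lemma real_square_cases:
  fixes t :: real
  obtains (zero) "t = 0" | (pos) x where "x > 0" "t = x\<^sup>2" | (neg) x where "x > 0" "t = - x\<^sup>2"
proof -
  consider "t = 0" | "t > 0" | "t < 0" by linarith
  then show ?thesis
  proof cases
    case 2 then show ?thesis using pos[of "sqrt t"] by simp
  next
    case 3 then show ?thesis using neg[of "sqrt (- t)"] by simp
  qed (use zero in blast)
qed

text \<open>This is \<open>sin\<^sup>2 = (1 - cos) (1 + cos)\<close>, respectively \<open>sinh\<^sup>2 = (cosh - 1) (cosh + 1)\<close>, divided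
  by \<open>t\<close>.\<close>

lemma stumpff_pythagoras: "(stumpff 1 t)\<^sup>2 = 2 * stumpff 2 t - t * (stumpff 2 t)\<^sup>2"
proof (cases t rule: real_square_cases)
  case zero then show ?thesis by (simp add: power2_eq_square)
next
  case (pos x)
  have E: "t * stumpff 2 t = 1 - cos x"
    using stumpff_rec[of 0 t] stumpff_cos[of x] pos by (simp add: numeral_2_eq_2)
  have "t * (stumpff 1 t)\<^sup>2 = (sin x)\<^sup>2"
    using stumpff_sin[of x] pos by (metis power_mult_distrib)
  also have "\<dots> = t * stumpff 2 t * (2 - t * stumpff 2 t)"
    unfolding E by (simp add: sin_squared_eq power2_eq_square algebra_simps)
  finally have "t * ((stumpff 1 t)\<^sup>2 - (2 * stumpff 2 t - t * (stumpff 2 t)\<^sup>2)) = 0"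
    by (simp add: algebra_simps power2_eq_square)
  then show ?thesis using pos by simp
next
  case (neg x)
  have E: "t * stumpff 2 t = 1 - cosh x"
    using stumpff_rec[of 0 t] stumpff_cosh[of x] neg by (simp add: numeral_2_eq_2)
  have "- t * (stumpff 1 t)\<^sup>2 = (sinh x)\<^sup>2"
    using stumpff_sinh[of x] neg by (metis minus_minus power_mult_distrib)
  also have "\<dots> = - (t * stumpff 2 t * (2 - t * stumpff 2 t))"
    unfolding E by (simp add: sinh_square_eq) (simp add: power2_eq_square algebra_simps)
  finally have "t * ((stumpff 1 t)\<^sup>2 - (2 * stumpff 2 t - t * (stumpff 2 t)\<^sup>2)) = 0"
    by (simp add: algebra_simps power2_eq_square)
  then show ?thesis using neg by simp
qed

lemma stumpff_2_nonneg: "0 \<le> stumpff 2 t"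
proof (cases t rule: real_square_cases)
  case zero then show ?thesis by simp
next
  case (pos x)
  have E: "t * stumpff 2 t = 1 - cos x"
    using stumpff_rec[of 0 t] stumpff_cos[of x] pos by (simp add: numeral_2_eq_2)
  then have "0 \<le> t * stumpff 2 t" by simp
  then show ?thesis using pos by (simp add: zero_le_mult_iff)
next
  case (neg x)
  have E: "t * stumpff 2 t = 1 - cosh x"
    using stumpff_rec[of 0 t] stumpff_cosh[of x] neg by (simp add: numeral_2_eq_2)
  then have "t * stumpff 2 t \<le> 0" using cosh_real_ge_1 by simp
  moreover have "t < 0" using neg by simp
  ultimately show ?thesis by (simp add: mult_le_0_iff)
qed

lemma stumpff_1_pos: "t < pi\<^sup>2 \<Longrightarrow> 0 < stumpff 1 t"
proof (cases t rule: real_square_cases)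
  case zero then show ?thesis by simp
next
  case (pos x)
  assume "t < pi\<^sup>2"
  then have "x < pi" using pos by (metis pi_gt_zero power_less_imp_less_base less_imp_le)
  then have "0 < x * stumpff 1 t" using pos stumpff_sin[of x] sin_gt_zero[of x] by simp
  then show ?thesis using pos by (simp add: zero_less_mult_iff)
next
  case (neg x)
  then have "0 < x * stumpff 1 t" using stumpff_sinh[of x] by simp
  then show ?thesis using neg by (simp add: zero_less_mult_iff)
qed

text \<open>The simplifier rewrites the index \<open>1\<close> to \<open>Suc 0\<close>.\<close>

lemmas stumpff_Suc_0_pos = stumpff_1_pos[unfolded One_nat_def]

section \<open>Smooth families of functions\<close>

lemma pdv_eq_has_derivative:
  assumes "(h has_derivative h') (at x)"
  shows "pdv i h x = h' (axis i 1)"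
proof -
  have l: "((\<lambda>t::real. x + t *\<^sub>R axis i 1) has_derivative (\<lambda>t. t *\<^sub>R axis i 1)) (at 0)"
    by (auto intro!: derivative_eq_intros)
  have "((\<lambda>t. h (x + t *\<^sub>R axis i 1)) has_derivative (\<lambda>t. h' (t *\<^sub>R axis i 1))) (at 0)"
    using diff_chain_at[OF l, of h h'] assms by (simp add: o_def)
  moreover have "h' (t *\<^sub>R axis i 1) = h' (axis i 1) * t" for t
    using linear_cmul[OF has_derivative_linear[OF assms], of t "axis i 1"] by simp
  ultimately have "((\<lambda>t. h (x + t *\<^sub>R axis i 1)) has_derivative (*) (h' (axis i 1))) (at 0)"
    by (simp add: fun_eq_iff)
  then show ?thesis
    unfolding pdv_def by (intro DERIV_imp_deriv) (simp add: has_field_derivative_def)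
qed

lemma pdv_cong_open:
  assumes "open U" "x \<in> U" "\<And>y. y \<in> U \<Longrightarrow> h y = k y"
  shows "pdv i h x = pdv i k x"
  unfolding pdv_def
proof (rule deriv_cong_ev)
  have "((\<lambda>t::real. x + t *\<^sub>R axis i 1) \<longlongrightarrow> x + 0 *\<^sub>R axis i 1) (nhds 0)"
    by (intro tendsto_intros filterlim_ident)
  then have "\<forall>\<^sub>F t::real in nhds 0. x + t *\<^sub>R axis i 1 \<in> U"
    using assms(1,2) by (simp add: topological_tendstoD)
  then show "\<forall>\<^sub>F t in nhds 0. h (x + t *\<^sub>R axis i 1) = k (x + t *\<^sub>R axis i 1)"
    by (rule eventually_mono) (rule assms(3))
qed simp

text \<open>Convergence of a family of metrics with all derivatives follows from smoothness in \<open>x\<close>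
  together with continuity of all \<open>x\<close>-derivatives in \<open>(l, x)\<close>. The classes of finite order \<open>k\<close>
  make induction on \<open>k\<close> available: a partial derivative of a product or of a composite is built by
  sums and products from functions whose order is one less.\<close>

fun C_family :: "nat \<Rightarrow> real set \<Rightarrow> (real ^ 'n::finite) set \<Rightarrow> (real \<Rightarrow> real ^ 'n \<Rightarrow> real) \<Rightarrow> bool" where
  "C_family 0 L U h \<longleftrightarrow> continuous_on (L \<times> U) (\<lambda>(l, x). h l x)"
| "C_family (Suc k) L U h \<longleftrightarrow> continuous_on (L \<times> U) (\<lambda>(l, x). h l x) \<and>
     (\<forall>l\<in>L. h l differentiable_on U) \<and> (\<forall>i. C_family k L U (\<lambda>l. pdv i (h l)))"

definition smooth_family :: "real set \<Rightarrow> (real ^ 'n::finite) set \<Rightarrow> (real \<Rightarrow> real ^ 'n \<Rightarrow> real) \<Rightarrow> bool" where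
  "smooth_family L U h \<longleftrightarrow> (\<forall>k. C_family k L U h)"

lemma C_family_continuous: "C_family k L U h \<Longrightarrow> continuous_on (L \<times> U) (\<lambda>(l, x). h l x)"
  by (cases k) auto

lemma C_family_Suc: "C_family (Suc k) L U h \<Longrightarrow> C_family k L U h"
  by (induction k arbitrary: h) auto

lemma C_family_cong:
  assumes "open U" "\<And>l x. l \<in> L \<Longrightarrow> x \<in> U \<Longrightarrow> h l x = h' l x" "C_family k L U h"
  shows "C_family k L U h'"
  using assms(2,3)
proof (induction k arbitrary: h h')
  case 0
  have "continuous_on (L \<times> U) (\<lambda>(l, x). h l x) \<longleftrightarrow> continuous_on (L \<times> U) (\<lambda>(l, x). h' l x)"
    by (rule continuous_on_cong) (use 0 in auto)
  then show ?case using 0 by simp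
next
  case (Suc k)
  have "continuous_on (L \<times> U) (\<lambda>(l, x). h l x) \<longleftrightarrow> continuous_on (L \<times> U) (\<lambda>(l, x). h' l x)"
    by (rule continuous_on_cong) (use Suc in auto)
  moreover have "h' l differentiable_on U" if "l \<in> L" for l
    unfolding differentiable_on_def
  proof
    fix x assume "x \<in> U"
    have "h l differentiable at x within U"
      using Suc.prems(2) that \<open>x \<in> U\<close> by (simp add: differentiable_on_def)
    then show "h' l differentiable at x within U"
      by (rule differentiable_transform_within[where d = 1])
        (use Suc.prems(1) that \<open>x \<in> U\<close> in auto)
  qed
  moreover have "C_family k L U (\<lambda>l. pdv i (h' l))" for i
    by (rule Suc.IH[of "\<lambda>l. pdv i (h l)"])
      (use Suc.prems in \<open>auto intro!: pdv_cong_open[OF assms(1)]\<close>)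
  ultimately show ?case using Suc.prems by auto
qed

lemma C_family_SucI:
  assumes "open U" "C_family k L U h"
    "\<And>l x. l \<in> L \<Longrightarrow> x \<in> U \<Longrightarrow> (h l has_derivative h' l x) (at x)"
    "\<And>i. C_family k L U (\<lambda>l x. h' l x (axis i 1))"
  shows "C_family (Suc k) L U h"
proof -
  have "C_family k L U (\<lambda>l. pdv i (h l))" for i
    by (rule C_family_cong[OF assms(1) _ assms(4)[of i]])
      (simp add: pdv_eq_has_derivative[OF assms(3)])
  moreover have "h l differentiable_on U" if "l \<in> L" for l
    using assms(3)[OF that] by (auto simp: differentiable_on_def differentiable_def
        intro: has_derivative_at_withinI)
  ultimately show ?thesis using C_family_continuous[OF assms(2)] by simp
qed

lemma C_family_derivative:
  assumes "open U" "C_family (Suc k) L U h" "l \<in> L" "x \<in> U"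
  shows "(h l has_derivative frechet_derivative (h l) (at x)) (at x)"
    and "frechet_derivative (h l) (at x) (axis i 1) = pdv i (h l) x"
proof -
  show 1: "(h l has_derivative frechet_derivative (h l) (at x)) (at x)"
    using assms by (metis C_family.simps(2) differentiable_on_eq_differentiable_at frechet_derivative_works)
  show "frechet_derivative (h l) (at x) (axis i 1) = pdv i (h l) x"
    using pdv_eq_has_derivative[OF 1] by simp
qed

lemma C_family_pdv: "C_family (Suc k) L U h \<Longrightarrow> C_family k L U (\<lambda>l. pdv i (h l))"
  by simp

lemma C_family_param:
  assumes "open U" "continuous_on L a"
  shows "C_family k L U (\<lambda>l x. a l)"
  using assms(2)
proof (induction k arbitrary: a)
  case 0
  then show ?case by (auto simp: split_def intro!: continuous_intros continuous_on_compose2[OF 0])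
next
  case (Suc k)
  show ?case
    by (rule C_family_SucI[OF assms(1) Suc.IH[OF Suc.prems], of "\<lambda>l x v. 0"])
      (use Suc.IH[of "\<lambda>_. 0"] in auto)
qed

lemma C_family_coord:
  assumes "open U" shows "C_family k L U (\<lambda>l x. x $ i)"
proof (induction k)
  case 0
  then show ?case by (auto simp: split_def intro!: continuous_intros)
next
  case (Suc k)
  show ?case
    by (rule C_family_SucI[OF assms(1) Suc.IH, of "\<lambda>l x v. v $ i"])
      (auto intro!: bounded_linear_imp_has_derivative bounded_linear_vec_nth C_family_param assms)
qed

lemma C_family_add:
  assumes "open U" "C_family k L U f" "C_family k L U g"
  shows "C_family k L U (\<lambda>l x. f l x + g l x)"
  using assms(2,3)
proof (induction k arbitrary: f g)
  case 0
  then show ?case by (auto simp: split_def intro!: continuous_on_add)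
next
  case (Suc k)
  note D = C_family_derivative[OF assms(1) Suc.prems(1)] C_family_derivative[OF assms(1) Suc.prems(2)]
  show ?case
  proof (rule C_family_SucI[OF assms(1) Suc.IH])
    fix l x assume lx: "l \<in> L" "x \<in> U"
    show "((\<lambda>x. f l x + g l x) has_derivative
        (\<lambda>v. frechet_derivative (f l) (at x) v + frechet_derivative (g l) (at x) v)) (at x)"
      by (intro has_derivative_add D lx)
  next
    fix i
    show "C_family k L U (\<lambda>l x. frechet_derivative (f l) (at x) (axis i 1)
         + frechet_derivative (g l) (at x) (axis i 1))"
      by (rule C_family_cong[OF assms(1) _ Suc.IH[OF Suc.prems[THEN C_family_pdv, of i]]])
        (simp add: D)
  qed (use Suc.prems[THEN C_family_Suc] in auto)
qed

lemma C_family_mult: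
  assumes "open U" "C_family k L U f" "C_family k L U g"
  shows "C_family k L U (\<lambda>l x. f l x * g l x)"
  using assms(2,3)
proof (induction k arbitrary: f g)
  case 0
  then show ?case by (auto simp: split_def intro!: continuous_on_mult)
next
  case (Suc k)
  note D = C_family_derivative[OF assms(1) Suc.prems(1)] C_family_derivative[OF assms(1) Suc.prems(2)]
  note S = Suc.prems[THEN C_family_Suc]
  show ?case
  proof (rule C_family_SucI[OF assms(1) Suc.IH])
    fix l x assume lx: "l \<in> L" "x \<in> U"
    show "((\<lambda>x. f l x * g l x) has_derivative
        (\<lambda>v. f l x * frechet_derivative (g l) (at x) v + frechet_derivative (f l) (at x) v * g l x)) (at x)"
      by (intro has_derivative_mult D lx)
  next
    fix i
    show "C_family k L U (\<lambda>l x. f l x * frechet_derivative (g l) (at x) (axis i 1)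
         + frechet_derivative (f l) (at x) (axis i 1) * g l x)"
      by (rule C_family_cong[OF assms(1) _ C_family_add[OF assms(1)
              Suc.IH[OF S(1) Suc.prems(2)[THEN C_family_pdv, of i]]
              Suc.IH[OF Suc.prems(1)[THEN C_family_pdv, of i] S(2)]]])
        (simp add: D)
  qed (use S in auto)
qed

text \<open>The sequence \<open>Q\<close> lists the derivatives of \<open>Q 0\<close>; the induction has to go through for all of
  them at once, since the chain rule replaces \<open>Q n\<close> by \<open>Q (Suc n)\<close>.\<close>

lemma C_family_compose:
  fixes Q :: "nat \<Rightarrow> real \<Rightarrow> real"
  assumes "open U" "\<And>n t. t \<in> V \<Longrightarrow> DERIV (Q n) t :> Q (Suc n) t"
    and "C_family k L U h" "\<And>l x. l \<in> L \<Longrightarrow> x \<in> U \<Longrightarrow> h l x \<in> V"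
  shows "C_family k L U (\<lambda>l x. Q n (h l x))"
  using assms(3)
proof (induction k arbitrary: n)
  case 0
  have "continuous_on V (Q n)"
    using assms(2) by (meson DERIV_isCont continuous_at_imp_continuous_on)
  from continuous_on_compose2[OF this, of "L \<times> U" "\<lambda>(l, x). h l x"] show ?case
    using 0 assms(4) by (auto simp: split_def image_subset_iff)
next
  case (Suc k)
  note D = C_family_derivative[OF assms(1) Suc.prems]
  note S = Suc.prems[THEN C_family_Suc]
  show ?case
  proof (rule C_family_SucI[OF assms(1) Suc.IH[OF S]])
    fix l x assume lx: "l \<in> L" "x \<in> U"
    show "((\<lambda>x. Q n (h l x)) has_derivative
        (\<lambda>v. Q (Suc n) (h l x) * frechet_derivative (h l) (at x) v)) (at x)"
      using has_derivative_compose[OF D(1)[OF lx],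
          OF assms(2)[OF assms(4)[OF lx], of n, unfolded has_field_derivative_def]] .
  next
    fix i
    show "C_family k L U (\<lambda>l x. Q (Suc n) (h l x) * frechet_derivative (h l) (at x) (axis i 1))"
      by (rule C_family_cong[OF assms(1) _ C_family_mult[OF assms(1)
              Suc.IH[OF S, of "Suc n"] Suc.prems[THEN C_family_pdv, of i]]])
        (simp add: D)
  qed
qed

named_theorems smooth_intros

lemma smooth_family_param [smooth_intros]:
  "open U \<Longrightarrow> continuous_on L a \<Longrightarrow> smooth_family L U (\<lambda>l x. a l)"
  by (simp add: smooth_family_def C_family_param)

lemma smooth_family_coord [smooth_intros]: "open U \<Longrightarrow> smooth_family L U (\<lambda>l x. x $ i)"
  by (simp add: smooth_family_def C_family_coord)

lemma smooth_family_add [smooth_intros]: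
  "open U \<Longrightarrow> smooth_family L U f \<Longrightarrow> smooth_family L U g \<Longrightarrow> smooth_family L U (\<lambda>l x. f l x + g l x)"
  by (simp add: smooth_family_def C_family_add)

lemma smooth_family_mult [smooth_intros]:
  "open U \<Longrightarrow> smooth_family L U f \<Longrightarrow> smooth_family L U g \<Longrightarrow> smooth_family L U (\<lambda>l x. f l x * g l x)"
  by (simp add: smooth_family_def C_family_mult)

lemma smooth_family_minus [smooth_intros]:
  "open U \<Longrightarrow> smooth_family L U f \<Longrightarrow> smooth_family L U (\<lambda>l x. - f l x)"
  using smooth_family_mult[of U L "\<lambda>_ _. - 1" f] smooth_family_param[of U L "\<lambda>_. - 1"] by simp

lemma smooth_family_diff [smooth_intros]:
  "open U \<Longrightarrow> smooth_family L U f \<Longrightarrow> smooth_family L U g \<Longrightarrow> smooth_family L U (\<lambda>l x. f l x - g l x)"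
  using smooth_family_add[of U L f "\<lambda>l x. - g l x"] smooth_family_minus[of U L g] by simp

lemma smooth_family_power [smooth_intros]:
  "open U \<Longrightarrow> smooth_family L U f \<Longrightarrow> smooth_family L U (\<lambda>l x. f l x ^ n)"
proof (induction n)
  case 0
  then show ?case using smooth_family_param[of U L "\<lambda>_. 1"] by simp
qed (use smooth_family_mult in auto)

lemma smooth_family_compose:
  fixes Q :: "nat \<Rightarrow> real \<Rightarrow> real"
  assumes "open U" "\<And>n t. t \<in> V \<Longrightarrow> DERIV (Q n) t :> Q (Suc n) t"
    and "smooth_family L U h" "\<And>l x. l \<in> L \<Longrightarrow> x \<in> U \<Longrightarrow> h l x \<in> V"
  shows "smooth_family L U (\<lambda>l x. Q 0 (h l x))"
  using assms C_family_compose[of U V Q] unfolding smooth_family_def by blast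

lemma smooth_family_stumpff [smooth_intros]:
  assumes "open U" "smooth_family L U h"
  shows "smooth_family L U (\<lambda>l x. stumpff k (h l x))"
proof -
  have e: "entire_series ((diffs ^^ n) (stumpff_coeff k))" for n
    by (induction n) (use entire_series_stumpff entire_series_diffs in auto)
  show ?thesis
    using smooth_family_compose[of U UNIV "\<lambda>n t. \<Sum>m. (diffs ^^ n) (stumpff_coeff k) m * t ^ m" L h]
      assms DERIV_entire_series[OF e] by (simp add: stumpff_def[abs_def])
qed

lemma DERIV_inverse_power_fact:
  fixes t :: real
  assumes "t > 0"
  shows "DERIV (\<lambda>t. (- 1) ^ n * fact n * inverse t ^ Suc n) t :> (- 1) ^ Suc n * fact (Suc n) * inverse t ^ Suc (Suc n)"
proof -
  have "DERIV (\<lambda>t. inverse t ^ Suc n) t :> real (Suc n) * (- (inverse t ^ 2) * inverse t ^ n)"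
    using assms DERIV_power[OF DERIV_inverse, of t "Suc n"]
    by (simp add: power2_eq_square numeral_2_eq_2 algebra_simps)
  from DERIV_cmult[OF this, of "(- 1) ^ n * fact n"] show ?thesis
    by (simp add: power2_eq_square algebra_simps)
qed

lemma smooth_family_inverse [smooth_intros]:
  assumes "open U" "smooth_family L U h" "\<And>l x. l \<in> L \<Longrightarrow> x \<in> U \<Longrightarrow> 0 < h l x"
  shows "smooth_family L U (\<lambda>l x. inverse (h l x))"
  using smooth_family_compose[of U "{0<..}" "\<lambda>n t. (- 1) ^ n * fact n * inverse t ^ Suc n" L h]
    assms DERIV_inverse_power_fact by simp

lemma smooth_family_divide [smooth_intros]:
  assumes "open U" "smooth_family L U f" "smooth_family L U h" "\<And>l x. l \<in> L \<Longrightarrow> x \<in> U \<Longrightarrow> 0 < h l x"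
  shows "smooth_family L U (\<lambda>l x. f l x / h l x)"
  using assms by (simp add: divide_inverse smooth_intros)

lemma smooth_family_ln [smooth_intros]:
  assumes "open U" "smooth_family L U h" "\<And>l x. l \<in> L \<Longrightarrow> x \<in> U \<Longrightarrow> 0 < h l x"
  shows "smooth_family L U (\<lambda>l x. ln (h l x))"
proof -
  let ?Q = "\<lambda>n. if n = 0 then ln else (\<lambda>t. (- 1) ^ (n - 1) * fact (n - 1) * inverse t ^ n)"
  have "DERIV (?Q n) t :> ?Q (Suc n) t" if "t \<in> {0<..}" for n and t :: real
  proof (cases n)
    case 0
    then show ?thesis using that by (auto intro!: derivative_eq_intros simp: divide_inverse)
  next
    case (Suc m)
    then show ?thesis using DERIV_inverse_power_fact[of t m] that by simp
  qed
  from smooth_family_compose[of U "{0<..}" ?Q L h, OF assms(1) this assms(2)] assms(3)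
  show ?thesis by simp
qed

lemma C_family_pdvs: "C_family (length is + k) L U h \<Longrightarrow> C_family k L U (\<lambda>l. pdvs is (h l))"
proof (induction "is" arbitrary: k)
  case (Cons i "is")
  have "C_family (Suc k) L U (\<lambda>l. pdvs is (h l))"
    by (rule Cons.IH) (use Cons.prems in \<open>simp del: C_family.simps\<close>)
  then show ?case by (simp add: pdvs_def)
qed (simp add: pdvs_def)

lemma smooth_family_imp_smooth_fun:
  assumes "smooth_family L U h" "l \<in> L"
  shows "smooth_fun U (h l)"
  unfolding smooth_fun_def
proof
  fix "is"
  have "C_family (Suc 0) L U (\<lambda>l. pdvs is (h l))"
    by (rule C_family_pdvs) (use assms in \<open>simp add: smooth_family_def del: C_family.simps\<close>)
  then show "pdvs is (h l) differentiable_on U" using assms(2) by simp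
qed

text \<open>On the compact set \<open>L \<times> K\<close> a jointly continuous derivative is uniformly continuous.\<close>

lemma smooth_family_uniform_limit:
  assumes "smooth_family L U h" "compact L" "compact K" "K \<subseteq> U" "l0 \<in> L"
    and F: "filterlim (\<lambda>l. l) (at l0 within L) F"
  shows "uniform_limit K (\<lambda>l. pdvs is (h l)) (pdvs is (h l0)) F"
proof -
  have "C_family 0 L U (\<lambda>l. pdvs is (h l))"
    by (rule C_family_pdvs) (use assms in \<open>simp add: smooth_family_def del: C_family.simps\<close>)
  then have "continuous_on (L \<times> K) (\<lambda>(l, x). pdvs is (h l) x)"
    using assms(4) by (auto intro: continuous_on_subset)
  then have uc: "uniformly_continuous_on (L \<times> K) (\<lambda>(l, x). pdvs is (h l) x)"
    using assms(2,3) by (intro compact_uniformly_continuous compact_Times)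
  show ?thesis
  proof (rule uniform_limitI)
    fix e :: real assume "e > 0"
    then obtain d where d: "d > 0" "\<And>z z'. z \<in> L \<times> K \<Longrightarrow> z' \<in> L \<times> K \<Longrightarrow> dist z' z < d \<Longrightarrow>
        dist ((\<lambda>(l, x). pdvs is (h l) x) z') ((\<lambda>(l, x). pdvs is (h l) x) z) < e"
      using uc unfolding uniformly_continuous_on_def by meson
    have "\<forall>\<^sub>F l in at l0 within L. l \<in> L \<and> dist l l0 < d"
      unfolding eventually_at using d(1) by auto
    then have "\<forall>\<^sub>F l in F. l \<in> L \<and> dist l l0 < d"
      using F unfolding filterlim_iff by blast
    then show "\<forall>\<^sub>F l in F. \<forall>x\<in>K. dist (pdvs is (h l) x) (pdvs is (h l0) x) < e"
    proof (rule eventually_mono)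
      fix l assume l: "l \<in> L \<and> dist l l0 < d"
      show "\<forall>x\<in>K. dist (pdvs is (h l) x) (pdvs is (h l0) x) < e"
      proof
        fix x assume "x \<in> K"
        then show "dist (pdvs is (h l) x) (pdvs is (h l0) x) < e"
          using d(2)[of "(l0, x)" "(l, x)"] l assms(5) by (simp add: dist_Pair_Pair)
      qed
    qed
  qed
qed

section \<open>Two-dimensional tensors\<close>

lemma vec_eq_2: "(x :: 'a ^ 2) = y \<longleftrightarrow> x $ 1 = y $ 1 \<and> x $ 2 = y $ 2"
  by (simp add: vec_eq_iff forall_2)

lemma vector_eq_axis: "vector [a, b] = a *\<^sub>R axis 1 1 + b *\<^sub>R axis (2::2) (1::real)"
  by (simp add: vec_eq_2 axis_def)

lemma has_derivative_vector_2:
  fixes f g :: "'a::real_normed_vector \<Rightarrow> real"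
  assumes "(f has_derivative f') F" "(g has_derivative g') F"
  shows "((\<lambda>x. vector [f x, g x] :: real ^ 2) has_derivative (\<lambda>v. vector [f' v, g' v])) F"
  unfolding vector_eq_axis by (intro derivative_intros assms)

lemma continuous_on_vector_2:
  fixes f g :: "'a::topological_space \<Rightarrow> 'b::real_normed_vector"
  assumes "continuous_on S f" "continuous_on S g"
  shows "continuous_on S (\<lambda>x. vector [f x, g x] :: 'b ^ 2)"
proof -
  have "vector [f x, g x] = (\<chi> i::2. if i = 1 then f x else g x)" for x
    by (simp add: vec_eq_2)
  moreover have "continuous_on S (\<lambda>x. if i = 1 then f x else g x)" for i :: 2
    using assms by (cases "i = 1") simp_all
  ultimately show ?thesis
    using continuous_on_vec_lambda[of S "\<lambda>(i::2) x. if i = 1 then f x else g x"] by simp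
qed

lemma has_derivative_coord: "((\<lambda>x. x $ i) has_derivative (\<lambda>v. v $ i)) F"
  by (intro bounded_linear_imp_has_derivative bounded_linear_vec_nth)

lemma jacobian_eqI:
  fixes \<Phi> :: "real ^ 'n \<Rightarrow> real ^ 'm"
  assumes "(\<Phi> has_derivative (\<lambda>v. J *v v)) (at x)"
  shows "jacobian \<Phi> (at x) = J"
  using frechet_derivative_at[OF assms] matrix_of_matrix_vector_mul[of J]
  by (simp add: jacobian_def)

definition diag2 :: "real \<Rightarrow> real \<Rightarrow> real ^ 2 ^ 2" where
  "diag2 a b = vector [vector [a, 0], vector [0, b]]"

definition area_form :: "real \<Rightarrow> real ^ 2 ^ 2" where
  "area_form w = vector [vector [0, w], vector [- w, 0]]"

lemma diag2_nth [simp]: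
  "diag2 a b $ 1 $ 1 = a" "diag2 a b $ 1 $ 2 = 0" "diag2 a b $ 2 $ 1 = 0" "diag2 a b $ 2 $ 2 = b"
  by (simp_all add: diag2_def)

lemma area_form_nth [simp]:
  "area_form w $ 1 $ 1 = 0" "area_form w $ 1 $ 2 = w" "area_form w $ 2 $ 1 = - w" "area_form w $ 2 $ 2 = 0"
  by (simp_all add: area_form_def)

lemma warped_eq_diag2: "warped \<phi> x = diag2 1 ((\<phi> (x $ 1))\<^sup>2)"
  by (simp add: warped_def diag2_def)

lemmas mat2_simps = vec_eq_2 sum_2 matrix_matrix_mult_def transpose_def matrix_vector_mult_def
  inner_vec_def

lemma jacobian_polar:
  "jacobian polar (at x) =
     vector [vector [cos (x $ 2), - (x $ 1 * sin (x $ 2))], vector [sin (x $ 2), x $ 1 * cos (x $ 2)]]"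
proof (rule jacobian_eqI)
  have "(polar has_derivative (\<lambda>v. vector
      [x $ 1 * (- sin (x $ 2) * v $ 2) + v $ 1 * cos (x $ 2),
       x $ 1 * (cos (x $ 2) * v $ 2) + v $ 1 * sin (x $ 2)])) (at x)"
    unfolding polar_def[abs_def]
    by (intro has_derivative_vector_2)
      (auto intro!: derivative_eq_intros has_derivative_coord)
  then show "(polar has_derivative (\<lambda>v. vector [vector [cos (x $ 2), - (x $ 1 * sin (x $ 2))],
      vector [sin (x $ 2), x $ 1 * cos (x $ 2)]] *v v)) (at x)"
    by (rule back_subst[where P = "\<lambda>D. (polar has_derivative D) (at x)"])
      (auto simp: mat2_simps fun_eq_iff)
qed

lemma jacobian_near_chart: "jacobian (near_chart m) (at x) = diag2 1 (real m)"
proof (rule jacobian_eqI)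
  have "(near_chart m has_derivative (\<lambda>v. vector [v $ 1, real m * v $ 2])) (at x)"
    unfolding near_chart_def[abs_def]
    by (intro has_derivative_vector_2) (auto intro!: derivative_eq_intros has_derivative_coord)
  then show "(near_chart m has_derivative (\<lambda>v. diag2 1 (real m) *v v)) (at x)"
    by (rule back_subst[where P = "\<lambda>D. (near_chart m has_derivative D) (at x)"])
      (auto simp: mat2_simps fun_eq_iff)
qed

lemma jacobian_far_chart: "jacobian (far_chart B m) (at x) = diag2 (- 1) (real m)"
proof (rule jacobian_eqI)
  have "(far_chart B m has_derivative (\<lambda>v. vector [- v $ 1, real m * v $ 2])) (at x)"
    unfolding far_chart_def[abs_def]
    by (intro has_derivative_vector_2) (auto intro!: derivative_eq_intros has_derivative_coord)
  then show "(far_chart B m has_derivative (\<lambda>v. diag2 (- 1) (real m) *v v)) (at x)"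
    by (rule back_subst[where P = "\<lambda>D. (far_chart B m has_derivative D) (at x)"])
      (auto simp: mat2_simps fun_eq_iff)
qed

lemma jacobian_scaling: "jacobian (\<lambda>z :: real ^ 2. s *\<^sub>R z) (at x) = diag2 s s"
proof (rule jacobian_eqI)
  have "((\<lambda>z :: real ^ 2. s *\<^sub>R z) has_derivative (\<lambda>v. s *\<^sub>R v)) (at x)"
    by (auto intro!: derivative_eq_intros)
  then show "((\<lambda>z :: real ^ 2. s *\<^sub>R z) has_derivative (\<lambda>v. diag2 s s *v v)) (at x)"
    by (rule back_subst[where P = "\<lambda>D. ((\<lambda>z :: real ^ 2. s *\<^sub>R z) has_derivative D) (at x)"])
      (auto simp: mat2_simps fun_eq_iff)
qed

definition nsq :: "real ^ 2 \<Rightarrow> real" where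
  "nsq z = (z $ 1)\<^sup>2 + (z $ 2)\<^sup>2"

lemma nsq_eq_norm: "nsq z = (norm z)\<^sup>2"
  by (simp add: nsq_def norm_vec_def L2_set_def sum_2)

lemma nsq_polar [simp]: "nsq (polar x) = (x $ 1)\<^sup>2"
proof -
  have "nsq (polar x) = (x $ 1)\<^sup>2 * ((cos (x $ 2))\<^sup>2 + (sin (x $ 2))\<^sup>2)"
    by (simp only: nsq_def polar_def vector_2 power_mult_distrib distrib_left)
  then show ?thesis by simp
qed

text \<open>This is \<open>a (dx\<^sup>2 + dy\<^sup>2) + m (x dy - y dx)\<^sup>2\<close>, the general form of a rotation invariant metric
  without a \<open>dr d\<theta>\<close> term that is smooth at the centre when \<open>a\<close> and \<open>m\<close> are smooth functions of
  \<open>r\<^sup>2\<close>.\<close>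

definition rotinv_metric :: "real \<Rightarrow> real \<Rightarrow> real ^ 2 \<Rightarrow> real ^ 2 ^ 2" where
  "rotinv_metric a m z =
     vector [vector [a + m * (z $ 2)\<^sup>2, - (m * z $ 1 * z $ 2)], vector [- (m * z $ 1 * z $ 2), a + m * (z $ 1)\<^sup>2]]"

text \<open>In polar coordinates \<open>dx\<^sup>2 + dy\<^sup>2 = dr\<^sup>2 + r\<^sup>2 d\<theta>\<^sup>2\<close> and \<open>x dy - y dx = r\<^sup>2 d\<theta>\<close>.\<close>

lemma pullback_polar_rotinv_metric:
  assumes "G (polar x) = rotinv_metric a m (polar x)"
  shows "pullback polar G x = diag2 a ((x $ 1)\<^sup>2 * (a + m * (x $ 1)\<^sup>2))"
proof -
  let ?c = "cos (x $ 2)" and ?s = "sin (x $ 2)"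
  have p: "polar x $ 1 = x $ 1 * ?c" "polar x $ 2 = x $ 1 * ?s" by (simp_all add: polar_def)
  have cs: "?s * ?s = 1 - ?c * ?c"
    using sin_squared_eq[of "x $ 2"] by (simp add: power2_eq_square)
  have csl: "?s * (?s * z) = z - ?c * (?c * z)" for z
    using arg_cong[OF cs, of "\<lambda>w. w * z"] by (simp add: left_diff_distrib mult.assoc)
  show ?thesis
    unfolding pullback_def assms jacobian_polar
    by (simp add: mat2_simps rotinv_metric_def p) (simp add: algebra_simps power2_eq_square cs csl)
qed

lemma pullback_polar_area_form:
  assumes "H (polar x) = area_form w"
  shows "pullback polar H x = area_form (x $ 1 * w)"
proof -
  let ?c = "cos (x $ 2)" and ?s = "sin (x $ 2)"
  have cs: "?s * ?s = 1 - ?c * ?c"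
    using sin_squared_eq[of "x $ 2"] by (simp add: power2_eq_square)
  have csl: "?s * (?s * z) = z - ?c * (?c * z)" for z
    using arg_cong[OF cs, of "\<lambda>w. w * z"] by (simp add: left_diff_distrib mult.assoc)
  show ?thesis
    unfolding pullback_def assms jacobian_polar
    by (simp add: mat2_simps) (simp add: algebra_simps cs csl)
qed

lemma pullback_near_chart_diag2:
  "T (near_chart m x) = diag2 a b \<Longrightarrow> pullback (near_chart m) T x = diag2 a ((real m)\<^sup>2 * b)"
  unfolding pullback_def jacobian_near_chart by (simp add: mat2_simps power2_eq_square)

lemma pullback_far_chart_diag2:
  "T (far_chart B m x) = diag2 a b \<Longrightarrow> pullback (far_chart B m) T x = diag2 a ((real m)\<^sup>2 * b)"
  unfolding pullback_def jacobian_far_chart by (simp add: mat2_simps power2_eq_square)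

lemma pullback_near_chart_area_form:
  "T (near_chart m x) = area_form w \<Longrightarrow> pullback (near_chart m) T x = area_form (real m * w)"
  unfolding pullback_def jacobian_near_chart by (simp add: mat2_simps)

lemma pullback_far_chart_area_form:
  "T (far_chart B m x) = area_form w \<Longrightarrow> pullback (far_chart B m) T x = area_form (- (real m * w))"
  unfolding pullback_def jacobian_far_chart by (simp add: mat2_simps)

lemma pullback_scaling_rotinv_metric:
  "pullback (\<lambda>z. s *\<^sub>R z) (\<lambda>w. rotinv_metric (a w) (m w) w) z =
     rotinv_metric (s\<^sup>2 * a (s *\<^sub>R z)) (s ^ 4 * m (s *\<^sub>R z)) z"
  unfolding pullback_def jacobian_scaling
  by (simp add: mat2_simps rotinv_metric_def) (simp add: algebra_simps power2_eq_square power4_eq_xxxx)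

text \<open>Lagrange's identity splits \<open>\<bar>v\<bar>\<^sup>2 \<bar>z\<bar>\<^sup>2\<close> into the squares of the radial part \<open>p\<close> and the angular
  part \<open>q\<close>, on which the metric acts by \<open>a\<close> and \<open>a + m \<bar>z\<bar>\<^sup>2\<close>.\<close>

lemma rotinv_metric_pos:
  assumes "0 < a" "0 < a + m * nsq z" "v \<noteq> 0"
  shows "0 < v \<bullet> (rotinv_metric a m z *v v)"
proof -
  define p q where "p = v $ 1 * z $ 1 + v $ 2 * z $ 2" and "q = v $ 2 * z $ 1 - v $ 1 * z $ 2"
  have e: "v \<bullet> (rotinv_metric a m z *v v) = a * nsq v + m * q\<^sup>2"
    by (simp add: mat2_simps rotinv_metric_def nsq_def q_def power2_eq_square algebra_simps)
  have v: "0 < nsq v" using assms(3) by (simp add: nsq_eq_norm)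
  show ?thesis
  proof (cases "nsq z = 0")
    case True
    then have "z = 0" by (simp add: nsq_eq_norm)
    then show ?thesis unfolding e using assms(1) v by (simp add: q_def)
  next
    case False
    then have z: "0 < nsq z" by (simp add: nsq_eq_norm)
    have l: "nsq v * nsq z = p\<^sup>2 + q\<^sup>2"
      by (simp add: nsq_def p_def q_def power2_eq_square algebra_simps)
    have "(a * nsq v + m * q\<^sup>2) * nsq z = a * p\<^sup>2 + (a + m * nsq z) * q\<^sup>2"
      using l by (simp add: algebra_simps)
    moreover have pq: "0 < p\<^sup>2 + q\<^sup>2" using v z mult_pos_pos[of "nsq v" "nsq z"] l by simp
    have "0 < a * p\<^sup>2 + (a + m * nsq z) * q\<^sup>2"
    proof (cases "q = 0")
      case True
      then show ?thesis using pq assms(1) by simp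
    next
      case False
      then have "0 < (a + m * nsq z) * q\<^sup>2" using assms(2) by (simp add: zero_less_mult_iff)
      moreover have "0 \<le> a * p\<^sup>2" using assms(1) by simp
      ultimately show ?thesis by linarith
    qed
    ultimately show ?thesis unfolding e using z by (metis zero_less_mult_pos2)
  qed
qed

lemma transpose_rotinv_metric: "transpose (rotinv_metric a m z) = rotinv_metric a m z"
  by (simp add: mat2_simps rotinv_metric_def)

lemma open_annulus: "open (annulus b)"
proof -
  have "annulus b = {x. 0 < x $ 1} \<inter> {x. ereal (x $ 1) < b}" by (auto simp: annulus_def)
  moreover have "open {x :: real ^ 2. 0 < x $ 1}" by (intro open_Collect_less continuous_intros)
  moreover have "open {x :: real ^ 2. ereal (x $ 1) < b}" by (intro open_Collect_less continuous_intros)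
  ultimately show ?thesis by auto
qed

lemma open_disc: "open (disc b)"
  unfolding disc_def by (intro open_Collect_less continuous_intros)

section \<open>Curvature of a warped product\<close>

lemma pdv_radial:
  assumes "open U" "x \<in> U" "\<And>y. y \<in> U \<Longrightarrow> h y = H (y $ 1)" "DERIV H (x $ 1) :> H'"
  shows "pdv 1 h x = H'" "pdv (2::2) h x = 0"
proof -
  have "((\<lambda>y. H (y $ 1)) has_derivative (\<lambda>v. H' * v $ 1)) (at x)"
    using has_derivative_compose[OF has_derivative_coord assms(4)[unfolded has_field_derivative_def]] .
  then have "pdv i (\<lambda>y. H (y $ 1)) x = H' * axis i 1 $ 1" for i
    by (rule pdv_eq_has_derivative)
  then show "pdv 1 h x = H'" "pdv (2::2) h x = 0"
    using pdv_cong_open[OF assms(1,2), of h "\<lambda>y. H (y $ 1)"] assms(3) by (simp_all add: axis_def)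
qed

lemma matrix_inv_diag2:
  assumes "a \<noteq> 0" "b \<noteq> 0"
  shows "matrix_inv (diag2 a b) = diag2 (1 / a) (1 / b)"
proof -
  have "diag2 a b ** diag2 (1 / a) (1 / b) = mat 1" "diag2 (1 / a) (1 / b) ** diag2 a b = mat 1"
    using assms by (simp_all add: mat2_simps mat_def)
  moreover from this have "matrix_inv (diag2 a b) ** diag2 a b = mat 1"
    unfolding matrix_inv_def by (rule someI2[where Q = "\<lambda>B. B ** diag2 a b = mat 1", OF conjI]) blast
  ultimately show ?thesis
    by (metis matrix_mul_assoc matrix_mul_lid matrix_mul_rid)
qed

locale warped_surface =
  fixes b :: ereal and \<phi> \<phi>1 \<phi>2 :: "real \<Rightarrow> real"
  assumes pos: "\<And>r. 0 < r \<Longrightarrow> ereal r < b \<Longrightarrow> 0 < \<phi> r"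
    and D1: "\<And>r. 0 < r \<Longrightarrow> ereal r < b \<Longrightarrow> DERIV \<phi> r :> \<phi>1 r"
    and D2: "\<And>r. 0 < r \<Longrightarrow> ereal r < b \<Longrightarrow> DERIV \<phi>1 r :> \<phi>2 r"
begin

context
  fixes x :: "real ^ 2"
  assumes x: "x \<in> annulus b"
begin

lemma r_range: "0 < x $ 1" "ereal (x $ 1) < b"
  using x by (simp_all add: annulus_def)

lemma \<phi>_nz: "\<phi> (x $ 1) \<noteq> 0"
  using pos r_range by fastforce

lemma matrix_inv_warped: "matrix_inv (warped \<phi> x) = diag2 1 (1 / (\<phi> (x $ 1))\<^sup>2)"
  unfolding warped_eq_diag2 using matrix_inv_diag2 \<phi>_nz by simp

lemma pdv_warped:
  "pdv k (\<lambda>y. warped \<phi> y $ 1 $ 1) x = 0" "pdv k (\<lambda>y. warped \<phi> y $ 1 $ 2) x = 0"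
  "pdv k (\<lambda>y. warped \<phi> y $ 2 $ 1) x = 0" "pdv 2 (\<lambda>y. warped \<phi> y $ 2 $ 2) x = 0"
  "pdv 1 (\<lambda>y. warped \<phi> y $ 2 $ 2) x = 2 * \<phi> (x $ 1) * \<phi>1 (x $ 1)"
proof -
  have c: "pdv k (\<lambda>y. c) x = 0" for c :: real and k
    by (simp add: pdv_def)
  have d: "DERIV (\<lambda>r. (\<phi> r)\<^sup>2) (x $ 1) :> 2 * \<phi> (x $ 1) * \<phi>1 (x $ 1)"
    using D1[OF r_range] by (auto intro!: derivative_eq_intros)
  note d = pdv_radial[OF open_UNIV UNIV_I _ d]
  show "pdv k (\<lambda>y. warped \<phi> y $ 1 $ 1) x = 0" "pdv k (\<lambda>y. warped \<phi> y $ 1 $ 2) x = 0"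
  "pdv k (\<lambda>y. warped \<phi> y $ 2 $ 1) x = 0" "pdv 2 (\<lambda>y. warped \<phi> y $ 2 $ 2) x = 0"
  "pdv 1 (\<lambda>y. warped \<phi> y $ 2 $ 2) x = 2 * \<phi> (x $ 1) * \<phi>1 (x $ 1)"
    by (simp_all add: warped_eq_diag2 c d)
qed

lemma christoffel_warped:
  "christoffel (warped \<phi>) 1 1 1 x = 0" "christoffel (warped \<phi>) 1 1 2 x = 0"
  "christoffel (warped \<phi>) 1 2 1 x = 0" "christoffel (warped \<phi>) 1 2 2 x = - \<phi> (x $ 1) * \<phi>1 (x $ 1)"
  "christoffel (warped \<phi>) 2 1 1 x = 0" "christoffel (warped \<phi>) 2 1 2 x = \<phi>1 (x $ 1) / \<phi> (x $ 1)"
  "christoffel (warped \<phi>) 2 2 1 x = \<phi>1 (x $ 1) / \<phi> (x $ 1)" "christoffel (warped \<phi>) 2 2 2 x = 0"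
  using \<phi>_nz by (simp_all add: christoffel_def sum_2 matrix_inv_warped pdv_warped power2_eq_square)

end

context
  fixes x :: "real ^ 2"
  assumes x: "x \<in> annulus b"
begin

lemma pdv_christoffel:
  "pdv k (christoffel (warped \<phi>) 1 1 1) x = 0" "pdv k (christoffel (warped \<phi>) 1 1 2) x = 0"
  "pdv k (christoffel (warped \<phi>) 1 2 1) x = 0"
  "pdv 1 (christoffel (warped \<phi>) 1 2 2) x = - (\<phi>1 (x $ 1))\<^sup>2 - \<phi> (x $ 1) * \<phi>2 (x $ 1)"
  "pdv 2 (christoffel (warped \<phi>) 1 2 2) x = 0"
  "pdv k (christoffel (warped \<phi>) 2 1 1) x = 0"
  "pdv 1 (christoffel (warped \<phi>) 2 1 2) x = \<phi>2 (x $ 1) / \<phi> (x $ 1) - (\<phi>1 (x $ 1) / \<phi> (x $ 1))\<^sup>2"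
  "pdv 2 (christoffel (warped \<phi>) 2 1 2) x = 0"
  "pdv 1 (christoffel (warped \<phi>) 2 2 1) x = \<phi>2 (x $ 1) / \<phi> (x $ 1) - (\<phi>1 (x $ 1) / \<phi> (x $ 1))\<^sup>2"
  "pdv 2 (christoffel (warped \<phi>) 2 2 1) x = 0"
  "pdv k (christoffel (warped \<phi>) 2 2 2) x = 0"
proof -
  note C = christoffel_warped and P = pdv_radial[OF open_annulus x]
  have 0: "pdv k h x = 0" if "\<And>y. y \<in> annulus b \<Longrightarrow> h y = 0" for h k
    using pdv_cong_open[OF open_annulus x, of h "\<lambda>_. 0" k] that by (simp add: pdv_def)
  note d = D1[OF r_range[OF x]] D2[OF r_range[OF x]]
  have d1: "DERIV (\<lambda>r. - \<phi> r * \<phi>1 r) (x $ 1) :> - (\<phi>1 (x $ 1))\<^sup>2 - \<phi> (x $ 1) * \<phi>2 (x $ 1)"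
    using d by (auto intro!: derivative_eq_intros simp: power2_eq_square)
  have d2: "DERIV (\<lambda>r. \<phi>1 r / \<phi> r) (x $ 1) :> \<phi>2 (x $ 1) / \<phi> (x $ 1) - (\<phi>1 (x $ 1) / \<phi> (x $ 1))\<^sup>2"
    using d \<phi>_nz[OF x] by (auto intro!: derivative_eq_intros simp: power2_eq_square field_simps)
  show "pdv k (christoffel (warped \<phi>) 1 1 1) x = 0" "pdv k (christoffel (warped \<phi>) 1 1 2) x = 0"
    "pdv k (christoffel (warped \<phi>) 1 2 1) x = 0" "pdv k (christoffel (warped \<phi>) 2 1 1) x = 0"
    "pdv k (christoffel (warped \<phi>) 2 2 2) x = 0"
    by (intro 0 C; assumption)+
  show "pdv 1 (christoffel (warped \<phi>) 1 2 2) x = - (\<phi>1 (x $ 1))\<^sup>2 - \<phi> (x $ 1) * \<phi>2 (x $ 1)"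
    "pdv 2 (christoffel (warped \<phi>) 1 2 2) x = 0"
    using P[OF C(4) d1] by simp_all
  show "pdv 1 (christoffel (warped \<phi>) 2 1 2) x = \<phi>2 (x $ 1) / \<phi> (x $ 1) - (\<phi>1 (x $ 1) / \<phi> (x $ 1))\<^sup>2"
    "pdv 2 (christoffel (warped \<phi>) 2 1 2) x = 0"
    using P[OF C(6) d2] by simp_all
  show "pdv 1 (christoffel (warped \<phi>) 2 2 1) x = \<phi>2 (x $ 1) / \<phi> (x $ 1) - (\<phi>1 (x $ 1) / \<phi> (x $ 1))\<^sup>2"
    "pdv 2 (christoffel (warped \<phi>) 2 2 1) x = 0"
    using P[OF C(7) d2] by simp_all
qed

lemma ricci_warped:
  "ricci (warped \<phi>) x = (- (\<phi>2 (x $ 1) / \<phi> (x $ 1))) *\<^sub>R warped \<phi> x"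
  using \<phi>_nz[OF x]
  by (simp add: vec_eq_2 ricci_def sum_2 pdv_christoffel christoffel_warped[OF x] warped_eq_diag2)
    (simp add: power2_eq_square)

lemma hessian_warped:
  assumes "\<And>r. 0 < r \<Longrightarrow> ereal r < b \<Longrightarrow> DERIV h r :> h1 r"
    and "\<And>r. 0 < r \<Longrightarrow> ereal r < b \<Longrightarrow> DERIV h1 r :> h2 r"
  shows "hessian (warped \<phi>) (\<lambda>y. h (y $ 1)) x =
    diag2 (h2 (x $ 1)) (\<phi> (x $ 1) * \<phi>1 (x $ 1) * h1 (x $ 1))"
proof -
  have 1: "pdv 1 (\<lambda>y. h (y $ 1)) y = h1 (y $ 1)" "pdv 2 (\<lambda>y. h (y $ 1)) y = 0"
    if "y \<in> annulus b" for y
    using pdv_radial[OF open_annulus that refl assms(1)[OF r_range[OF that]]] by simp_all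
  have 0: "pdv k (pdv 2 (\<lambda>y. h (y $ 1))) x = 0" for k
    using pdv_cong_open[OF open_annulus x, of "pdv 2 (\<lambda>y. h (y $ 1))" "\<lambda>_. 0" k] 1
    by (simp add: pdv_def[of _ "\<lambda>_. 0"])
  note 2 = pdv_radial[OF open_annulus x 1(1) assms(2)[OF r_range[OF x]]]
  show ?thesis
    by (simp add: vec_eq_2 hessian_def sum_2 christoffel_warped[OF x] 0 1[OF x] 2)
qed

lemma form_square_warped:
  assumes "F x = area_form w"
  shows "form_square (warped \<phi>) F x = (w / \<phi> (x $ 1))\<^sup>2 *\<^sub>R warped \<phi> x"
  using \<phi>_nz[OF x]
  by (simp add: vec_eq_2 form_square_def sum_2 matrix_inv_warped[OF x] assms)
    (simp add: warped_eq_diag2 power2_eq_square)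

text \<open>The area form \<open>\<phi> dr \<and> d\<theta>\<close> is parallel.\<close>

lemma divergence_area_form:
  assumes "\<And>y. y \<in> annulus b \<Longrightarrow> T y = area_form (c * \<phi> (y $ 1))"
  shows "divergence (warped \<phi>) T x = 0"
proof -
  have d: "DERIV (\<lambda>r. c * \<phi> r) (x $ 1) :> c * \<phi>1 (x $ 1)"
    using D1[OF r_range[OF x]] by (auto intro!: derivative_eq_intros)
  have d': "DERIV (\<lambda>r. - (c * \<phi> r)) (x $ 1) :> - (c * \<phi>1 (x $ 1))"
    using DERIV_minus[OF d] .
  have 0: "pdv k (\<lambda>y. T y $ i $ i) x = 0" for k i
    using pdv_cong_open[OF open_annulus x, of "\<lambda>y. T y $ i $ i" "\<lambda>_. 0" k] assms exhaust_2[of i]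
    by (auto simp: pdv_def[of _ "\<lambda>_. 0"])
  have 1: "pdv 1 (\<lambda>y. T y $ 1 $ 2) x = c * \<phi>1 (x $ 1)" "pdv 2 (\<lambda>y. T y $ 1 $ 2) x = 0"
    by (rule pdv_radial[OF open_annulus x _ d]; simp add: assms)+
  have 2: "pdv 1 (\<lambda>y. T y $ 2 $ 1) x = - (c * \<phi>1 (x $ 1))" "pdv 2 (\<lambda>y. T y $ 2 $ 1) x = 0"
    by (rule pdv_radial[OF open_annulus x _ d']; simp add: assms)+
  show ?thesis
    using \<phi>_nz[OF x]
    by (simp add: vec_eq_2 divergence_def cov_deriv_def sum_2 matrix_inv_warped[OF x]
        christoffel_warped[OF x] 0 1 2 assms[OF x])
qed

end

end

section \<open>The radial profiles\<close>

text \<open>\<open>csin l\<close> is the solution of \<open>u'' = - l u\<close> with \<open>u(0) = 0\<close>, \<open>u'(0) = 1\<close>, that is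
  \<open>sin (\<surd>l r) / \<surd>l\<close>, \<open>r\<close> or \<open>sinh (\<surd>(-l) r) / \<surd>(-l)\<close>, and \<open>vers l\<close> is its primitive.\<close>

definition vers :: "real \<Rightarrow> real \<Rightarrow> real" where
  "vers l r = r\<^sup>2 * stumpff 2 (l * r\<^sup>2)"

definition csin :: "real \<Rightarrow> real \<Rightarrow> real" where
  "csin l r = r * stumpff 1 (l * r\<^sup>2)"

text \<open>Up to the factor \<open>k\<close> the logarithmic derivative of \<open>1 + k vers l r\<close>, normalized to have slope 1
  at the tip \<open>r = 0\<close>. Near either tip the warping function of a soliton a multiple of it, where \<open>k\<close>
  is the slope at the first tip, respectively minus the absolute value of the slope at the second.\<close>

definition tip_warp :: "real \<Rightarrow> real \<Rightarrow> real \<Rightarrow> real" where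
  "tip_warp k l r = csin l r / (1 + k * vers l r)"

lemma vers_nonneg: "0 \<le> vers l r"
  by (simp add: vers_def stumpff_2_nonneg)

lemma csin_square: "(csin l r)\<^sup>2 = 2 * vers l r - l * (vers l r)\<^sup>2"
proof -
  have "(csin l r)\<^sup>2 = r\<^sup>2 * (2 * stumpff 2 (l * r\<^sup>2) - l * r\<^sup>2 * (stumpff 2 (l * r\<^sup>2))\<^sup>2)"
    unfolding csin_def power_mult_distrib stumpff_pythagoras ..
  then show ?thesis by (simp add: vers_def algebra_simps power2_eq_square)
qed

lemma DERIV_vers: "DERIV (vers l) r :> csin l r"
proof -
  let ?t = "l * r\<^sup>2"
  have "DERIV (\<lambda>r. r\<^sup>2 * stumpff 2 (l * r\<^sup>2)) r :>
      2 * r * stumpff 2 ?t + stumpff' 2 ?t * (l * (2 * r)) * r\<^sup>2"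
    by (auto intro!: derivative_eq_intros DERIV_chain2[OF DERIV_stumpff])
  moreover have "2 * r * stumpff 2 ?t + stumpff' 2 ?t * (l * (2 * r)) * r\<^sup>2
      = r * (2 * ?t * stumpff' 2 ?t + 2 * stumpff 2 ?t)"
    by (simp add: algebra_simps)
  moreover have "2 * ?t * stumpff' 2 ?t + 2 * stumpff 2 ?t = stumpff 1 ?t"
    using stumpff'_eq[of ?t 1] by (simp add: numeral_2_eq_2)
  ultimately show ?thesis by (simp add: vers_def[abs_def] csin_def)
qed

lemma DERIV_csin: "DERIV (csin l) r :> 1 - l * vers l r"
proof -
  let ?t = "l * r\<^sup>2"
  have "DERIV (\<lambda>r. r * stumpff 1 (l * r\<^sup>2)) r :>
      stumpff 1 ?t + stumpff' 1 ?t * (l * (2 * r)) * r"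
    by (auto intro!: derivative_eq_intros DERIV_chain2[OF DERIV_stumpff])
  moreover have "stumpff 1 ?t + stumpff' 1 ?t * (l * (2 * r)) * r = 1 - l * vers l r"
    using stumpff'_eq[of ?t 0] stumpff_rec[of 0 ?t]
    by (simp add: vers_def numeral_2_eq_2 algebra_simps)
  ultimately show ?thesis by (simp add: csin_def[abs_def])
qed

lemma l_square: "0 < l \<Longrightarrow> l * r\<^sup>2 = (sqrt l * r)\<^sup>2"
  by (simp add: power_mult_distrib)

lemma csin_eq_sin: "0 < l \<Longrightarrow> csin l r = sin (sqrt l * r) / sqrt l"
  using stumpff_sin[of "sqrt l * r"] unfolding csin_def l_square[symmetric]
  by (simp add: field_simps)

lemma vers_eq_cos: "0 < l \<Longrightarrow> vers l r = (1 - cos (sqrt l * r)) / l"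
  using stumpff_cos[of "sqrt l * r"] stumpff_rec[of 0 "l * r\<^sup>2"]
  unfolding vers_def l_square[symmetric] by (simp add: numeral_2_eq_2 field_simps)

definition tip_warp1 :: "real \<Rightarrow> real \<Rightarrow> real \<Rightarrow> real" where
  "tip_warp1 k l r = (1 - l * vers l r) / (1 + k * vers l r) - k * (csin l r)\<^sup>2 / (1 + k * vers l r)\<^sup>2"

definition tip_warp2 :: "real \<Rightarrow> real \<Rightarrow> real \<Rightarrow> real" where
  "tip_warp2 k l r = - (l * csin l r / (1 + k * vers l r))
    - 3 * k * csin l r * (1 - l * vers l r) / (1 + k * vers l r)\<^sup>2
    + 2 * k\<^sup>2 * (csin l r) ^ 3 / (1 + k * vers l r) ^ 3"

lemma DERIV_tip_warp:
  assumes "1 + k * vers l r \<noteq> 0"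
  shows "DERIV (tip_warp k l) r :> tip_warp1 k l r"
  unfolding tip_warp_def[abs_def] tip_warp1_def using assms
  by (auto intro!: derivative_eq_intros DERIV_csin DERIV_vers simp: power2_eq_square diff_divide_distrib)

lemma DERIV_tip_warp1:
  assumes "1 + k * vers l r \<noteq> 0"
  shows "DERIV (tip_warp1 k l) r :> tip_warp2 k l r"
proof -
  define v where "v = 1 + k * vers l r"
  define u where "u = csin l r"
  define e where "e = vers l r"
  have v: "v \<noteq> 0" using assms by (simp add: v_def)
  have "DERIV (\<lambda>r. (1 - l * vers l r) / (1 + k * vers l r) - k * (csin l r)\<^sup>2 / (1 + k * vers l r)\<^sup>2) r :>
    ((- (l * u)) * v - (1 - l * e) * (k * u)) / (v * v)
    - ((k * (2 * u * (1 - l * e))) * v\<^sup>2 - (k * u\<^sup>2) * (2 * v * (k * u))) / (v\<^sup>2 * v\<^sup>2)"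
    using assms unfolding u_def e_def v_def
    by (auto intro!: derivative_eq_intros DERIV_csin DERIV_vers) (simp add: algebra_simps)
  moreover have "((- (l * u)) * v - (1 - l * e) * (k * u)) / (v * v)
    - ((k * (2 * u * (1 - l * e))) * v\<^sup>2 - (k * u\<^sup>2) * (2 * v * (k * u))) / (v\<^sup>2 * v\<^sup>2) =
    - (l * u / v) - 3 * k * u * (1 - l * e) / v\<^sup>2 + 2 * k\<^sup>2 * u ^ 3 / v ^ 3"
    using v by (simp add: field_simps power2_eq_square power3_eq_cube)
  ultimately show ?thesis unfolding tip_warp1_def[abs_def] tip_warp2_def u_def e_def v_def by simp
qed

section \<open>Orbifold charts at the tips\<close>

text \<open>In a chart \<open>r\<close> is not smooth at the centre, but \<open>s = r\<^sup>2\<close> is, so the profiles are rewritten as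
  functions of \<open>s\<close>. The metric \<open>dr\<^sup>2 + w\<^sup>2 d\<theta>\<^sup>2\<close> with \<open>w = tip_warp k l r\<close> equals
  \<open>dx\<^sup>2 + dy\<^sup>2 + ((w/r)\<^sup>2 - 1) / s (x dy - y dx)\<^sup>2\<close>; the numerator of the last coefficient is divisible by
  \<open>s\<close>, because \<open>w/r\<close> is \<open>stumpff 1 (l s) / den k l s\<close> and both functions have the value 1 at \<open>s = 0\<close>.\<close>

definition den :: "real \<Rightarrow> real \<Rightarrow> real \<Rightarrow> real" where
  "den k l s = 1 + k * (s * stumpff 2 (l * s))"

definition chart_coeff :: "real \<Rightarrow> real \<Rightarrow> real \<Rightarrow> real" where
  "chart_coeff k l s =
     (stumpff 1 (l * s) + den k l s) * (- (l * stumpff 3 (l * s)) - k * stumpff 2 (l * s)) / (den k l s)\<^sup>2"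

text \<open>The factor \<open>\<sigma>\<close> stands for a pull-back under \<open>z \<mapsto> \<sigma> z\<close>; it is needed for the cigar, whose
  usual coordinate is a multiple of the arc length of the limit.\<close>

definition chart_metric :: "real \<Rightarrow> real \<Rightarrow> real \<Rightarrow> real ^ 2 \<Rightarrow> real ^ 2 ^ 2" where
  "chart_metric \<sigma> k l z = rotinv_metric (\<sigma>\<^sup>2) (\<sigma> ^ 4 * chart_coeff k l (\<sigma>\<^sup>2 * nsq z)) z"

lemma den_square: "den k l (r\<^sup>2) = 1 + k * vers l r"
  by (simp add: den_def vers_def)

lemma chart_coeff_eq:
  assumes "den k l s \<noteq> 0"
  shows "1 + s * chart_coeff k l s = (stumpff 1 (l * s) / den k l s)\<^sup>2"
proof -
  have c: "stumpff 1 (l * s) = 1 - l * s * stumpff 3 (l * s)"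
    using stumpff_rec[of 1 "l * s"] by (simp add: numeral_3_eq_3)
  have "s * (- (l * stumpff 3 (l * s)) - k * stumpff 2 (l * s)) = stumpff 1 (l * s) - den k l s"
    unfolding c den_def by (simp add: algebra_simps)
  then have "s * chart_coeff k l s =
      (stumpff 1 (l * s) + den k l s) * (stumpff 1 (l * s) - den k l s) / (den k l s)\<^sup>2"
    by (metis chart_coeff_def mult.left_commute times_divide_eq_right)
  then show ?thesis using assms by (simp add: field_simps power2_eq_square)
qed

lemma smooth_fun_single: "smooth_family {0} U (\<lambda>_. h) \<Longrightarrow> smooth_fun U h"
  using smooth_family_imp_smooth_fun by blast

lemma smooth_family_nsq [smooth_intros]: "open U \<Longrightarrow> smooth_family L U (\<lambda>l. nsq)"
  unfolding nsq_def by (intro smooth_intros)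

lemma smooth_family_chart_metric:
  assumes U: "open U" and "\<And>l z. l \<in> L \<Longrightarrow> z \<in> U \<Longrightarrow> 0 < den k l (\<sigma>\<^sup>2 * nsq z)"
  shows "smooth_family L U (\<lambda>l z. chart_metric \<sigma> k l z $ i $ j)"
proof -
  have c: "smooth_family L U (\<lambda>l z. chart_coeff k l (\<sigma>\<^sup>2 * nsq z))"
    unfolding chart_coeff_def den_def
    by (intro smooth_intros U zero_less_power continuous_intros)
      (use assms(2) in \<open>auto simp: den_def\<close>)
  then show ?thesis
    using exhaust_2[of i] exhaust_2[of j] unfolding chart_metric_def
    by (auto simp: rotinv_metric_def intro!: smooth_intros U continuous_intros)
qed

text \<open>Up to the radius \<open>b\<close> the warping function is finite and positive.\<close>

definition tip_domain :: "ereal \<Rightarrow> real \<Rightarrow> real \<Rightarrow> real \<Rightarrow> bool" where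
  "tip_domain b \<sigma> k l \<longleftrightarrow> (\<forall>r. 0 \<le> r \<and> ereal r < b \<longrightarrow>
     0 < den k l (\<sigma>\<^sup>2 * r\<^sup>2) \<and> 0 < stumpff 1 (l * (\<sigma>\<^sup>2 * r\<^sup>2)))"

lemma metric_lift_chart_metric:
  assumes "\<sigma> \<noteq> 0" and dom: "tip_domain b \<sigma> k l"
    and pb: "\<And>x. x \<in> annulus b \<Longrightarrow> pullback Q g x = diag2 (\<sigma>\<^sup>2) ((tip_warp k l (\<sigma> * x $ 1))\<^sup>2)"
  shows "metric_lift b Q g (chart_metric \<sigma> k l)"
  unfolding metric_lift_def lifts_tensor_def riemannian_metric_def
proof (intro conjI ballI allI impI)
  have d: "0 < den k l (\<sigma>\<^sup>2 * nsq z)" "0 < stumpff 1 (l * (\<sigma>\<^sup>2 * nsq z))" if "z \<in> disc b" for z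
    using dom that by (simp_all add: tip_domain_def disc_def nsq_eq_norm)
  show "smooth_tensor (disc b) (chart_metric \<sigma> k l)"
    unfolding smooth_tensor_def
    by (intro allI smooth_family_imp_smooth_fun[of "{l}"] smooth_family_chart_metric open_disc)
      (use d in auto)
  fix z assume z: "z \<in> disc b"
  show "transpose (chart_metric \<sigma> k l z) = chart_metric \<sigma> k l z"
    by (simp add: chart_metric_def transpose_rotinv_metric)
  fix v :: "real ^ 2" assume "v \<noteq> 0"
  have "\<sigma>\<^sup>2 + \<sigma> ^ 4 * chart_coeff k l (\<sigma>\<^sup>2 * nsq z) * nsq z
      = \<sigma>\<^sup>2 * (1 + (\<sigma>\<^sup>2 * nsq z) * chart_coeff k l (\<sigma>\<^sup>2 * nsq z))"
    by (simp add: algebra_simps power2_eq_square power4_eq_xxxx)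
  also have "\<dots> > 0"
    using d[OF z] chart_coeff_eq[of k l "\<sigma>\<^sup>2 * nsq z"] assms(1) by simp
  finally show "0 < v \<bullet> (chart_metric \<sigma> k l z *v v)"
    unfolding chart_metric_def using \<open>v \<noteq> 0\<close> assms(1) by (intro rotinv_metric_pos) simp_all
next
  fix x assume x: "x \<in> annulus b"
  let ?s = "\<sigma>\<^sup>2 * (x $ 1)\<^sup>2"
  have d: "0 < den k l ?s" using dom x by (simp add: tip_domain_def annulus_def)
  have "pullback polar (chart_metric \<sigma> k l) x =
      diag2 (\<sigma>\<^sup>2) ((x $ 1)\<^sup>2 * (\<sigma>\<^sup>2 + \<sigma> ^ 4 * chart_coeff k l ?s * (x $ 1)\<^sup>2))"
    by (rule pullback_polar_rotinv_metric) (simp add: chart_metric_def)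
  also have "(x $ 1)\<^sup>2 * (\<sigma>\<^sup>2 + \<sigma> ^ 4 * chart_coeff k l ?s * (x $ 1)\<^sup>2) = ?s * (1 + ?s * chart_coeff k l ?s)"
    by (simp add: algebra_simps power2_eq_square power4_eq_xxxx)
  also have "\<dots> = (tip_warp k l (\<sigma> * x $ 1))\<^sup>2"
    using d chart_coeff_eq[of k l ?s] den_square[of k l "\<sigma> * x $ 1"]
    by (simp add: tip_warp_def csin_def power_mult_distrib power_divide)
  finally show "pullback polar (chart_metric \<sigma> k l) x = pullback Q g x"
    using pb[OF x] by simp
qed

lemma potential_lift_den:
  assumes dom: "tip_domain b 1 k l" and V: "0 < V"
    and pb: "\<And>x. x \<in> annulus b \<Longrightarrow> f (Q x) = - ln (V * (1 + k * vers l (x $ 1)))"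
  shows "potential_lift b Q f (\<lambda>z. - ln (V * den k l (nsq z)))"
  unfolding potential_lift_def
proof (intro conjI ballI)
  have "0 < V * den k l (nsq z)" if "z \<in> disc b" for z
    using dom that V by (simp add: tip_domain_def disc_def nsq_eq_norm)
  then show "smooth_fun (disc b) (\<lambda>z. - ln (V * den k l (nsq z)))"
    unfolding den_def
    by (intro smooth_fun_single smooth_intros open_disc continuous_intros) auto
qed (simp add: pb den_square)

lemma rot_mult:
  "rot a *v z = vector [cos a * z $ 1 - sin a * z $ 2, sin a * z $ 1 + cos a * z $ 2]"
  by (simp add: rot_def mat2_simps)

lemma transpose_rot_mult:
  "transpose (rot a) *v z = vector [cos a * z $ 1 + sin a * z $ 2, - sin a * z $ 1 + cos a * z $ 2]"
  unfolding rot_def transpose_def by (simp add: vec_eq_2 matrix_vector_mult_def sum_2)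

lemma sin_times_sin: "sin a * (sin a * u) = u - cos a * (cos a * u)" for a u :: real
proof -
  have "sin a * sin a * u = (1 - cos a * cos a) * u"
    using sin_squared_eq[of a] by (simp add: power2_eq_square)
  then show ?thesis by (simp add: left_diff_distrib mult.assoc)
qed

lemma nsq_rot [simp]: "nsq (rot a *v z) = nsq z"
  by (simp add: nsq_def rot_mult power2_eq_square algebra_simps sin_times_sin)

lemma DERIV_stumpff_2_times: "DERIV (\<lambda>s. s * stumpff 2 (l * s)) s :> stumpff 1 (l * s) / 2"
proof -
  have "DERIV (\<lambda>s. s * stumpff 2 (l * s)) s :> stumpff 2 (l * s) + stumpff' 2 (l * s) * l * s"
    by (auto intro!: derivative_eq_intros DERIV_chain2[OF DERIV_stumpff])
  moreover have "stumpff 2 (l * s) + stumpff' 2 (l * s) * l * s = stumpff 1 (l * s) / 2"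
    using stumpff'_eq[of "l * s" 1] by (simp add: numeral_2_eq_2 algebra_simps)
  ultimately show ?thesis by simp
qed

text \<open>The form \<open>\<alpha> (x dy - y dx)\<close> with \<open>s \<alpha> = c E / (1 + k E)\<close>, where \<open>E = s stumpff 2 (l s)\<close>.\<close>

definition chart_connection :: "real \<Rightarrow> real \<Rightarrow> real \<Rightarrow> real ^ 2 \<Rightarrow> real ^ 2" where
  "chart_connection c k l z = (let \<alpha> = c * stumpff 2 (l * nsq z) / den k l (nsq z)
     in vector [- (\<alpha> * z $ 2), \<alpha> * z $ 1])"

lemma pdv_nsq_times_coord:
  assumes "DERIV \<alpha> (nsq z) :> \<alpha>'"
  shows "pdv i (\<lambda>y. \<alpha> (nsq y) * y $ j) z = \<alpha> (nsq z) * axis i 1 $ j + \<alpha>' * (2 * z $ i) * z $ j"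
proof -
  have n: "(nsq has_derivative (\<lambda>v. 2 * z $ 1 * v $ 1 + 2 * z $ 2 * v $ 2)) (at z)"
    unfolding nsq_def[abs_def] by (auto intro!: derivative_eq_intros has_derivative_coord)
  have "((\<lambda>y. \<alpha> (nsq y) * y $ j) has_derivative
     (\<lambda>v. \<alpha> (nsq z) * v $ j + (\<alpha>' * (2 * z $ 1 * v $ 1 + 2 * z $ 2 * v $ 2)) * z $ j)) (at z)"
    using has_derivative_mult[OF has_derivative_compose[OF n assms[unfolded has_field_derivative_def]]
        has_derivative_coord] .
  from pdv_eq_has_derivative[OF this, of i] show ?thesis
    using exhaust_2[of i] by (auto simp: axis_def)
qed

text \<open>The exterior derivative of \<open>\<alpha>(s) (x dy - y dx)\<close> is \<open>2 (s \<alpha>)' dx \<and> dy\<close>, and here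
  \<open>(s \<alpha>)' = c E' / (1 + k E)\<^sup>2\<close> with \<open>2 E' = stumpff 1 (l s)\<close>.\<close>

lemma ext_deriv_chart_connection:
  assumes "den k l (nsq z) \<noteq> 0"
  shows "ext_deriv (chart_connection c k l) z = area_form (c * stumpff 1 (l * nsq z) / (den k l (nsq z))\<^sup>2)"
proof -
  let ?a = "\<lambda>s. c * stumpff 2 (l * s) / den k l s" and ?s = "nsq z"
  let ?E = "\<lambda>s. s * stumpff 2 (l * s)"
  have den: "DERIV (den k l) ?s :> k * (stumpff 1 (l * ?s) / 2)"
    unfolding den_def[abs_def]
    using DERIV_add[OF DERIV_const DERIV_cmult[OF DERIV_stumpff_2_times]] by simp
  have "DERIV (\<lambda>s. stumpff 2 (l * s)) ?s :> stumpff' 2 (l * ?s) * l"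
    by (auto intro!: derivative_eq_intros DERIV_chain2[OF DERIV_stumpff])
  from DERIV_divide[OF DERIV_cmult[OF this, of c] den assms] obtain a' where a': "DERIV ?a ?s :> a'" by blast
  have "DERIV (\<lambda>s. s * ?a s) ?s :> ?a ?s + a' * ?s"
    using DERIV_mult[OF DERIV_ident a'] by simp
  moreover have "DERIV (\<lambda>s. c * (?E s / den k l s)) ?s :>
      c * ((stumpff 1 (l * ?s) / 2 * den k l ?s - ?E ?s * (k * (stumpff 1 (l * ?s) / 2))) / (den k l ?s * den k l ?s))"
    by (intro DERIV_cmult DERIV_divide DERIV_stumpff_2_times den assms)
  ultimately have "?a ?s + a' * ?s =
      c * ((stumpff 1 (l * ?s) / 2 * den k l ?s - ?E ?s * (k * (stumpff 1 (l * ?s) / 2))) / (den k l ?s * den k l ?s))"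
    by (intro DERIV_unique[of "\<lambda>s. s * ?a s"]) (simp_all add: mult_ac)
  also have "\<dots> = c * (stumpff 1 (l * ?s) / 2 * (den k l ?s - k * ?E ?s)) / (den k l ?s)\<^sup>2"
    by (simp add: power2_eq_square algebra_simps)
  also have "\<dots> = c * stumpff 1 (l * ?s) / (den k l ?s)\<^sup>2 / 2"
    by (simp add: den_def)
  finally have "?a ?s + a' * ?s = c * stumpff 1 (l * ?s) / (den k l ?s)\<^sup>2 / 2" .
  moreover have dbl: "2 * x + 2 * y = w" if "x + y = w / 2" for x y w :: real using that by simp
  ultimately have e: "2 * ?a ?s + 2 * (a' * ?s) = c * stumpff 1 (l * ?s) / (den k l ?s)\<^sup>2" by blast
  note P = pdv_nsq_times_coord[of ?a _ z, OF a']
  have a'': "DERIV (\<lambda>s. - ?a s) ?s :> - a'" by (intro DERIV_minus a')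
  note N = pdv_nsq_times_coord[of "\<lambda>s. - ?a s" _ z, OF a'']
  have "pdv 1 (\<lambda>y. chart_connection c k l y $ 2) z - pdv 2 (\<lambda>y. chart_connection c k l y $ 1) z
      = 2 * ?a ?s + 2 * (a' * ?s)"
    using P[of 1 1] N[of 2 2]
    by (simp add: chart_connection_def Let_def axis_def) (simp add: nsq_def power2_eq_square algebra_simps)
  with e show ?thesis by (simp add: vec_eq_2 ext_deriv_def)
qed

lemma curvature_lift_area_form:
  assumes dom: "tip_domain b 1 k l"
    and pb: "\<And>x. x \<in> annulus b \<Longrightarrow>
       pullback Q F x = area_form (c * csin l (x $ 1) / (1 + k * vers l (x $ 1))\<^sup>2)"
  shows "curvature_lift b Q m F (\<lambda>z. area_form (c * stumpff 1 (l * nsq z) / (den k l (nsq z))\<^sup>2))"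
proof -
  let ?H = "\<lambda>z. area_form (c * stumpff 1 (l * nsq z) / (den k l (nsq z))\<^sup>2)"
  have d: "0 < den k l (nsq z)" if "z \<in> disc b" for z
    using dom that by (simp add: tip_domain_def disc_def nsq_eq_norm)
  have d1: "smooth_fun (disc b) (\<lambda>z. w * (c * stumpff 1 (l * nsq z) / (den k l (nsq z))\<^sup>2))" for w
    unfolding den_def
    by (intro smooth_fun_single smooth_intros open_disc continuous_intros zero_less_power)
      (use d in \<open>simp add: den_def\<close>)
  have "smooth_fun (disc b) (\<lambda>z. ?H z $ i $ j)" for i j
    using exhaust_2[of i] exhaust_2[of j] d1[of 0] d1[of 1] d1[of "-1"] by auto
  then have 1: "two_form (disc b) ?H"
    by (simp add: two_form_def smooth_tensor_def mat2_simps)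
  have 2: "lifts_tensor b Q F ?H"
    unfolding lifts_tensor_def
  proof
    fix x assume x: "x \<in> annulus b"
    have "pullback polar ?H x = area_form (x $ 1 * (c * stumpff 1 (l * (x $ 1)\<^sup>2) / (den k l ((x $ 1)\<^sup>2))\<^sup>2))"
      by (rule pullback_polar_area_form) simp
    then show "pullback polar ?H x = pullback Q F x"
      by (simp add: pb[OF x] den_square csin_def mult_ac)
  qed
  have "smooth_fun (disc b) (\<lambda>z. chart_connection c k l z $ i)" for i
    using exhaust_2[of i]
  proof
    assume "i = 1"
    then show ?thesis
      unfolding chart_connection_def Let_def den_def
      by (simp only: vector_2, intro smooth_fun_single smooth_intros open_disc continuous_intros)
        (use d in \<open>simp add: den_def\<close>)
  next
    assume "i = 2"
    then show ?thesis
      unfolding chart_connection_def Let_def den_def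
      by (simp only: vector_2, intro smooth_fun_single smooth_intros open_disc continuous_intros)
        (use d in \<open>simp add: den_def\<close>)
  qed
  then have 3: "smooth_vec (disc b) (chart_connection c k l)"
    by (simp add: smooth_vec_def)
  have 4: "ext_deriv (chart_connection c k l) z = ?H z" if "z \<in> disc b" for z
    using d[OF that] by (intro ext_deriv_chart_connection) simp
  have 5: "transpose (rot a) *v chart_connection c k l (rot a *v z) = chart_connection c k l z" for a z
    by (simp add: chart_connection_def Let_def transpose_rot_mult del: transpose_matrix_vector)
      (simp add: vec_eq_2 rot_mult algebra_simps sin_times_sin add_divide_distrib diff_divide_distrib)
  show ?thesis
    unfolding curvature_lift_def using 1 2 3 4 5 by blast
qed

section \<open>The family of solitons\<close>

definition soliton_radius :: "real \<Rightarrow> ereal" where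
  "soliton_radius l = (if l \<le> 0 then \<infinity> else ereal (pi / sqrt l))"

text \<open>With \<open>v = 1 + vers l r / p\<close> the warping function is \<open>v' / v\<close>, the potential is \<open>- ln v\<close> and the
  curvature form is a constant multiple of \<open>v' / v\<^sup>2 dr \<and> d\<theta>\<close>. The constant is real for
  \<open>l \<ge> - 2 / p\<close> only, and vanishes at the cigar \<open>l = - 2 / p\<close>.\<close>

definition soliton :: "nat \<Rightarrow> real \<Rightarrow> rot_rym" where
  "soliton p l = \<lparr>
     radius = soliton_radius l,
     warp = (\<lambda>r. tip_warp (1 / p) l r / p),
     curv = (\<lambda>x. area_form (sqrt (2 * (2 / p + l)) / p * csin l (x $ 1) / (1 + 1 / p * vers l (x $ 1))\<^sup>2)),
     pot = (\<lambda>x. - ln (1 + 1 / p * vers l (x $ 1)))\<rparr>"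

lemma soliton_simps [simp]:
  "radius (soliton p l) = soliton_radius l"
  "warp (soliton p l) = (\<lambda>r. tip_warp (1 / p) l r / p)"
  "curv (soliton p l) = (\<lambda>x. area_form (sqrt (2 * (2 / p + l)) / p * csin l (x $ 1) / (1 + 1 / p * vers l (x $ 1))\<^sup>2))"
  "pot (soliton p l) = (\<lambda>x. - ln (1 + 1 / p * vers l (x $ 1)))"
  "metric_of (soliton p l) = warped (\<lambda>r. tip_warp (1 / p) l r / p)"
  by (simp_all add: soliton_def metric_of_def)

lemma soliton_radius_pos: "0 < soliton_radius l"
  by (simp add: soliton_radius_def)

lemma less_soliton_radius:
  assumes "0 \<le> r" "ereal r < soliton_radius l"
  shows "l * r\<^sup>2 < pi\<^sup>2"
proof (cases "l \<le> 0")
  case True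
  then have "l * r\<^sup>2 \<le> 0" by (simp add: mult_nonpos_nonneg)
  then show ?thesis using zero_less_power[OF pi_gt_zero, of 2] by linarith
next
  case False
  then have "sqrt l * r < pi" using assms by (simp add: soliton_radius_def field_simps)
  then have "(sqrt l * r)\<^sup>2 < pi\<^sup>2" using False assms(1) by (intro power_strict_mono) auto
  then show ?thesis using False by (simp add: power_mult_distrib)
qed

lemma one_plus_vers_pos: "0 \<le> k \<Longrightarrow> 0 < 1 + k * vers l r"
  using vers_nonneg[of l r] by (simp add: add_pos_nonneg)

lemma den_pos: "0 \<le> k \<Longrightarrow> 0 \<le> s \<Longrightarrow> 0 < den k l s"
  by (simp add: den_def add_pos_nonneg stumpff_2_nonneg)

lemma csin_pos: "0 < r \<Longrightarrow> ereal r < soliton_radius l \<Longrightarrow> 0 < csin l r"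
  using less_soliton_radius[of r l] by (simp add: csin_def stumpff_Suc_0_pos)

lemma tip_warp_pos: "0 \<le> k \<Longrightarrow> 0 < r \<Longrightarrow> ereal r < soliton_radius l \<Longrightarrow> 0 < tip_warp k l r"
  by (simp add: tip_warp_def csin_pos one_plus_vers_pos)

lemma tip_domain_near: "0 \<le> k \<Longrightarrow> tip_domain (soliton_radius l) 1 k l"
  by (simp add: tip_domain_def den_pos stumpff_Suc_0_pos less_soliton_radius)

lemma tip_domain_nonpos: "0 \<le> k \<Longrightarrow> l \<le> 0 \<Longrightarrow> tip_domain \<infinity> \<sigma> k l"
proof -
  assume k: "0 \<le> k" and l: "l \<le> 0"
  have "l * (\<sigma>\<^sup>2 * r\<^sup>2) < pi\<^sup>2" for r
    using l zero_less_power[OF pi_gt_zero, of 2] mult_nonpos_nonneg[of l "\<sigma>\<^sup>2 * r\<^sup>2"]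
    by (smt (verit) zero_le_mult_iff zero_le_power2)
  then show ?thesis using k by (simp add: tip_domain_def den_pos stumpff_Suc_0_pos)
qed

lemma pullback_near_chart_soliton:
  assumes "p > 0"
  shows "pullback (near_chart p) (warped (\<lambda>r. tip_warp k l r / p)) x = diag2 (1\<^sup>2) ((tip_warp k l (1 * x $ 1))\<^sup>2)"
proof -
  have "pullback (near_chart p) (warped (\<lambda>r. tip_warp k l r / p)) x
      = diag2 1 ((real p)\<^sup>2 * (tip_warp k l (x $ 1) / p)\<^sup>2)"
    by (rule pullback_near_chart_diag2) (simp add: warped_eq_diag2 near_chart_def)
  then show ?thesis using assms by (simp add: power_divide)
qed

lemma metric_lift_near:
  "p > 0 \<Longrightarrow> metric_lift (soliton_radius l) (near_chart p) (metric_of (soliton p l)) (chart_metric 1 (1 / p) l)"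
  by (intro metric_lift_chart_metric tip_domain_near) (simp_all add: pullback_near_chart_soliton)

lemma soliton_tip_near:
  assumes "p > 0"
  shows "orbifold_tip_near (soliton p l) p"
proof -
  have "DERIV (\<lambda>r. tip_warp (1 / p) l r / p) 0 :> 1 / p"
    using DERIV_cdivide[OF DERIV_tip_warp[of "1 / p" l 0], of "real p"]
    by (simp add: tip_warp1_def vers_def csin_def)
  then have "((\<lambda>r. tip_warp (1 / p) l r / p) has_real_derivative 1 / p) (at 0 within {0..})"
    by (rule has_field_derivative_at_within)
  then show ?thesis
    using assms metric_lift_near[OF assms, of l]
    by (auto simp: orbifold_tip_near_def tip_warp_def csin_def)
qed

lemma warped_surface_soliton:
  fixes p :: nat
  assumes "p > 0"
  shows "warped_surface (soliton_radius l) (\<lambda>r. tip_warp (1 / p) l r / p)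
    (\<lambda>r. tip_warp1 (1 / p) l r / p) (\<lambda>r. tip_warp2 (1 / p) l r / p)"
proof
  fix r :: real assume r: "0 < r" "ereal r < soliton_radius l"
  have nz: "1 + 1 / p * vers l r \<noteq> 0" using one_plus_vers_pos[of "1 / p" l r] by simp
  show "0 < tip_warp (1 / p) l r / p" using r assms by (simp add: tip_warp_pos)
  show "DERIV (\<lambda>r. tip_warp (1 / p) l r / p) r :> tip_warp1 (1 / p) l r / p"
    by (intro DERIV_cdivide DERIV_tip_warp nz)
  show "DERIV (\<lambda>r. tip_warp1 (1 / p) l r / p) r :> tip_warp2 (1 / p) l r / p"
    by (intro DERIV_cdivide DERIV_tip_warp1 nz)
qed

text \<open>The scalar soliton equation, with \<open>e = vers l r\<close> and \<open>u = csin l r\<close>: after clearing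
  denominators it is quadratic in \<open>e\<close>, once \<open>u\<^sup>2\<close> is eliminated.\<close>

lemma soliton_identity:
  fixes k l v u e :: real
  assumes "v = 1 + k * e" "u\<^sup>2 = 2 * e - l * e\<^sup>2" "v \<noteq> 0"
  shows "l + 3 * k * (1 - l * e) / v - 2 * k\<^sup>2 * u\<^sup>2 / v\<^sup>2 - (2 * k + l) / v\<^sup>2
    - k * ((1 - l * e) / v - k * u\<^sup>2 / v\<^sup>2) = 0"
proof -
  have "l + 3 * k * (1 - l * e) / v - 2 * k\<^sup>2 * u\<^sup>2 / v\<^sup>2 - (2 * k + l) / v\<^sup>2
    - k * ((1 - l * e) / v - k * u\<^sup>2 / v\<^sup>2) =
    (l * v\<^sup>2 + 2 * k * (1 - l * e) * v - k\<^sup>2 * u\<^sup>2 - (2 * k + l)) / v\<^sup>2"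
    using assms(3) by (simp add: field_simps power2_eq_square)
  also have "l * v\<^sup>2 + 2 * k * (1 - l * e) * v - k\<^sup>2 * u\<^sup>2 - (2 * k + l) = 0"
    unfolding assms(2) unfolding assms(1) by (simp add: algebra_simps power2_eq_square)
  finally show ?thesis by simp
qed

lemma smooth_warped_soliton:
  "smooth_tensor U (warped (\<lambda>r. tip_warp (1 / real p) l r / p))" if "open U"
proof -
  have pos: "0 < 1 + 1 / real p * ((x $ 1)\<^sup>2 * stumpff 2 (l * (x $ 1)\<^sup>2))" for x :: "real ^ 2"
    using one_plus_vers_pos[of "1 / p" l "x $ 1"] by (simp add: vers_def)
  have c: "smooth_fun U (\<lambda>x. c)" for c
    by (intro smooth_fun_single smooth_intros that continuous_intros)
  have "smooth_fun U (\<lambda>x. (tip_warp (1 / real p) l (x $ 1) * inverse p)\<^sup>2)"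
    unfolding tip_warp_def csin_def vers_def
    by (intro smooth_fun_single smooth_intros that continuous_intros pos)
  then show ?thesis
    unfolding smooth_tensor_def warped_eq_diag2
    by (auto simp: forall_2 c divide_inverse)
qed

text \<open>Since \<open>f' = - \<phi>\<close>, the Hessian of \<open>f\<close> is the multiple \<open>- \<phi>'\<close> of the metric, like every other
  term of the equation, and a single scalar equation remains.\<close>

lemma soliton_equation:
  assumes p: "p > 0" and l: "- 2 / real p \<le> l"
  shows "steady_rym_soliton (annulus (soliton_radius l)) (metric_of (soliton p l)) (curv (soliton p l)) (pot (soliton p l))"
  unfolding steady_rym_soliton_def gradient_rym_soliton_def
proof (intro conjI ballI)
  interpret warped_surface "soliton_radius l" "\<lambda>r. tip_warp (1 / p) l r / p"
    "\<lambda>r. tip_warp1 (1 / p) l r / p" "\<lambda>r. tip_warp2 (1 / p) l r / p"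
    by (rule warped_surface_soliton[OF p])
  let ?U = "annulus (soliton_radius l)" and ?k = "1 / real p"
  let ?C = "sqrt (2 * (2 / p + l))"
  have pos1: "0 < 1 + ?k * vers l r" for r
    by (rule one_plus_vers_pos) simp
  have pos': "0 < 1 + ?k * ((x $ 1)\<^sup>2 * stumpff 2 (l * (x $ 1)\<^sup>2))" for x :: "real ^ 2"
    using pos1[of "x $ 1"] by (simp add: vers_def)
  show "riemannian_metric ?U (metric_of (soliton p l))"
    unfolding riemannian_metric_def
  proof (intro conjI ballI allI impI)
    show "smooth_tensor ?U (metric_of (soliton p l))"
      using smooth_warped_soliton[OF open_annulus] by simp
    fix x assume x: "x \<in> ?U"
    show "transpose (metric_of (soliton p l) x) = metric_of (soliton p l) x"
      by (simp add: mat2_simps warped_eq_diag2)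
    fix v :: "real ^ 2" assume v: "v \<noteq> 0"
    define w where "w = tip_warp ?k l (x $ 1) / p"
    have "w \<noteq> 0" using \<phi>_nz[OF x] by (simp add: w_def)
    moreover have "v \<bullet> (metric_of (soliton p l) x *v v) = (v $ 1)\<^sup>2 + (w * v $ 2)\<^sup>2"
      by (simp add: mat2_simps warped_eq_diag2 w_def power2_eq_square)
    ultimately show "0 < v \<bullet> (metric_of (soliton p l) x *v v)"
      using v by (simp add: vec_eq_2 sum_power2_gt_zero_iff)
  qed
  have F: "smooth_fun ?U (\<lambda>x. w * (?C / p * csin l (x $ 1) / (1 + ?k * vers l (x $ 1))\<^sup>2))" for w
    unfolding csin_def vers_def
    by (intro smooth_fun_single smooth_intros open_annulus continuous_intros zero_less_power pos') (use p in simp_all)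
  then show "two_form ?U (curv (soliton p l))"
    using F[of 0] F[of 1] F[of "-1"]
    by (auto simp: two_form_def smooth_tensor_def forall_2 mat2_simps)
  show "smooth_fun ?U (pot (soliton p l))"
    unfolding soliton_simps vers_def
    by (intro smooth_fun_single smooth_intros open_annulus continuous_intros pos')
  fix x assume x: "x \<in> ?U"
  define v where "v = 1 + ?k * vers l (x $ 1)"
  define u where "u = csin l (x $ 1)"
  define e where "e = vers l (x $ 1)"
  have v0: "v > 0" using pos1 by (simp add: v_def)
  have u0: "u > 0" using r_range[OF x] csin_pos by (simp add: u_def)
  have C: "?C\<^sup>2 = 2 * (2 * ?k + l)" using l by (simp add: algebra_simps)
  define \<phi> where "\<phi> = ?k * u / v"
  have \<phi>: "tip_warp ?k l (x $ 1) / p = \<phi>" by (simp add: \<phi>_def tip_warp_def u_def v_def)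
  have h1: "DERIV (\<lambda>r. - ln (1 + ?k * vers l r)) r :> - (tip_warp ?k l r / p)" for r
    using p pos1[of r]
    by (auto intro!: derivative_eq_intros DERIV_vers simp: tip_warp_def)
  have h2: "DERIV (\<lambda>r. - (tip_warp ?k l r / p)) r :> - (tip_warp1 ?k l r / p)" for r
    using pos1[of r] by (intro DERIV_minus DERIV_cdivide DERIV_tip_warp) simp
  define \<phi>1 where "\<phi>1 = ((1 - l * e) / v - ?k * u\<^sup>2 / v\<^sup>2) / p"
  define \<phi>2 where "\<phi>2 = (- (l * u / v) - 3 * ?k * u * (1 - l * e) / v\<^sup>2 + 2 * ?k\<^sup>2 * u ^ 3 / v ^ 3) / p"
  have hess: "hessian (warped (\<lambda>r. tip_warp ?k l r / p)) (pot (soliton p l)) x = diag2 (- \<phi>1) (- (\<phi> * \<phi>1 * \<phi>))"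
    using hessian_warped[OF x h1 h2] by (simp add: \<phi> \<phi>1_def tip_warp1_def u_def v_def e_def)
  have ric: "ricci (warped (\<lambda>r. tip_warp ?k l r / p)) x = (- (\<phi>2 / \<phi>)) *\<^sub>R diag2 1 (\<phi>\<^sup>2)"
    using ricci_warped[OF x] by (simp add: \<phi> \<phi>2_def tip_warp2_def u_def v_def e_def warped_eq_diag2)
  have sq: "form_square (warped (\<lambda>r. tip_warp ?k l r / p)) (curv (soliton p l)) x = (?C / v)\<^sup>2 *\<^sub>R diag2 1 (\<phi>\<^sup>2)"
  proof -
    have "curv (soliton p l) x = area_form (?C / p * u / v\<^sup>2)"
      by (simp add: u_def v_def)
    from form_square_warped[where F = "curv (soliton p l)", OF x this]
    have "form_square (warped (\<lambda>r. tip_warp ?k l r / p)) (curv (soliton p l)) x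
        = (?C / p * u / v\<^sup>2 / \<phi>)\<^sup>2 *\<^sub>R diag2 1 (\<phi>\<^sup>2)"
      unfolding \<phi> warped_eq_diag2 .
    moreover have "?C / p * u / v\<^sup>2 / \<phi> = ?C / v"
      using u0 v0 p by (simp add: \<phi>_def power2_eq_square)
    ultimately show ?thesis by (simp only:)
  qed
  have ph2: "- (\<phi>2 / \<phi>) = l + 3 * ?k * (1 - l * e) / v - 2 * ?k\<^sup>2 * u\<^sup>2 / v\<^sup>2"
    using p u0 v0 by (simp add: \<phi>2_def \<phi>_def field_simps power2_eq_square power3_eq_cube)
  have zero: "- (\<phi>2 / \<phi>) - 1 / 2 * (?C / v)\<^sup>2 - \<phi>1 = 0"
  proof -
    have half: "1 / 2 * (2 * X / w) = X / w" for X w :: real by simp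
    have "1 / 2 * (?C / v)\<^sup>2 = (2 * ?k + l) / v\<^sup>2" unfolding power_divide C by (rule half)
    moreover have "\<phi>1 = ?k * ((1 - l * e) / v - ?k * u\<^sup>2 / v\<^sup>2)" by (simp add: \<phi>1_def)
    moreover have "u\<^sup>2 = 2 * e - l * e\<^sup>2" unfolding u_def e_def by (rule csin_square)
    ultimately show ?thesis
      using soliton_identity[of v ?k e u l] v0 unfolding ph2 by (simp only: v_def e_def)
  qed
  have sum_zero: "a *\<^sub>R diag2 1 (w\<^sup>2) - (1 / 2) *\<^sub>R (c *\<^sub>R diag2 1 (w\<^sup>2))
      + diag2 (- (a - 1 / 2 * c)) (- (w * (a - 1 / 2 * c) * w)) = 0" for a c w
    by (simp add: vec_eq_2 power2_eq_square algebra_simps)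
  from zero have eq: "- (\<phi>2 / \<phi>) - 1 / 2 * (?C / v)\<^sup>2 = \<phi>1" by simp
  show "ricci (metric_of (soliton p l)) x - (1 / 2) *\<^sub>R form_square (metric_of (soliton p l)) (curv (soliton p l)) x
     + hessian (metric_of (soliton p l)) (pot (soliton p l)) x = 0 *\<^sub>R metric_of (soliton p l) x"
    unfolding soliton_simps(5) hess ric sq eq[symmetric] scaleR_zero_left by (rule sum_zero)
  show "divergence (metric_of (soliton p l)) (\<lambda>y. exp (- pot (soliton p l) y) *\<^sub>R curv (soliton p l) y) x = 0"
    unfolding soliton_simps(5)
  proof (rule divergence_area_form[OF x])
    fix y :: "real ^ 2"
    show "exp (- pot (soliton p l) y) *\<^sub>R curv (soliton p l) y = area_form (?C * (tip_warp (1 / p) l (y $ 1) / p))"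
      using pos1[of "y $ 1"] by (simp add: vec_eq_2 tip_warp_def power2_eq_square)
  qed
qed

subsection \<open>The far tip\<close>

text \<open>The reflection \<open>r \<mapsto> B - r\<close> maps \<open>csin\<close> to itself and \<open>vers\<close> to \<open>2 / l - vers\<close>. Hence the second
  tip looks like the first one, with \<open>1 / p\<close> replaced by \<open>- l / (p l + 2)\<close>.\<close>

context
  fixes l B :: real
  assumes l: "0 < l" and B: "B = pi / sqrt l"
begin

lemma sqrt_times_far: "sqrt l * (B - r) = pi - sqrt l * r"
  using l by (simp add: B field_simps)

lemma csin_far: "csin l (B - r) = csin l r"
  unfolding csin_eq_sin[OF l] sqrt_times_far by (simp add: sin_diff)

lemma vers_far: "vers l (B - r) = 2 / l - vers l r"
  unfolding vers_eq_cos[OF l] sqrt_times_far by (simp add: cos_diff diff_divide_distrib add_divide_distrib)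

lemma one_plus_vers_far:
  fixes p :: nat
  assumes "p > 0"
  shows "1 + 1 / real p * vers l (B - r) = (p * l + 2) / (p * l) * (1 + (- (l / (p * l + 2))) * vers l r)"
proof -
  have pl: "0 < p * l + 2" using l assms by (simp add: add_pos_pos)
  have a: "a / (p * l) * (1 + (- (l / a)) * w) = a / (p * l) - w / p" if "a > 0" for a w
    using that l assms by (simp add: field_simps)
  show ?thesis unfolding vers_far a[OF pl] using l assms by (simp add: field_simps)
qed

lemma tip_warp_far:
  fixes p :: nat
  assumes "p > 0"
  shows "tip_warp (1 / p) l (B - r) / p = l / (p * l + 2) * tip_warp (- (l / (p * l + 2))) l r"
proof -
  have "0 < p * l + 2" using l assms by (simp add: add_pos_pos)
  then show ?thesis using l assms unfolding tip_warp_def csin_far one_plus_vers_far[OF assms]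
    by simp
qed

lemma DERIV_warp_far:
  fixes p :: nat
  assumes "p > 0"
  shows "((\<lambda>r. tip_warp (1 / p) l r / p) has_real_derivative - (l / (p * l + 2))) (at B)"
proof -
  have 0: "csin l B = 0" "vers l B = 2 / l"
    using csin_far[of 0] vers_far[of 0] by (simp_all add: csin_def vers_def)
  have "1 + 1 / p * vers l B \<noteq> 0" using one_plus_vers_pos[of "1 / p" l B] by simp
  from DERIV_cdivide[OF DERIV_tip_warp[OF this], of "real p"]
  have "((\<lambda>r. tip_warp (1 / p) l r / p) has_real_derivative - (1 / (1 + 2 / (p * l)) / p)) (at B)"
    using l by (simp add: 0 tip_warp1_def)
  moreover have "1 / (1 + 2 / (p * l)) / p = l / (p * l + 2)"
  proof -
    have "1 + 2 / (p * l) = (p * l + 2) / (p * l)" using l assms by (simp add: field_simps)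
    then show ?thesis using assms by simp
  qed
  ultimately show ?thesis by simp
qed

lemma tip_domain_far:
  fixes p :: nat
  assumes "p > 0"
  shows "tip_domain (ereal B) 1 (- (l / (p * l + 2))) l"
  unfolding tip_domain_def
proof (intro allI impI)
  fix r assume r: "0 \<le> r \<and> ereal r < ereal B"
  have pl: "0 < p * l" "0 < p * l + 2" using l assms by (simp_all add: add_pos_pos)
  have "0 < 1 + 1 / real p * vers l (B - r)" by (rule one_plus_vers_pos) simp
  then have "0 < 1 + (- (l / (p * l + 2))) * vers l r"
    unfolding one_plus_vers_far[OF assms] using pl by (simp add: zero_less_mult_iff zero_less_divide_iff)
  then have "0 < den (- (l / (p * l + 2))) l (r\<^sup>2)" by (simp add: den_square)
  moreover have "0 < stumpff 1 (l * r\<^sup>2)"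
    using less_soliton_radius[of r l] l r by (intro stumpff_1_pos) (simp add: soliton_radius_def B)
  ultimately show "0 < den (- (l / (p * l + 2))) l (1\<^sup>2 * r\<^sup>2) \<and> 0 < stumpff 1 (l * (1\<^sup>2 * r\<^sup>2))" by simp
qed

end

text \<open>The surface closes up with slope \<open>- l / (p l + 2)\<close>, and a one-sided derivative is unique.\<close>

lemma orbifold_tip_far_order:
  assumes "p > 0" "orbifold_tip_far (soliton p l) q"
  shows "0 < l" "real q * l = real p * l + 2" "q > 0"
proof -
  obtain B where B: "soliton_radius l = ereal B"
    "((\<lambda>r. tip_warp (1 / p) l r / p) has_real_derivative - 1 / q) (at B within {..B})" and q: "1 \<le> q"
    using assms(2) by (auto simp: orbifold_tip_far_def)
  show l: "0 < l" using B(1) by (auto simp: soliton_radius_def split: if_splits)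
  have B': "B = pi / sqrt l" using B(1) l by (simp add: soliton_radius_def)
  show q0: "q > 0" using q by simp
  have "- 1 / real q = - (l / (p * l + 2))"
  proof (rule has_field_derivative_unique[OF B(2)])
    show "((\<lambda>r. tip_warp (1 / p) l r / p) has_real_derivative - (l / (p * l + 2))) (at B within {..B})"
      using DERIV_warp_far[OF l B' assms(1)] by (rule has_field_derivative_at_within)
    show "at B within {..B} \<noteq> bot"
    proof
      assume "at B within {..B} = bot"
      moreover have "at_left B \<le> at B within {..B}" by (rule at_le) auto
      ultimately show False using trivial_limit_at_left_real[of B] by (simp add: bot_unique)
    qed
  qed
  moreover have "0 < p * l + 2" using l by (simp add: add_nonneg_pos)
  ultimately show "real q * l = real p * l + 2" using q0 by (simp add: field_simps)
qed

lemma soliton_tip_far: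
  assumes p: "p > 0" and l: "0 < l" and q: "real q * l = real p * l + 2"
  shows "orbifold_tip_far (soliton p l) q"
proof -
  define B where "B = pi / sqrt l"
  have pl: "0 < p * l + 2" using l by (simp add: add_nonneg_pos)
  then have q0: "0 < q" using q l by (metis mult_zero_left not_gr0 of_nat_0 less_irrefl)
  have lq: "l / (p * l + 2) = 1 / q" using q l pl q0 by (simp add: field_simps)
  have "metric_lift (ereal B) (far_chart B q) (metric_of (soliton p l)) (chart_metric 1 (- (1 / q)) l)"
  proof (rule metric_lift_chart_metric)
    show "tip_domain (ereal B) 1 (- (1 / q)) l"
      using tip_domain_far[OF l B_def p] by (simp add: lq)
    fix x :: "real ^ 2"
    have "tip_warp (1 / p) l (B - x $ 1) / p = 1 / q * tip_warp (- (1 / q)) l (x $ 1)"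
      using tip_warp_far[OF l B_def p, of "x $ 1"] by (simp only: lq)
    then have "pullback (far_chart B q) (metric_of (soliton p l)) x
        = diag2 1 ((real q)\<^sup>2 * (1 / q * tip_warp (- (1 / q)) l (x $ 1))\<^sup>2)"
      by (intro pullback_far_chart_diag2) (simp add: warped_eq_diag2 far_chart_def)
    then show "pullback (far_chart B q) (metric_of (soliton p l)) x
        = diag2 (1\<^sup>2) ((tip_warp (- (1 / q)) l (1 * x $ 1))\<^sup>2)"
      using q0 by (simp add: power_divide)
  qed simp
  moreover have "csin l B = 0"
    using csin_far[OF l B_def, of 0] by (simp add: csin_def)
  moreover have "((\<lambda>r. tip_warp (1 / p) l r / p) has_real_derivative - 1 / q) (at B within {..B})"
    using has_field_derivative_at_within[OF DERIV_warp_far[OF l B_def p]] by (simp add: lq)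
  ultimately show ?thesis
    using l q0 by (auto simp: orbifold_tip_far_def soliton_radius_def B_def tip_warp_def intro!: exI[of _ B])
qed

lemma pullback_area_form_far:
  fixes p m :: nat and l :: real
  assumes p: "p > 0" and l: "0 < l" and B: "B = pi / sqrt l"
    and F: "F = (\<lambda>x. area_form (c * csin l (x $ 1) / (1 + 1 / real p * vers l (x $ 1))\<^sup>2))"
  shows "pullback (far_chart B m) F x =
    area_form ((- real m * c / ((p * l + 2) / (p * l))\<^sup>2) * csin l (x $ 1) / (1 + (- (l / (p * l + 2))) * vers l (x $ 1))\<^sup>2)"
proof -
  have "pullback (far_chart B m) F x =
      area_form (- (real m * (c * csin l (x $ 1) / ((p * l + 2) / (p * l) * (1 + (- (l / (p * l + 2))) * vers l (x $ 1)))\<^sup>2)))"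
    by (rule pullback_far_chart_area_form)
      (simp only: F far_chart_def vector_2 csin_far[OF l B] one_plus_vers_far[OF l B p])
  moreover have "- (real m * (c * u / (V * W)\<^sup>2)) = (- real m * c / V\<^sup>2) * u / W\<^sup>2" for u V W
    by (simp add: power_mult_distrib)
  ultimately show ?thesis by (simp only:)
qed

lemma rot_symmetric_soliton: "p > 0 \<Longrightarrow> rot_symmetric (soliton p l)"
  by (auto simp: rot_symmetric_def soliton_radius_pos tip_warp_pos)

lemma rot_steady_soliton_soliton:
  assumes p: "p > 0" and l: "- 2 / real p \<le> l"
  shows "rot_steady_soliton p (soliton p l)"
  unfolding rot_steady_soliton_def
proof (intro conjI allI impI)
  show "rot_symmetric (soliton p l)" by (rule rot_symmetric_soliton[OF p])
  show "cone_point_if_closed (soliton p l)"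
    unfolding cone_point_if_closed_def
  proof (intro allI impI)
    fix B assume "radius (soliton p l) = ereal B \<and> warp (soliton p l) B = 0"
    then have "0 < l" "B = pi / sqrt l" by (auto simp: soliton_radius_def split: if_splits)
    moreover have "0 < l / (p * l + 2)" using \<open>0 < l\<close> by (simp add: add_nonneg_pos)
    ultimately show "\<exists>c>0. (warp (soliton p l) has_real_derivative - c) (at B within {..B})"
      using has_field_derivative_at_within[OF DERIV_warp_far[of l B p]] p by auto
  qed
  show "steady_rym_soliton (annulus (radius (soliton p l))) (metric_of (soliton p l)) (curv (soliton p l)) (pot (soliton p l))"
    using soliton_equation[OF assms] by (simp del: soliton_simps(2-))
  show "orbifold_tip_near (soliton p l) p" by (rule soliton_tip_near[OF p])
  show "\<exists>h. potential_lift (radius (soliton p l)) (near_chart p) (pot (soliton p l)) h"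
    using potential_lift_den[OF tip_domain_near, of "1 / p" 1 l "pot (soliton p l)" "near_chart p"]
    by (auto simp: near_chart_def)
  show "\<exists>H. curvature_lift (radius (soliton p l)) (near_chart p) p (curv (soliton p l)) H"
  proof -
    have "pullback (near_chart p) (curv (soliton p l)) x =
        area_form (sqrt (2 * (2 / p + l)) * csin l (x $ 1) / (1 + 1 / p * vers l (x $ 1))\<^sup>2)" for x
    proof -
      have "pullback (near_chart p) (curv (soliton p l)) x =
        area_form (p * (sqrt (2 * (2 / p + l)) / p * csin l (x $ 1) / (1 + 1 / p * vers l (x $ 1))\<^sup>2))"
        by (rule pullback_near_chart_area_form) (simp add: near_chart_def)
      then show ?thesis using p by simp
    qed
    from curvature_lift_area_form[where m = p, OF tip_domain_near this] show ?thesis by auto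
  qed
  fix q B assume "orbifold_tip_far (soliton p l) q \<and> radius (soliton p l) = ereal B"
  then have far: "orbifold_tip_far (soliton p l) q" and rB: "soliton_radius l = ereal B" by simp_all
  have l0: "0 < l" and q: "real q * l = real p * l + 2" and q0: "q > 0"
    using orbifold_tip_far_order[OF p far] by auto
  have B: "B = pi / sqrt l" using rB l0 by (simp add: soliton_radius_def)
  have V: "0 < (p * l + 2) / (p * l)" using p l0 by (simp add: add_pos_pos)
  show "\<exists>h. potential_lift (radius (soliton p l)) (far_chart B q) (pot (soliton p l)) h"
    using potential_lift_den[OF tip_domain_far[OF l0 B p] V, of "pot (soliton p l)" "far_chart B q"]
      one_plus_vers_far[OF l0 B p]
    by (auto simp: far_chart_def rB)
  show "\<exists>H. curvature_lift (radius (soliton p l)) (far_chart B q) q (curv (soliton p l)) H"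
    using curvature_lift_area_form[OF tip_domain_far[OF l0 B p]
        pullback_area_form_far[OF p l0 B soliton_simps(3), of q], of q]
    by (auto simp: rB)
qed

lemma football_soliton:
  assumes p: "p > 0" and q: "p < q"
  shows "football_orbifold p q (soliton p (2 / (real q - real p)))"
  unfolding football_orbifold_def
  using rot_symmetric_soliton[OF p] soliton_tip_near[OF p] soliton_tip_far[OF p, of "2 / (real q - real p)" q] q
  by (simp add: field_simps)

subsection \<open>Dependence on the parameter\<close>

lemma continuous_on_stumpff: "continuous_on S f \<Longrightarrow> continuous_on S (\<lambda>x. stumpff k (f x))"
  using continuous_on_compose2[OF DERIV_continuous_on[OF DERIV_stumpff[THEN has_field_derivative_at_within], of UNIV]]
  by blast

lemma continuous_on_vers [continuous_intros]:
  "continuous_on S f \<Longrightarrow> continuous_on S g \<Longrightarrow> continuous_on S (\<lambda>x. vers (f x) (g x))"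
  unfolding vers_def by (intro continuous_intros continuous_on_stumpff)

lemma continuous_on_csin [continuous_intros]:
  "continuous_on S f \<Longrightarrow> continuous_on S g \<Longrightarrow> continuous_on S (\<lambda>x. csin (f x) (g x))"
  unfolding csin_def by (intro continuous_intros continuous_on_stumpff)

lemma continuous_on_tip_warp [continuous_intros]:
  assumes "0 \<le> k" "continuous_on S f" "continuous_on S g"
  shows "continuous_on S (\<lambda>x. tip_warp k (f x) (g x))"
  unfolding tip_warp_def using assms one_plus_vers_pos[OF assms(1)]
  by (intro continuous_intros) (auto simp: less_le)

lemma isCont_soliton_radius: "isCont soliton_radius l"
proof -
  consider "l < 0" | "l = 0" | "l > 0" by linarith
  then show ?thesis
  proof cases
    case 1
    have "\<forall>\<^sub>F x in nhds l. x < 0" using 1 by (intro eventually_nhds_in_open[of "{..<0}", simplified]) auto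
    then have "\<forall>\<^sub>F x in nhds l. soliton_radius x = \<infinity>"
      by (rule eventually_mono) (simp add: soliton_radius_def)
    then have "isCont soliton_radius l \<longleftrightarrow> isCont (\<lambda>_. \<infinity> :: ereal) l" by (rule isCont_cong)
    then show ?thesis by simp
  next
    case 3
    have "\<forall>\<^sub>F x in nhds l. x > 0" using 3 by (intro eventually_nhds_in_open[of "{0<..}", simplified]) auto
    then have "\<forall>\<^sub>F x in nhds l. soliton_radius x = ereal (pi / sqrt x)"
      by (rule eventually_mono) (simp add: soliton_radius_def)
    then have "isCont soliton_radius l \<longleftrightarrow> isCont (\<lambda>x. ereal (pi / sqrt x)) l" by (rule isCont_cong)
    then show ?thesis using 3 by (simp add: isCont_def) (intro tendsto_intros, simp)
  next
    case 2
    have "\<forall>\<^sub>F x in at 0. ereal c < soliton_radius x" for c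
    proof -
      define d where "d = pi / (\<bar>c\<bar> + 1)"
      have d: "d > 0" by (simp add: d_def)
      have "\<forall>\<^sub>F x in nhds (0::real). x < d\<^sup>2" using d by (intro eventually_nhds_in_open[of "{..<d\<^sup>2}", simplified]) auto
      then have "\<forall>\<^sub>F x in at (0::real). x < d\<^sup>2" by (rule eventually_at_filter[THEN iffD2, OF eventually_mono]) simp
      then show ?thesis
      proof (rule eventually_mono)
        fix x assume x: "x < d\<^sup>2"
        show "ereal c < soliton_radius x"
        proof (cases "x \<le> 0")
          case False
          have "sqrt x < d" using x d real_less_lsqrt[of d x] False by simp
          then have "sqrt x * (\<bar>c\<bar> + 1) < pi" by (simp add: d_def field_simps)
          then have "\<bar>c\<bar> + 1 < pi / sqrt x" using False by (simp add: field_simps)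
          then show ?thesis using False by (simp add: soliton_radius_def)
        qed (simp add: soliton_radius_def)
      qed
    qed
    then have "(soliton_radius \<longlongrightarrow> \<infinity>) (at 0)" by (simp add: tendsto_PInfty)
    then show ?thesis using 2 by (simp add: isCont_def soliton_radius_def)
  qed
qed

lemma continuous_family_soliton:
  assumes p: "p > 0"
  shows "continuous_family I (soliton p)"
proof -
  define D where "D = {(l, x). l \<in> I \<and> x \<in> annulus (soliton_radius l)}"
  have pos: "1 + 1 / real p * vers l r \<noteq> 0" for l r
    using one_plus_vers_pos[of "1 / p" l r] by simp
  have m: "continuous_on D (\<lambda>z. (tip_warp (1 / real p) (fst z) (snd z $ 1) / p)\<^sup>2)"
    using p by (auto intro!: continuous_intros)
  have p': "real p \<noteq> 0" using p by simp
  have F: "continuous_on D (\<lambda>z. sqrt (2 * (2 / p + fst z)) / p * csin (fst z) (snd z $ 1) / (1 + 1 / p * vers (fst z) (snd z $ 1))\<^sup>2)"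
    by (intro continuous_intros ballI power_not_zero pos p')
  have f: "continuous_on D (\<lambda>z. - ln (1 + 1 / real p * vers (fst z) (snd z $ 1)))"
    using pos p by (auto intro!: continuous_intros)
  have "continuous_on I soliton_radius"
    using isCont_soliton_radius by (simp add: continuous_at_imp_continuous_on)
  moreover have "continuous_on D (\<lambda>(l, x). metric_of (soliton p l) x)"
    unfolding soliton_simps warped_eq_diag2 diag2_def split_def
    by (rule continuous_on_vector_2 continuous_on_const m)+
  moreover have "continuous_on D (\<lambda>(l, x). curv (soliton p l) x)"
    unfolding soliton_simps area_form_def split_def
    by (rule continuous_on_vector_2 continuous_on_const F continuous_on_minus[OF F])+
  moreover have "continuous_on D (\<lambda>(l, x). pot (soliton p l) x)"
    using f unfolding soliton_simps split_def .
  ultimately show ?thesis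
    unfolding continuous_family_def Let_def soliton_simps(1) D_def by blast
qed

text \<open>For \<open>l \<le> 0\<close> the charts at the base point are all of \<open>\<real>\<^sup>2\<close>, and the lifted metrics are given
  by one formula which is smooth in \<open>z\<close> and continuous in \<open>l\<close>. So a fixed linear embedding works, and
  the members of the family converge to its member at \<open>l0\<close>.\<close>

lemma cheeger_gromov_soliton:
  assumes p: "p > 0" and \<sigma>: "0 < \<sigma>" and L: "compact L" "L \<subseteq> {..0}" "l0 \<in> L"
    and F: "filterlim (\<lambda>l. l) (at l0 within L) F"
    and g': "\<And>x. pullback (near_chart p) g' x = diag2 (\<sigma>\<^sup>2) ((tip_warp (1 / p) l0 (\<sigma> * x $ 1))\<^sup>2)"
  shows "cheeger_gromov_conv p (soliton p) \<infinity> g' F"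
  unfolding cheeger_gromov_conv_def
proof (intro conjI exI)
  have "\<forall>\<^sub>F l in at l0 within L. l \<in> L" by (simp add: eventually_at_filter)
  then have "\<forall>\<^sub>F l in F. l \<in> L" using F unfolding filterlim_iff by blast
  then have neg: "\<forall>\<^sub>F l in F. l \<le> 0" by (rule eventually_mono) (use L in auto)
  then show "\<forall>\<^sub>F l in F. \<forall>B. radius (soliton p l) = ereal B \<and> warp (soliton p l) B = 0
      \<longrightarrow> (\<exists>q. orbifold_tip_far (soliton p l) q)"
    by (rule eventually_mono) (simp add: soliton_radius_def)
  have disc: "disc \<infinity> = UNIV" by (simp add: disc_def)
  show "metric_lift \<infinity> (near_chart p) g' (chart_metric \<sigma> (1 / p) l0)"
    using \<sigma> L g' by (intro metric_lift_chart_metric tip_domain_nonpos) auto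
  have emb: "orbifold_embedding p UNIV UNIV (\<lambda>z. \<sigma> *\<^sub>R z)"
  proof -
    have "smooth_fun (UNIV :: (real ^ 2) set) (\<lambda>z. \<sigma> * z $ i)" for i
      by (intro smooth_fun_single smooth_intros continuous_intros open_UNIV)
    moreover have "det (jacobian (\<lambda>z :: real ^ 2. \<sigma> *\<^sub>R z) (at z)) \<noteq> 0" for z
      using \<sigma> by (simp add: jacobian_scaling det_2)
    moreover have "\<exists>k::int. \<forall>z. \<sigma> *\<^sub>R (rot (2 * pi / real p) *v z) = rot (2 * pi * of_int k / real p) *v (\<sigma> *\<^sub>R z)"
      by (intro exI[of _ 1]) (simp add: matrix_vector_mult_scaleR)
    ultimately show ?thesis
      using \<sigma> by (simp add: orbifold_embedding_def smooth_vec_def inj_on_def)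
  qed
  show "\<forall>\<^sub>F l in F. metric_lift (radius (soliton p l)) (near_chart p) (metric_of (soliton p l)) (chart_metric 1 (1 / p) l) \<and>
      UNIV \<subseteq> disc \<infinity> \<and> orbifold_embedding p UNIV (disc (radius (soliton p l))) (\<lambda>z. \<sigma> *\<^sub>R z)"
    using neg
  proof (rule eventually_mono)
    fix l :: real assume "l \<le> 0"
    then have "radius (soliton p l) = \<infinity>" by (simp add: soliton_radius_def)
    then show "metric_lift (radius (soliton p l)) (near_chart p) (metric_of (soliton p l)) (chart_metric 1 (1 / p) l) \<and>
      UNIV \<subseteq> disc \<infinity> \<and> orbifold_embedding p UNIV (disc (radius (soliton p l))) (\<lambda>z. \<sigma> *\<^sub>R z)"
      using metric_lift_near[OF p, of l] emb disc by simp
  qed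
  have nsq: "nsq (\<sigma> *\<^sub>R z) = \<sigma>\<^sup>2 * nsq z" for z
    by (simp add: nsq_def power_mult_distrib distrib_left)
  have pb: "pullback (\<lambda>z. \<sigma> *\<^sub>R z) (chart_metric 1 (1 / p) l) = chart_metric \<sigma> (1 / p) l" for l
    unfolding chart_metric_def fun_eq_iff
    by (simp add: pullback_scaling_rotinv_metric nsq)
  have sm: "smooth_family L UNIV (\<lambda>l z. chart_metric \<sigma> (1 / p) l z $ i $ j)" for i j
    by (intro smooth_family_chart_metric den_pos) (auto simp: nsq_eq_norm)
  show "\<forall>K. compact K \<and> K \<subseteq> disc \<infinity> \<longrightarrow>
      (\<forall>\<^sub>F l in F. K \<subseteq> UNIV) \<and>
      (\<forall>is i j. uniform_limit K (\<lambda>l. pdvs is (\<lambda>z. pullback (\<lambda>z. \<sigma> *\<^sub>R z) (chart_metric 1 (1 / p) l) z $ i $ j))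
         (pdvs is (\<lambda>z. chart_metric \<sigma> (1 / p) l0 z $ i $ j)) F)"
    unfolding pb using smooth_family_uniform_limit[OF sm L(1) _ _ L(3) F] by simp
qed

text \<open>At \<open>l = - 2 / p\<close> and \<open>r = \<surd>(2p) s\<close> the function \<open>1 + vers l r / p\<close> is \<open>cosh\<^sup>2 s\<close>, by the formulas
  for the double argument; its logarithmic derivative is a multiple of \<open>tanh s\<close>.\<close>

lemma cheeger_gromov_cigar:
  assumes "p > 1"
  shows "cheeger_gromov_conv p (soliton p) \<infinity> (\<lambda>x. (2 * real p) *\<^sub>R cigar_quotient p x) (at_right (- 2 / real p))"
proof (rule cheeger_gromov_soliton[where L = "{- 2 / real p..0}" and \<sigma> = "sqrt (2 * p)" and ?l0.0 = "- 2 / real p"])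
  show "filterlim (\<lambda>l. l) (at (- 2 / real p) within {- 2 / real p..0}) (at_right (- 2 / real p))"
  proof -
    have "- 2 / real p < 0" using assms by simp
    then have "at (- 2 / real p) within {- 2 / real p..0} = at_right (- 2 / real p)"
      by (rule at_within_Icc_at_right)
    then show ?thesis by (simp add: filterlim_ident)
  qed
  fix x :: "real ^ 2"
  define s where "s = x $ 1"
  have tw: "tip_warp (1 / p) (- 2 / real p) (sqrt (2 * p) * s) = sqrt (2 * p) * tanh s"
  proof -
    let ?l = "- 2 / real p"
    have t: "?l * (sqrt (2 * p) * s)\<^sup>2 = - (2 * s)\<^sup>2"
      using assms by (simp add: power_mult_distrib)
    have "2 * s * stumpff 1 (- (2 * s)\<^sup>2) = 2 * sinh s * cosh s"
      using stumpff_sinh[of "2 * s"] sinh_double[of s] by simp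
    then have c: "csin ?l (sqrt (2 * p) * s) = sqrt (2 * p) * (sinh s * cosh s)"
      unfolding csin_def t by simp
    have "1 - - (2 * s)\<^sup>2 * stumpff 2 (- (2 * s)\<^sup>2) = 1 + 2 * (sinh s)\<^sup>2"
    proof -
      have "cosh (2 * s) = 1 - - (2 * s)\<^sup>2 * stumpff 2 (- (2 * s)\<^sup>2)"
        using stumpff_cosh[of "2 * s"] stumpff_rec[of 0 "- (2 * s)\<^sup>2"] by (simp add: numeral_2_eq_2)
      then show ?thesis using cosh_double_cosh[of s] cosh_square_eq[of s] by simp
    qed
    then have "2 * s\<^sup>2 * stumpff 2 (- (2 * s)\<^sup>2) = (sinh s)\<^sup>2"
      by (simp add: power_mult_distrib)
    then have "1 + 1 / p * vers ?l (sqrt (2 * p) * s) = 1 + (sinh s)\<^sup>2"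
      unfolding vers_def t using assms by (simp add: power_mult_distrib)
    then have v: "1 + 1 / p * vers ?l (sqrt (2 * p) * s) = (cosh s)\<^sup>2"
      by (simp add: cosh_square_eq)
    show ?thesis
      unfolding tip_warp_def c v by (simp add: tanh_def power2_eq_square)
  qed
  have "pullback (near_chart p) (\<lambda>x. (2 * real p) *\<^sub>R cigar_quotient p x) x =
      diag2 (2 * p) ((real p)\<^sup>2 * (2 * p * (tanh s / p)\<^sup>2))"
    by (rule pullback_near_chart_diag2)
      (simp add: vec_eq_2 cigar_quotient_def warped_eq_diag2 near_chart_def s_def)
  then show "pullback (near_chart p) (\<lambda>x. (2 * real p) *\<^sub>R cigar_quotient p x) x =
      diag2 ((sqrt (2 * p))\<^sup>2) ((tip_warp (1 / p) (- 2 / real p) (sqrt (2 * p) * x $ 1))\<^sup>2)"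
    unfolding s_def[symmetric] tw using assms by (simp add: power_mult_distrib power_divide)
qed (use assms in auto)

lemma tip_warp_cusp: "p > 0 \<Longrightarrow> tip_warp (1 / real p) 0 r / p = r / (real p + r\<^sup>2 / 2)"
proof -
  assume "p > 0"
  then have "(1 + 1 / real p * (r\<^sup>2 / 2)) * p = real p + r\<^sup>2 / 2" by (simp add: field_simps)
  then show ?thesis by (simp add: tip_warp_def csin_def vers_def mult.commute)
qed

lemma cusp_metric_eq: "p > 0 \<Longrightarrow> cusp_metric p = warped (\<lambda>r. tip_warp (1 / real p) 0 r / p)"
  by (simp add: cusp_metric_def tip_warp_cusp)

lemma cheeger_gromov_cusp:
  assumes "p > 0"
  shows "cheeger_gromov_conv p (soliton p) \<infinity> (cusp_metric p) (at_left 0)"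
proof (rule cheeger_gromov_soliton[where L = "{- 1..0}" and \<sigma> = 1 and ?l0.0 = 0])
  show "filterlim (\<lambda>l. l) (at 0 within {- 1..0::real}) (at_left 0)"
    using at_within_Icc_at_left[of "- 1" "0::real"] by (simp add: filterlim_ident)
qed (use assms in \<open>auto simp: cusp_metric_eq pullback_near_chart_soliton\<close>)

section \<open>Rotationally symmetric surfaces as metric spaces\<close>

definition admissible :: "ereal \<Rightarrow> (real ^ 2 \<Rightarrow> real ^ 2 ^ 2) \<Rightarrow> (real \<Rightarrow> real ^ 2) \<Rightarrow> bool" where
  "admissible b g \<gamma> \<longleftrightarrow> \<gamma> piecewise_C1_differentiable_on {0..1} \<and> \<gamma> ` {0..1} \<subseteq> strip b g \<and>
     speed g \<gamma> integrable_on {0..1}"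

definition curve_length :: "(real ^ 2 \<Rightarrow> real ^ 2 ^ 2) \<Rightarrow> (real \<Rightarrow> real ^ 2) \<Rightarrow> real" where
  "curve_length g \<gamma> = integral {0..1} (speed g \<gamma>)"

definition point_of :: "ereal \<Rightarrow> (real ^ 2 \<Rightarrow> real ^ 2 ^ 2) \<Rightarrow> real ^ 2 \<Rightarrow> (real ^ 2) set" where
  "point_of b g x = same_point b g `` {x}"

lemma curve_between_iff:
  "curve_between b g P Q \<gamma> \<longleftrightarrow> admissible b g \<gamma> \<and> \<gamma> 0 \<in> P \<and> \<gamma> 1 \<in> Q"
  by (auto simp: curve_between_def admissible_def)

definition affine_chart :: "real \<Rightarrow> real \<Rightarrow> real ^ 2 \<Rightarrow> real ^ 2" where
  "affine_chart s c x = vector [s * x $ 1, x $ 2 + c]"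

lemma affine_chart_nth [simp]: "affine_chart s c x $ 1 = s * x $ 1" "affine_chart s c x $ 2 = x $ 2 + c"
  by (simp_all add: affine_chart_def)

text \<open>The metric is \<open>a\<^sup>2 dr\<^sup>2 + \<phi>\<^sup>2 d\<theta>\<^sup>2\<close>; the constant \<open>a\<close> accommodates a rescaling of the tensor in fixed
  coordinates.\<close>

locale rot_surface =
  fixes b :: ereal and a :: real and \<phi> :: "real \<Rightarrow> real"
  assumes b_pos: "0 < b" and a_pos: "0 < a"
    and cont: "continuous_on {r. 0 \<le> r \<and> ereal r \<le> b} \<phi>"
    and \<phi>_pos: "\<And>r. 0 < r \<Longrightarrow> ereal r < b \<Longrightarrow> 0 < \<phi> r"
    and \<phi>_0: "\<phi> 0 = 0" and \<phi>_b: "\<And>r. ereal r = b \<Longrightarrow> \<phi> r = 0"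
begin

definition g :: "real ^ 2 \<Rightarrow> real ^ 2 ^ 2" where
  "g x = diag2 (a\<^sup>2) ((\<phi> (x $ 1))\<^sup>2)"

definition tangent_norm :: "real ^ 2 \<Rightarrow> real ^ 2 \<Rightarrow> real" where
  "tangent_norm x v = sqrt ((a * v $ 1)\<^sup>2 + (\<phi> (x $ 1) * v $ 2)\<^sup>2)"

abbreviation "coords \<equiv> strip b g"
abbreviation "same \<equiv> same_point b g"
abbreviation "pt \<equiv> point_of b g"
abbreviation "adm \<equiv> admissible b g"
abbreviation "len \<equiv> curve_length g"
abbreviation "X \<equiv> points b g"
abbreviation "d \<equiv> riem_dist b g"

lemma speed_eq: "speed g \<gamma> t = tangent_norm (\<gamma> t) (vector_derivative \<gamma> (at t))"
  by (simp add: speed_def tangent_norm_def g_def mat2_simps power2_eq_square algebra_simps)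

lemma tangent_norm_nonneg [simp]: "0 \<le> tangent_norm x v"
  by (simp add: tangent_norm_def)

lemma speed_nonneg: "0 \<le> speed g \<gamma> t"
  by (simp add: speed_eq)

lemma tangent_norm_scaleR: "tangent_norm x (c *\<^sub>R v) = \<bar>c\<bar> * tangent_norm x v"
proof -
  have "(a * (c *\<^sub>R v) $ 1)\<^sup>2 + (\<phi> (x $ 1) * (c *\<^sub>R v) $ 2)\<^sup>2 = c\<^sup>2 * ((a * v $ 1)\<^sup>2 + (\<phi> (x $ 1) * v $ 2)\<^sup>2)"
    by (simp add: power_mult_distrib algebra_simps)
  then show ?thesis by (simp only: tangent_norm_def real_sqrt_mult real_sqrt_abs)
qed

lemma tangent_norm_minus [simp]: "tangent_norm x (- v) = tangent_norm x v"
  by (simp add: tangent_norm_def)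

lemma tangent_norm_radial: "a * \<bar>v $ 1\<bar> \<le> tangent_norm x v"
  using real_sqrt_ge_abs1[of "a * v $ 1" "\<phi> (x $ 1) * v $ 2"] a_pos by (simp add: tangent_norm_def abs_mult)

lemma tangent_norm_angular: "\<bar>\<phi> (x $ 1)\<bar> * \<bar>v $ 2\<bar> \<le> tangent_norm x v"
  using real_sqrt_ge_abs2[of "\<phi> (x $ 1) * v $ 2" "a * v $ 1"] by (simp add: tangent_norm_def abs_mult)

lemma strip_iff: "x \<in> coords \<longleftrightarrow> 0 \<le> x $ 1 \<and> ereal (x $ 1) \<le> b"
  using b_pos \<phi>_0 \<phi>_b[of "x $ 1"]
  by (auto simp: strip_def annulus_def g_def less_le zero_ereal_def)

lemma \<phi>_nonneg: "x \<in> coords \<Longrightarrow> 0 \<le> \<phi> (x $ 1)"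
  using \<phi>_pos[of "x $ 1"] \<phi>_0 \<phi>_b[of "x $ 1"] by (force simp: strip_iff less_le)

lemma same_point_iff: "(x, y) \<in> same \<longleftrightarrow> x \<in> coords \<and> y \<in> coords \<and> x $ 1 = y $ 1 \<and>
     (\<phi> (x $ 1) = 0 \<or> (\<exists>k::int. x $ 2 - y $ 2 = 2 * pi * of_int k))"
  by (simp add: same_point_def g_def)

lemma equiv_same_point: "equiv coords same"
proof (rule equivI)
  show "same \<subseteq> coords \<times> coords" by (auto simp: same_point_iff)
  show "refl_on coords same"
    by (auto simp: refl_on_def same_point_iff intro: exI[of _ 0])
  show "sym same"
  proof (rule symI)
    fix x y assume xy: "(x, y) \<in> same"
    have "\<exists>k::int. y $ 2 - x $ 2 = 2 * pi * of_int k" if "x $ 2 - y $ 2 = 2 * pi * of_int k" for k :: int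
      using that by (intro exI[of _ "- k"]) simp
    then show "(y, x) \<in> same" using xy by (auto simp: same_point_iff)
  qed
  show "trans same"
  proof (rule transI)
    fix x y z assume xyz: "(x, y) \<in> same" "(y, z) \<in> same"
    have "\<exists>k::int. x $ 2 - z $ 2 = 2 * pi * of_int k"
      if "x $ 2 - y $ 2 = 2 * pi * of_int k" "y $ 2 - z $ 2 = 2 * pi * of_int j" for k j :: int
      using that by (intro exI[of _ "k + j"]) (simp add: algebra_simps)
    then show "(x, z) \<in> same" using xyz by (auto simp: same_point_iff)
  qed
qed

lemma mem_point_of: "y \<in> pt x \<longleftrightarrow> (x, y) \<in> same"
  by (simp add: point_of_def)

lemma point_of_self: "x \<in> coords \<Longrightarrow> x \<in> pt x"
  using equiv_same_point by (simp add: mem_point_of equiv_def refl_on_def)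

lemma point_of_eq_iff: "x \<in> coords \<Longrightarrow> y \<in> coords \<Longrightarrow> pt x = pt y \<longleftrightarrow> (x, y) \<in> same"
  unfolding point_of_def by (rule eq_equiv_class_iff[OF equiv_same_point])

lemma point_of_eq: "y \<in> pt x \<Longrightarrow> pt y = pt x"
  by (metis point_of_eq_iff mem_point_of same_point_iff)

lemma point_of_points: "x \<in> coords \<Longrightarrow> pt x \<in> X"
  by (simp add: points_def point_of_def quotientI)

lemma pointsE:
  assumes "P \<in> X"
  obtains x where "x \<in> coords" "P = pt x"
  using assms by (auto simp: points_def point_of_def elim: quotientE)

subsection \<open>Curves\<close>

lemma admissible_valid: "adm \<gamma> \<Longrightarrow> valid_path \<gamma>"
  by (simp add: admissible_def valid_path_def)

lemma admissible_strip: "adm \<gamma> \<Longrightarrow> t \<in> {0..1} \<Longrightarrow> \<gamma> t \<in> coords"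
  by (auto simp: admissible_def)

lemma curve_length_nonneg: "0 \<le> len \<gamma>"
  unfolding curve_length_def
  by (cases "speed g \<gamma> integrable_on {0..1}")
    (simp_all add: integral_nonneg speed_nonneg not_integrable_integral)

text \<open>The increment of a coordinate is the integral of its derivative, by the fundamental theorem of
  calculus with finitely many exceptional points.\<close>

lemma component_bound:
  assumes \<gamma>: "adm \<gamma>" and uv: "0 \<le> u" "u \<le> v" "v \<le> 1" and m: "0 \<le> m"
    and le: "\<And>t w. t \<in> {u..v} \<Longrightarrow> m * \<bar>w $ i\<bar> \<le> tangent_norm (\<gamma> t) w"
  shows "m * \<bar>\<gamma> v $ i - \<gamma> u $ i\<bar> \<le> integral {u..v} (speed g \<gamma>)"
proof -
  obtain S where S: "finite S" "continuous_on {0..1} \<gamma>" "\<gamma> C1_differentiable_on {0..1} - S"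
    using \<gamma> by (auto simp: admissible_def piecewise_C1_differentiable_on_def)
  let ?D = "\<lambda>t. vector_derivative \<gamma> (at t)"
  have D: "(\<gamma> has_vector_derivative ?D t) (at t)" if "t \<in> {u<..<v} - S" for t
    using S(3) that uv by (auto simp: C1_differentiable_on_eq vector_derivative_works[symmetric])
  have int: "((\<lambda>t. ?D t $ i) has_integral (\<gamma> v $ i - \<gamma> u $ i)) {u..v}"
  proof (rule fundamental_theorem_of_calculus_interior_strong[OF S(1) uv(2)])
    fix t assume "t \<in> {u<..<v} - S"
    from bounded_linear.has_vector_derivative[OF bounded_linear_vec_nth D[OF this]]
    show "((\<lambda>t. \<gamma> t $ i) has_vector_derivative ?D t $ i) (at t)" .
  next
    show "continuous_on {u..v} (\<lambda>t. \<gamma> t $ i)"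
      using S(2) uv by (intro continuous_on_component) (auto intro: continuous_on_subset)
  qed
  have sp: "speed g \<gamma> integrable_on {u..v}"
    using \<gamma> uv by (auto simp: admissible_def intro: integrable_on_subinterval)
  have "norm (integral {u..v} (\<lambda>t. m * ?D t $ i)) \<le> integral {u..v} (speed g \<gamma>)"
  proof (rule integral_norm_bound_integral[OF _ sp])
    show "(\<lambda>t. m * ?D t $ i) integrable_on {u..v}"
      using has_integral_mult_right[OF int] by (rule has_integral_integrable)
    fix t assume "t \<in> {u..v}"
    then show "norm (m * ?D t $ i) \<le> speed g \<gamma> t"
      using le[of t "?D t"] m by (simp add: speed_eq abs_mult)
  qed
  then have "\<bar>m * (\<gamma> v $ i - \<gamma> u $ i)\<bar> \<le> integral {u..v} (speed g \<gamma>)"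
    unfolding integral_unique[OF has_integral_mult_right[OF int]] by simp
  then show ?thesis using m by (simp add: abs_mult)
qed

lemma radial_bound:
  assumes \<gamma>: "adm \<gamma>" and t: "t \<in> {0..1}"
  shows "a * \<bar>\<gamma> t $ 1 - \<gamma> 0 $ 1\<bar> + a * \<bar>\<gamma> 1 $ 1 - \<gamma> t $ 1\<bar> \<le> len \<gamma>"
proof -
  have "a * \<bar>\<gamma> t $ 1 - \<gamma> 0 $ 1\<bar> \<le> integral {0..t} (speed g \<gamma>)"
    using a_pos t by (intro component_bound[OF \<gamma>] tangent_norm_radial) auto
  moreover have "a * \<bar>\<gamma> 1 $ 1 - \<gamma> t $ 1\<bar> \<le> integral {t..1} (speed g \<gamma>)"
    using a_pos t by (intro component_bound[OF \<gamma>] tangent_norm_radial) auto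
  moreover have "integral {0..t} (speed g \<gamma>) + integral {t..1} (speed g \<gamma>) = len \<gamma>"
    unfolding curve_length_def using \<gamma> t by (intro Henstock_Kurzweil_Integration.integral_combine) (auto simp: admissible_def)
  ultimately show ?thesis by linarith
qed

lemma admissible_reverse:
  assumes \<gamma>: "adm \<gamma>"
  shows "adm (reversepath \<gamma>)" "len (reversepath \<gamma>) = len \<gamma>"
proof -
  obtain S where S: "finite S" "\<gamma> C1_differentiable_on {0..1} - S"
    using \<gamma> by (auto simp: admissible_def piecewise_C1_differentiable_on_def)
  have i: "(speed g \<gamma> has_integral len \<gamma>) {0..1}"
    using \<gamma> unfolding curve_length_def admissible_def by (auto intro: integrable_integral)
  have i': "((\<lambda>t. speed g \<gamma> (1 - t)) has_integral len \<gamma>) {0..1}"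
    using has_integral_affinity01[where m = "-1" and c = 1, OF i] by simp
  have "(speed g (reversepath \<gamma>) has_integral len \<gamma>) {0..1}"
  proof (rule has_integral_spike_finite[OF _ _ i'])
    show "finite ((\<lambda>x. 1 - x) ` S)" using S(1) by simp
    fix t assume t: "t \<in> {0..1} - (\<lambda>x. 1 - x) ` S"
    have "1 - t \<notin> S" using t by (metis DiffD2 diff_diff_eq2 add_diff_cancel_left' image_eqI)
    then have "(\<gamma> has_vector_derivative vector_derivative \<gamma> (at (1 - t))) (at (1 - t))"
      using S(2) t by (auto simp: C1_differentiable_on_eq vector_derivative_works[symmetric])
    then have "(\<gamma> \<circ> (\<lambda>x. 1 - x) has_vector_derivative (-1) *\<^sub>R vector_derivative \<gamma> (at (1 - t))) (at t)"
      by (intro vector_diff_chain_at) (auto intro!: derivative_eq_intros)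
    then have "vector_derivative (reversepath \<gamma>) (at t) = (-1) *\<^sub>R vector_derivative \<gamma> (at (1 - t))"
      unfolding reversepath_def o_def by (rule vector_derivative_at)
    then show "speed g (reversepath \<gamma>) t = speed g \<gamma> (1 - t)"
      unfolding speed_eq by (simp add: reversepath_def tangent_norm_scaleR del: scaleR_minus_left)
  qed
  moreover have "valid_path (reversepath \<gamma>)" using admissible_valid[OF \<gamma>] by simp
  moreover have "reversepath \<gamma> ` {0..1} \<subseteq> coords"
    using admissible_strip[OF \<gamma>] by (auto simp: reversepath_def)
  ultimately show "adm (reversepath \<gamma>)" "len (reversepath \<gamma>) = len \<gamma>"
    by (auto simp: admissible_def valid_path_def curve_length_def intro: integral_unique)
qed

lemma admissible_join:
  assumes \<gamma>: "adm \<gamma>1" "adm \<gamma>2" and j: "\<gamma>1 1 = \<gamma>2 0"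
  shows "adm (\<gamma>1 +++ \<gamma>2)" "len (\<gamma>1 +++ \<gamma>2) = len \<gamma>1 + len \<gamma>2"
proof -
  obtain s1 s2
    where s1: "finite s1" "\<forall>x\<in>{0..1} - s1. \<gamma>1 differentiable at x"
      and s2: "finite s2" "\<forall>x\<in>{0..1} - s2. \<gamma>2 differentiable at x"
    using \<gamma> by (auto simp: admissible_def piecewise_C1_differentiable_on_def C1_differentiable_on_eq)
  have i: "(speed g \<gamma>1 has_integral len \<gamma>1) {0..1}" "(speed g \<gamma>2 has_integral len \<gamma>2) {0..1}"
    using \<gamma> unfolding curve_length_def admissible_def by (auto intro: integrable_integral)
  have i1: "((\<lambda>x. 2 * speed g \<gamma>1 (2 * x)) has_integral len \<gamma>1) {0..1/2}"
   and i2: "((\<lambda>x. 2 * speed g \<gamma>2 (2 * x - 1)) has_integral len \<gamma>2) {1/2..1}"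
    using has_integral_affinity01 [OF i(1), where m= 2 and c=0, THEN has_integral_cmul [where c=2]]
          has_integral_affinity01 [OF i(2), where m= 2 and c="-1", THEN has_integral_cmul [where c=2]]
    by (simp_all only: image_affinity_atLeastAtMost_div_diff, simp_all add: mult_ac)
  have g1: "vector_derivative (\<gamma>1 +++ \<gamma>2) (at z) = 2 *\<^sub>R vector_derivative \<gamma>1 (at (2 * z))"
    if "0 \<le> z" "2 * z < 1" "2 * z \<notin> s1" for z
    unfolding joinpaths_def
  proof (rule vector_derivative_at [OF has_vector_derivative_transform_within])
    show "0 < \<bar>z - 1/2\<bar>" using that by auto
    have "(\<gamma>1 has_vector_derivative vector_derivative \<gamma>1 (at (2 * z))) (at (2 * z))"
      using s1 that by (auto simp: vector_derivative_works[symmetric])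
    then have "(\<gamma>1 \<circ> (\<lambda>x. 2 * x) has_vector_derivative 2 *\<^sub>R vector_derivative \<gamma>1 (at (2 * z))) (at z)"
      by (intro vector_diff_chain_at) (auto intro!: derivative_eq_intros)
    then show "((\<lambda>x. \<gamma>1 (2 * x)) has_vector_derivative 2 *\<^sub>R vector_derivative \<gamma>1 (at (2 * z))) (at z)"
      by (simp add: o_def)
  qed (use that in \<open>simp_all add: dist_real_def abs_if split: if_split_asm\<close>)
  have g2: "vector_derivative (\<gamma>1 +++ \<gamma>2) (at z) = 2 *\<^sub>R vector_derivative \<gamma>2 (at (2 * z - 1))"
    if "1 < 2 * z" "z \<le> 1" "2 * z - 1 \<notin> s2" for z
    unfolding joinpaths_def
  proof (rule vector_derivative_at [OF has_vector_derivative_transform_within])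
    show "0 < \<bar>z - 1/2\<bar>" using that by auto
    have "(\<gamma>2 has_vector_derivative vector_derivative \<gamma>2 (at (2 * z - 1))) (at (2 * z - 1))"
      using s2 that by (auto simp: vector_derivative_works[symmetric])
    then have "(\<gamma>2 \<circ> (\<lambda>x. 2 * x - 1) has_vector_derivative 2 *\<^sub>R vector_derivative \<gamma>2 (at (2 * z - 1))) (at z)"
      by (intro vector_diff_chain_at) (auto intro!: derivative_eq_intros)
    then show "((\<lambda>x. \<gamma>2 (2 * x - 1)) has_vector_derivative 2 *\<^sub>R vector_derivative \<gamma>2 (at (2 * z - 1))) (at z)"
      by (simp add: o_def)
  qed (use that in \<open>simp_all add: dist_real_def abs_if split: if_split_asm\<close>)
  have jp1: "(\<gamma>1 +++ \<gamma>2) z = \<gamma>1 (2 * z)" if "2 * z < 1" for z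
    using that by (simp add: joinpaths_def)
  have jp2: "(\<gamma>1 +++ \<gamma>2) z = \<gamma>2 (2 * z - 1)" if "1 < 2 * z" for z
    using that by (simp add: joinpaths_def)
  have "(speed g (\<gamma>1 +++ \<gamma>2) has_integral len \<gamma>1) {0..1/2}"
  proof (rule has_integral_spike_finite [OF _ _ i1])
    show "finite (insert (1/2) ((*) 2 -` s1))"
      using s1 by (force intro: finite_vimageI [where h = "(*)2"] inj_onI)
  qed (auto simp: speed_eq g1 tangent_norm_scaleR jp1)
  moreover have "(speed g (\<gamma>1 +++ \<gamma>2) has_integral len \<gamma>2) {1/2..1}"
  proof (rule has_integral_spike_finite [OF _ _ i2])
    show "finite (insert (1/2) ((\<lambda>x. 2 * x - 1) -` s2))"
      using s2 by (force intro: finite_vimageI [where h = "\<lambda>x. 2 * x - 1"] inj_onI)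
  qed (auto simp: speed_eq g2 tangent_norm_scaleR jp2)
  ultimately have "(speed g (\<gamma>1 +++ \<gamma>2) has_integral len \<gamma>1 + len \<gamma>2) {0..1}"
    by (rule has_integral_combine[rotated 2]) auto
  moreover have "valid_path (\<gamma>1 +++ \<gamma>2)"
    using \<gamma>[THEN admissible_valid] j by (intro valid_path_join) (auto simp: pathfinish_def pathstart_def)
  moreover have "(\<gamma>1 +++ \<gamma>2) ` {0..1} \<subseteq> coords"
    using \<gamma>[THEN admissible_strip] by (auto simp: joinpaths_def)
  ultimately show "adm (\<gamma>1 +++ \<gamma>2)" "len (\<gamma>1 +++ \<gamma>2) = len \<gamma>1 + len \<gamma>2"
    by (auto simp: admissible_def valid_path_def curve_length_def intro: integral_unique)
qed

lemma strip_segment: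
  assumes "x \<in> coords" "y \<in> coords" "t \<in> {0..1}"
  shows "linepath x y t \<in> coords"
proof -
  have e: "linepath x y t $ 1 = (1 - t) * x $ 1 + t * y $ 1" by (simp add: linepath_def)
  have "(1 - t) * x $ 1 + t * y $ 1 \<le> max (x $ 1) (y $ 1)"
    using assms(3) by (intro convex_bound_le) auto
  moreover have "ereal (max (x $ 1) (y $ 1)) \<le> b" using assms by (simp add: strip_iff max_def)
  ultimately have "ereal (linepath x y t $ 1) \<le> b" unfolding e by (metis ereal_less_eq(3) order_trans)
  moreover have "0 \<le> linepath x y t $ 1" unfolding e using assms by (auto simp: strip_iff)
  ultimately show ?thesis by (simp add: strip_iff)
qed

lemma admissible_linepath:
  assumes xy: "x \<in> coords" "y \<in> coords" and c: "\<And>t. t \<in> {0..1} \<Longrightarrow> tangent_norm (linepath x y t) (y - x) = c"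
  shows "adm (linepath x y)" "len (linepath x y) = c"
proof -
  have "((\<lambda>_. c) has_integral c) {0..1::real}"
    using has_integral_const_real[of c 0 1] by simp
  then have "(speed g (linepath x y) has_integral c) {0..1}"
    by (rule has_integral_eq[rotated]) (simp add: speed_eq c)
  moreover have "valid_path (linepath x y)" by simp
  moreover have "linepath x y ` {0..1} \<subseteq> coords" using strip_segment[OF xy] by blast
  ultimately show "adm (linepath x y)" "len (linepath x y) = c"
    by (auto simp: admissible_def valid_path_def curve_length_def intro: integral_unique)
qed

lemma admissible_radial:
  assumes xy: "x \<in> coords" "y \<in> coords" and e: "x $ 2 = y $ 2"
  shows "adm (linepath x y)" "len (linepath x y) = a * \<bar>x $ 1 - y $ 1\<bar>"
proof -
  have "tangent_norm (linepath x y t) (y - x) = a * \<bar>x $ 1 - y $ 1\<bar>" for t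
    using e a_pos by (simp add: tangent_norm_def abs_mult abs_minus_commute)
  from admissible_linepath[OF xy this]
  show "adm (linepath x y)" "len (linepath x y) = a * \<bar>x $ 1 - y $ 1\<bar>" by simp_all
qed

lemma admissible_angular:
  assumes xy: "x \<in> coords" "y \<in> coords" and e: "x $ 1 = y $ 1"
  shows "adm (linepath x y)" "len (linepath x y) = \<phi> (y $ 1) * \<bar>x $ 2 - y $ 2\<bar>"
proof -
  have l: "linepath x y t $ 1 = y $ 1" for t using e by (simp add: linepath_def algebra_simps)
  have "tangent_norm (linepath x y t) (y - x) = \<phi> (y $ 1) * \<bar>x $ 2 - y $ 2\<bar>" for t
    using e \<phi>_nonneg[OF xy(2)] by (simp add: tangent_norm_def l abs_mult abs_minus_commute)
  from admissible_linepath[OF xy this]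
  show "adm (linepath x y)" "len (linepath x y) = \<phi> (y $ 1) * \<bar>x $ 2 - y $ 2\<bar>" by simp_all
qed

end

subsection \<open>Comparison of lengths\<close>

lemma valid_path_affine_chart:
  assumes "valid_path \<gamma>"
  shows "valid_path (\<lambda>t. affine_chart s c (\<gamma> t))"
proof -
  have "valid_path ((\<lambda>x. diag2 s 1 *v x) \<circ> \<gamma>)"
    by (intro linear_image_valid_path assms matrix_vector_mul_linear)
  then have "valid_path ((+) (vector [0, c]) \<circ> ((\<lambda>x. diag2 s 1 *v x) \<circ> \<gamma>))"
    by (simp add: valid_path_translation_eq)
  moreover have "(+) (vector [0, c]) \<circ> ((\<lambda>x. diag2 s 1 *v x) \<circ> \<gamma>) = (\<lambda>t. affine_chart s c (\<gamma> t))"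
    by (auto simp: fun_eq_iff mat2_simps)
  ultimately show ?thesis by simp
qed

lemma integral_diff_finite:
  fixes f :: "real \<Rightarrow> real"
  assumes "finite S"
  shows "f integrable_on (T - S) \<longleftrightarrow> f integrable_on T" "integral (T - S) f = integral T f"
proof -
  have n: "negligible {x \<in> (T - S) - T. f x \<noteq> 0}" "negligible {x \<in> T - (T - S). f x \<noteq> 0}"
    by (auto intro!: negligible_finite finite_subset[OF _ assms])
  show "f integrable_on (T - S) \<longleftrightarrow> f integrable_on T" using integrable_spike_set n by blast
  show "integral (T - S) f = integral T f" by (rule integral_spike_set[OF n])
qed

text \<open>A pointwise bound for the image speed, off the finitely many break points, bounds the image
  length. The image speed is integrable since it is measurable, being continuous off the break
  points, and dominated. The case of a single surface and \<open>s = 1\<close> covers rotations.\<close>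

lemma admissible_affine_chart:
  assumes 1: "rot_surface b1 a1 \<phi>1" and 2: "rot_surface b2 a2 \<phi>2"
    and \<gamma>: "rot_surface.adm b1 a1 \<phi>1 \<gamma>" and s: "0 < s" and K: "0 \<le> K" "a2 * s \<le> K * a1"
    and b2: "\<And>t. t \<in> {0..1} \<Longrightarrow> ereal (s * \<gamma> t $ 1) \<le> b2"
    and le: "\<And>t. t \<in> {0..1} \<Longrightarrow> \<phi>2 (s * \<gamma> t $ 1) \<le> K * \<phi>1 (\<gamma> t $ 1)"
  shows "rot_surface.adm b2 a2 \<phi>2 (\<lambda>t. affine_chart s c (\<gamma> t))"
    and "rot_surface.len a2 \<phi>2 (\<lambda>t. affine_chart s c (\<gamma> t)) \<le> K * rot_surface.len a1 \<phi>1 \<gamma>"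
proof -
  interpret s1: rot_surface b1 a1 \<phi>1 by (rule 1)
  interpret s2: rot_surface b2 a2 \<phi>2 by (rule 2)
  let ?\<gamma> = "\<lambda>t. affine_chart s c (\<gamma> t)"
  have st1: "\<gamma> t \<in> s1.coords" if "t \<in> {0..1}" for t
    by (rule s1.admissible_strip[OF \<gamma> that])
  have st2: "?\<gamma> t \<in> s2.coords" if "t \<in> {0..1}" for t
    using st1[OF that] b2[OF that] s by (simp add: s1.strip_iff s2.strip_iff)
  obtain S where S: "finite S" "continuous_on {0..1} \<gamma>" "\<gamma> C1_differentiable_on {0..1} - S"
    using \<gamma> by (auto simp: admissible_def piecewise_C1_differentiable_on_def)
  let ?W = "{0..1} - S" and ?D = "\<lambda>t. vector_derivative \<gamma> (at t)"
  have D: "(\<gamma> has_vector_derivative ?D t) (at t)" if "t \<in> ?W" for t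
    using S(3) that by (auto simp: C1_differentiable_on_eq vector_derivative_works[symmetric])
  have Dc: "continuous_on ?W ?D"
    using S(3) by (simp add: C1_differentiable_on_eq)
  have D': "vector_derivative ?\<gamma> (at t) = vector [s * ?D t $ 1, ?D t $ 2]" if "t \<in> ?W" for t
  proof (rule vector_derivative_at)
    have d: "((\<lambda>t. \<gamma> t $ i) has_derivative (\<lambda>h. h * ?D t $ i)) (at t)" for i
      using bounded_linear.has_vector_derivative[OF bounded_linear_vec_nth D[OF that]]
      by (simp add: has_vector_derivative_def)
    have "(?\<gamma> has_derivative (\<lambda>h. vector [s * (h * ?D t $ 1), h * ?D t $ 2])) (at t)"
      unfolding affine_chart_def
      by (intro has_derivative_vector_2) (auto intro!: derivative_eq_intros d)
    then show "(?\<gamma> has_vector_derivative vector [s * ?D t $ 1, ?D t $ 2]) (at t)"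
      unfolding has_vector_derivative_def
      by (rule back_subst[where P = "\<lambda>D. (?\<gamma> has_derivative D) (at t)"])
        (auto simp: fun_eq_iff vec_eq_2)
  qed
  have sp2: "speed s2.g ?\<gamma> t = sqrt ((a2 * (s * ?D t $ 1))\<^sup>2 + (\<phi>2 (s * \<gamma> t $ 1) * ?D t $ 2)\<^sup>2)" if "t \<in> ?W" for t
    unfolding s2.speed_eq D'[OF that] by (simp add: s2.tangent_norm_def)
  have ptw: "speed s2.g ?\<gamma> t \<le> K * speed s1.g \<gamma> t" if t: "t \<in> ?W" for t
  proof -
    have "(a2 * (s * ?D t $ 1))\<^sup>2 \<le> (K * (a1 * ?D t $ 1))\<^sup>2"
    proof (rule abs_le_square_iff[THEN iffD1])
      have "\<bar>a2 * (s * ?D t $ 1)\<bar> = a2 * s * \<bar>?D t $ 1\<bar>" using s s2.a_pos by (simp add: abs_mult)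
      also have "\<dots> \<le> K * a1 * \<bar>?D t $ 1\<bar>" using K by (intro mult_right_mono) auto
      finally show "\<bar>a2 * (s * ?D t $ 1)\<bar> \<le> \<bar>K * (a1 * ?D t $ 1)\<bar>"
        using K s1.a_pos by (simp add: abs_mult)
    qed
    moreover have "(\<phi>2 (s * \<gamma> t $ 1) * ?D t $ 2)\<^sup>2 \<le> (K * (\<phi>1 (\<gamma> t $ 1) * ?D t $ 2))\<^sup>2"
    proof (rule abs_le_square_iff[THEN iffD1])
      have p: "0 \<le> \<phi>2 (s * \<gamma> t $ 1)" "0 \<le> \<phi>1 (\<gamma> t $ 1)"
        using s2.\<phi>_nonneg[OF st2, of t] s1.\<phi>_nonneg[OF st1, of t] t by simp_all
      have "\<bar>\<phi>2 (s * \<gamma> t $ 1) * ?D t $ 2\<bar> = \<phi>2 (s * \<gamma> t $ 1) * \<bar>?D t $ 2\<bar>"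
        using p by (simp add: abs_mult)
      also have "\<dots> \<le> K * \<phi>1 (\<gamma> t $ 1) * \<bar>?D t $ 2\<bar>" using le[of t] t by (intro mult_right_mono) auto
      finally show "\<bar>\<phi>2 (s * \<gamma> t $ 1) * ?D t $ 2\<bar> \<le> \<bar>K * (\<phi>1 (\<gamma> t $ 1) * ?D t $ 2)\<bar>"
        using K p by (simp add: abs_mult)
    qed
    ultimately have "speed s2.g ?\<gamma> t \<le> sqrt ((K * (a1 * ?D t $ 1))\<^sup>2 + (K * (\<phi>1 (\<gamma> t $ 1) * ?D t $ 2))\<^sup>2)"
      unfolding sp2[OF t] by (intro real_sqrt_le_mono add_mono)
    also have "\<dots> = sqrt (K\<^sup>2 * ((a1 * ?D t $ 1)\<^sup>2 + (\<phi>1 (\<gamma> t $ 1) * ?D t $ 2)\<^sup>2))"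
      by (simp add: power_mult_distrib distrib_left)
    also have "\<dots> = K * speed s1.g \<gamma> t"
      using K by (simp add: real_sqrt_mult s1.speed_eq s1.tangent_norm_def)
    finally show ?thesis .
  qed
  have i1: "(\<lambda>t. K * speed s1.g \<gamma> t) integrable_on ?W"
  proof -
    have "speed s1.g \<gamma> integrable_on ?W"
      using \<gamma> by (simp add: admissible_def integral_diff_finite[OF S(1)])
    from has_integral_mult_right[OF integrable_integral[OF this]] show ?thesis
      by (rule has_integral_integrable)
  qed
  have cont: "continuous_on ?W (speed s2.g ?\<gamma>)"
  proof -
    have "continuous_on ?W (\<lambda>t. s * \<gamma> t $ 1)"
      using S(2) by (intro continuous_intros) (auto intro: continuous_on_subset)
    then have "continuous_on ?W (\<lambda>t. \<phi>2 (s * \<gamma> t $ 1))"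
      by (rule continuous_on_compose2[OF s2.cont]) (use st2 s2.strip_iff in force)
    then have "continuous_on ?W (\<lambda>t. sqrt ((a2 * (s * ?D t $ 1))\<^sup>2 + (\<phi>2 (s * \<gamma> t $ 1) * ?D t $ 2)\<^sup>2))"
      using Dc by (intro continuous_intros)
    then show ?thesis by (rule continuous_on_eq) (simp add: sp2)
  qed
  have W: "?W \<in> sets lebesgue" using negligible_imp_sets[OF negligible_finite[OF S(1)]] by (intro sets.Diff) auto
  have i2: "speed s2.g ?\<gamma> integrable_on ?W"
  proof (rule measurable_bounded_by_integrable_imp_integrable[OF _ i1 _ W])
    show "speed s2.g ?\<gamma> \<in> borel_measurable (lebesgue_on ?W)"
      using cont W by (rule continuous_imp_measurable_on_sets_lebesgue)
    fix t assume "t \<in> ?W"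
    then show "norm (speed s2.g ?\<gamma> t) \<le> K * speed s1.g \<gamma> t"
      using ptw s2.speed_nonneg by simp
  qed
  have "integral ?W (speed s2.g ?\<gamma>) \<le> integral ?W (\<lambda>t. K * speed s1.g \<gamma> t)"
    by (rule integral_le[OF i2 i1 ptw])
  then show "s2.len ?\<gamma> \<le> K * s1.len \<gamma>"
    by (simp add: curve_length_def integral_diff_finite[OF S(1)])
  show "s2.adm ?\<gamma>"
    using valid_path_affine_chart[OF s1.admissible_valid[OF \<gamma>]] st2 i2
    by (auto simp: admissible_def valid_path_def integral_diff_finite[OF S(1)])
qed


subsection \<open>The metric\<close>

context rot_surface
begin

lemma riem_dist_eq:
  "P \<in> X \<Longrightarrow> Q \<in> X \<Longrightarrow> d P Q = Inf {len \<gamma> | \<gamma>. adm \<gamma> \<and> \<gamma> 0 \<in> P \<and> \<gamma> 1 \<in> Q}"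
  by (simp add: riem_dist_def curve_length_def curve_between_iff)

lemma riem_dist_le:
  assumes "P \<in> X" "Q \<in> X" "adm \<gamma>" "\<gamma> 0 \<in> P" "\<gamma> 1 \<in> Q"
  shows "d P Q \<le> len \<gamma>"
  unfolding riem_dist_eq[OF assms(1,2)]
  by (rule cInf_lower) (use assms curve_length_nonneg in \<open>auto intro!: bdd_belowI[of _ 0]\<close>)

text \<open>A radial segment, followed by an arc of the circle through \<open>y\<close>.\<close>

lemma joining_curve:
  assumes x: "x \<in> coords" and y: "y \<in> coords"
  obtains \<gamma> where "adm \<gamma>" "\<gamma> 0 = x" "\<gamma> 1 = y"
    "len \<gamma> = a * \<bar>x $ 1 - y $ 1\<bar> + \<phi> (y $ 1) * \<bar>x $ 2 - y $ 2\<bar>"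
proof
  define z :: "real ^ 2" where "z = vector [y $ 1, x $ 2]"
  have z: "z \<in> coords" using y by (simp add: strip_iff z_def)
  note r = admissible_radial[OF x z] and t = admissible_angular[OF z y]
  have j: "linepath x z 1 = linepath z y 0" by (simp add: linepath_def)
  show "adm (linepath x z +++ linepath z y)"
    using r(1) t(1) j by (intro admissible_join) (simp_all add: z_def)
  show "(linepath x z +++ linepath z y) 0 = x" "(linepath x z +++ linepath z y) 1 = y"
    by (simp_all add: joinpaths_def linepath_def)
  have "len (linepath x z +++ linepath z y) = len (linepath x z) + len (linepath z y)"
    using r(1) t(1) j by (intro admissible_join) (simp_all add: z_def)
  then show "len (linepath x z +++ linepath z y) = a * \<bar>x $ 1 - y $ 1\<bar> + \<phi> (y $ 1) * \<bar>x $ 2 - y $ 2\<bar>"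
    using r(2) t(2) by (simp add: z_def)
qed

lemma riem_dist_ge:
  assumes "P \<in> X" "Q \<in> X"
    and "\<And>\<gamma>. adm \<gamma> \<Longrightarrow> \<gamma> 0 \<in> P \<Longrightarrow> \<gamma> 1 \<in> Q \<Longrightarrow> c \<le> len \<gamma>"
  shows "c \<le> d P Q"
  unfolding riem_dist_eq[OF assms(1,2)]
proof (rule cInf_greatest)
  obtain x y where x: "x \<in> coords" "P = pt x" and y: "y \<in> coords" "Q = pt y"
    using assms(1,2) by (metis pointsE)
  obtain \<gamma> where "adm \<gamma>" "\<gamma> 0 = x" "\<gamma> 1 = y"
    using joining_curve[OF x(1) y(1)] by blast
  then show "{len \<gamma> | \<gamma>. adm \<gamma> \<and> \<gamma> 0 \<in> P \<and> \<gamma> 1 \<in> Q} \<noteq> {}"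
    using x y point_of_self by auto
qed (use assms(3) in auto)

lemma riem_dist_approx:
  assumes "P \<in> X" "Q \<in> X" "0 < e"
  obtains \<gamma> where "adm \<gamma>" "\<gamma> 0 \<in> P" "\<gamma> 1 \<in> Q" "len \<gamma> < d P Q + e"
proof (rule ccontr)
  assume nt: "\<not> thesis"
  have "d P Q + e \<le> d P Q"
  proof (rule riem_dist_ge[OF assms(1,2)])
    fix \<gamma> assume "adm \<gamma>" "\<gamma> 0 \<in> P" "\<gamma> 1 \<in> Q"
    then show "d P Q + e \<le> len \<gamma>" using that[of \<gamma>] nt by (cases "len \<gamma> < d P Q + e") auto
  qed
  then show False using assms(3) by simp
qed

lemma riem_dist_nonneg: "0 \<le> d P Q"
proof (cases "P \<in> X \<and> Q \<in> X")
  case True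
  then show ?thesis by (intro riem_dist_ge curve_length_nonneg) auto
qed (auto simp: riem_dist_def)

lemma riem_dist_commute: "d P Q = d Q P"
proof -
  have "d P Q \<le> d Q P" if PQ: "P \<in> X" "Q \<in> X" for P Q
  proof (rule riem_dist_ge[OF PQ(2,1)])
    fix \<gamma> assume "adm \<gamma>" "\<gamma> 0 \<in> Q" "\<gamma> 1 \<in> P"
    then show "d P Q \<le> len \<gamma>"
      using riem_dist_le[OF PQ, of "reversepath \<gamma>"] admissible_reverse[of \<gamma>] by (simp add: reversepath_def)
  qed
  then show ?thesis
    by (cases "P \<in> X \<and> Q \<in> X") (auto simp: riem_dist_def intro: antisym)
qed

text \<open>Rotations move a curve to any other representative of its initial point, unless this
  point is a tip, where the angle can be changed at no cost.\<close>

lemma change_initial_point: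
  assumes \<gamma>: "adm \<gamma>" and x: "x \<in> pt (\<gamma> 0)"
  obtains \<gamma>' where "adm \<gamma>'" "\<gamma>' 0 = x" "\<gamma>' 1 \<in> pt (\<gamma> 1)" "len \<gamma>' \<le> len \<gamma>"
proof -
  have st: "\<gamma> 0 \<in> coords" "\<gamma> 1 \<in> coords" using admissible_strip[OF \<gamma>] by auto
  have x': "x \<in> coords" "x $ 1 = \<gamma> 0 $ 1" using x by (auto simp: mem_point_of same_point_iff)
  show ?thesis
  proof (cases "\<phi> (\<gamma> 0 $ 1) = 0")
    case True
    note l = admissible_angular[OF x'(1) st(1) x'(2)]
    have j: "linepath x (\<gamma> 0) 1 = \<gamma> 0" by (simp add: linepath_def)
    show ?thesis
    proof (rule that)
      show "adm (linepath x (\<gamma> 0) +++ \<gamma>)" by (rule admissible_join(1)[OF l(1) \<gamma> j])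
      show "(linepath x (\<gamma> 0) +++ \<gamma>) 0 = x" by (simp add: joinpaths_def linepath_def)
      show "(linepath x (\<gamma> 0) +++ \<gamma>) 1 \<in> pt (\<gamma> 1)"
        using point_of_self[OF st(2)] by (simp add: joinpaths_def)
      show "len (linepath x (\<gamma> 0) +++ \<gamma>) \<le> len \<gamma>"
        unfolding admissible_join(2)[OF l(1) \<gamma> j] l(2) using True by simp
    qed
  next
    case False
    then obtain k :: int where k: "\<gamma> 0 $ 2 - x $ 2 = 2 * pi * of_int k"
      using x by (auto simp: mem_point_of same_point_iff)
    let ?c = "x $ 2 - \<gamma> 0 $ 2"
    have sh: "adm (\<lambda>t. affine_chart 1 ?c (\<gamma> t))" "len (\<lambda>t. affine_chart 1 ?c (\<gamma> t)) \<le> 1 * len \<gamma>"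
      by (rule admissible_affine_chart[OF rot_surface_axioms rot_surface_axioms \<gamma>, where K = 1];
          use admissible_strip[OF \<gamma>] in \<open>simp add: strip_iff\<close>)+
    show ?thesis
    proof (rule that[OF sh(1)])
      show "affine_chart 1 ?c (\<gamma> 0) = x" using x'(2) by (simp add: vec_eq_2)
      have "affine_chart 1 ?c (\<gamma> 1) \<in> coords" using st(2) by (simp add: strip_iff)
      moreover have "\<gamma> 1 $ 2 - affine_chart 1 ?c (\<gamma> 1) $ 2 = 2 * pi * of_int k" using k by simp
      ultimately show "affine_chart 1 ?c (\<gamma> 1) \<in> pt (\<gamma> 1)"
        using st(2) by (auto simp: mem_point_of same_point_iff)
    qed (use sh(2) in simp)
  qed
qed

text \<open>Two almost minimal curves meet in the same point, but in general at different angles; the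
  second one is moved before they are joined.\<close>

lemma riem_dist_triangle:
  assumes P: "P \<in> X" and Q: "Q \<in> X" and R: "R \<in> X"
  shows "d P R \<le> d P Q + d Q R"
proof (rule field_le_epsilon)
  fix e :: real assume "0 < e"
  then have e: "0 < e / 2" by simp
  obtain \<gamma>1 where 1: "adm \<gamma>1" "\<gamma>1 0 \<in> P" "\<gamma>1 1 \<in> Q" "len \<gamma>1 < d P Q + e / 2"
    by (rule riem_dist_approx[OF P Q e])
  obtain \<gamma>2 where 2: "adm \<gamma>2" "\<gamma>2 0 \<in> Q" "\<gamma>2 1 \<in> R" "len \<gamma>2 < d Q R + e / 2"
    by (rule riem_dist_approx[OF Q R e])
  obtain y z where yz: "Q = pt y" "R = pt z" using Q R by (metis pointsE)
  have "\<gamma>1 1 \<in> pt (\<gamma>2 0)" using 1(3) 2(2) unfolding yz(1) by (metis point_of_eq)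
  then obtain \<gamma>3 where 3: "adm \<gamma>3" "\<gamma>3 0 = \<gamma>1 1" "\<gamma>3 1 \<in> pt (\<gamma>2 1)" "len \<gamma>3 \<le> len \<gamma>2"
    using change_initial_point[OF 2(1)] by blast
  have R3: "\<gamma>3 1 \<in> R" using 3(3) 2(3) unfolding yz(2) by (metis point_of_eq)
  note j = admissible_join[OF 1(1) 3(1) 3(2)[symmetric]]
  have "d P R \<le> len (\<gamma>1 +++ \<gamma>3)"
    using 1(2) R3 by (intro riem_dist_le P R j(1)) (simp_all add: joinpaths_def)
  then show "d P R \<le> d P Q + d Q R + e" using j(2) 1(4) 2(4) 3(4) by linarith
qed

lemma riem_dist_le_coords:
  assumes x: "x \<in> coords" and y: "y \<in> coords"
  shows "d (pt x) (pt y) \<le> a * \<bar>x $ 1 - y $ 1\<bar> + \<phi> (y $ 1) * \<bar>x $ 2 - y $ 2\<bar>"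
  using joining_curve[OF x y] riem_dist_le[OF point_of_points[OF x] point_of_points[OF y]] point_of_self[OF x] point_of_self[OF y]
  by metis

lemma riem_dist_radial:
  assumes x: "x \<in> coords" and y: "y \<in> coords"
  shows "a * \<bar>x $ 1 - y $ 1\<bar> \<le> d (pt x) (pt y)"
proof (rule riem_dist_ge[OF point_of_points[OF x] point_of_points[OF y]])
  fix \<gamma> assume \<gamma>: "adm \<gamma>" "\<gamma> 0 \<in> pt x" "\<gamma> 1 \<in> pt y"
  then have "\<gamma> 0 $ 1 = x $ 1" "\<gamma> 1 $ 1 = y $ 1" by (auto simp: mem_point_of same_point_iff)
  then show "a * \<bar>x $ 1 - y $ 1\<bar> \<le> len \<gamma>"
    using radial_bound[OF \<gamma>(1), of 1] by (simp add: abs_minus_commute)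
qed

text \<open>Different radii are separated by the radial bound. If only the angles differ, a curve either
  leaves an annulus around the common radius, which costs a radial distance, or it stays there and
  turns by an angle bounded away from zero along circles that are not short.\<close>

lemma riem_dist_pos:
  assumes x: "x \<in> coords" and y: "y \<in> coords" and ne: "(x, y) \<notin> same"
  shows "0 < d (pt x) (pt y)"
proof (cases "x $ 1 = y $ 1")
  case False
  then have "0 < a * \<bar>x $ 1 - y $ 1\<bar>" using a_pos by simp
  then show ?thesis using riem_dist_radial[OF x y] by linarith
next
  case True
  define r where "r = x $ 1"
  define w where "w = (x $ 2 - y $ 2) / (2 * pi)"
  have ph: "\<phi> r \<noteq> 0" and nk: "x $ 2 - y $ 2 \<noteq> 2 * pi * of_int k" for k :: int
    using ne x y True by (auto simp: same_point_iff r_def)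
  have r: "0 < r" "ereal r < b"
    using ph \<phi>_0 \<phi>_b[of r] x by (auto simp: strip_iff r_def less_le)
  \<comment> \<open>the angle keeps a distance \<open>\<eta>\<close> from the multiples of \<open>2\<pi>\<close>\<close>
  have wk: "w \<noteq> of_int k" for k :: int
    using nk[of k] by (auto simp: w_def field_simps)
  define \<eta> where "\<eta> = 2 * pi * min (frac w) (1 - frac w)"
  have "frac w \<noteq> 0" using wk by (auto simp: frac_eq_0_iff elim!: Ints_cases)
  then have \<eta>: "0 < \<eta>" using frac_ge_0[of w] frac_lt_1[of w] by (simp add: \<eta>_def)
  have far: "\<eta> \<le> \<bar>x $ 2 - y $ 2 - 2 * pi * of_int k\<bar>" for k :: int
  proof -
    have "min (frac w) (1 - frac w) \<le> \<bar>w - of_int k\<bar>"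
    proof (cases "k \<le> \<lfloor>w\<rfloor>")
      case True
      then have "real_of_int k \<le> of_int \<lfloor>w\<rfloor>" by simp
      then show ?thesis unfolding frac_def by linarith
    next
      case False
      then have "real_of_int \<lfloor>w\<rfloor> + 1 \<le> of_int k" by linarith
      then show ?thesis unfolding frac_def by linarith
    qed
    then have "\<eta> \<le> 2 * pi * \<bar>w - of_int k\<bar>" by (simp add: \<eta>_def)
    also have "\<dots> = \<bar>2 * pi * (w - of_int k)\<bar>" by (simp add: abs_mult)
    also have "2 * pi * (w - of_int k) = x $ 2 - y $ 2 - 2 * pi * of_int k" by (simp add: w_def field_simps)
    finally show ?thesis .
  qed
  \<comment> \<open>a compact range of radii around \<open>r\<close> on which the circles are not short\<close>
  obtain r' where r': "r < r'" "ereal r' < b" using ereal_dense2[OF r(2)] by auto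
  define \<delta> where "\<delta> = min (r / 2) (r' - r)"
  have \<delta>: "0 < \<delta>" "0 < r - \<delta>" "ereal (r + \<delta>) < b"
  proof -
    show "0 < \<delta>" "0 < r - \<delta>" using r r' by (simp_all add: \<delta>_def min_def)
    have "ereal (r + \<delta>) \<le> ereal r'" by (simp add: \<delta>_def)
    then show "ereal (r + \<delta>) < b" using r'(2) by (rule le_less_trans)
  qed
  have in_range: "0 < s \<and> ereal s < b" if "s \<in> {r - \<delta>..r + \<delta>}" for s
    using that \<delta>(2,3) by (auto intro: le_less_trans[of "ereal s" "ereal (r + \<delta>)"])
  have "\<exists>s\<in>{r - \<delta>..r + \<delta>}. \<forall>t\<in>{r - \<delta>..r + \<delta>}. \<phi> s \<le> \<phi> t"
    using \<delta> in_range by (intro continuous_attains_inf continuous_on_subset[OF cont]) (auto intro: less_imp_le)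
  then obtain s where s: "s \<in> {r - \<delta>..r + \<delta>}" "\<And>t. t \<in> {r - \<delta>..r + \<delta>} \<Longrightarrow> \<phi> s \<le> \<phi> t" by blast
  define m where "m = \<phi> s"
  have m: "0 < m" using in_range[OF s(1)] \<phi>_pos by (simp add: m_def)
  have "min (a * \<delta>) (m * \<eta>) \<le> d (pt x) (pt y)"
  proof (rule riem_dist_ge[OF point_of_points[OF x] point_of_points[OF y]])
    fix \<gamma> assume \<gamma>: "adm \<gamma>" "\<gamma> 0 \<in> pt x" "\<gamma> 1 \<in> pt y"
    have e1: "\<gamma> 0 $ 1 = r" using \<gamma>(2) by (simp add: mem_point_of same_point_iff r_def)
    show "min (a * \<delta>) (m * \<eta>) \<le> len \<gamma>"
    proof (cases "\<exists>t\<in>{0..1}. \<delta> < \<bar>\<gamma> t $ 1 - r\<bar>")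
      case True
      then obtain t where t: "t \<in> {0..1}" "\<delta> < \<bar>\<gamma> t $ 1 - r\<bar>" by blast
      have "a * \<delta> \<le> a * \<bar>\<gamma> t $ 1 - \<gamma> 0 $ 1\<bar>" using t(2) a_pos e1 by simp
      also have "\<dots> \<le> len \<gamma>" using radial_bound[OF \<gamma>(1) t(1)] a_pos by (smt (verit) mult_nonneg_nonneg abs_ge_zero)
      finally show ?thesis by simp
    next
      case False
      have "m * \<bar>\<gamma> 1 $ 2 - \<gamma> 0 $ 2\<bar> \<le> integral {0..1} (speed g \<gamma>)"
      proof (rule component_bound[OF \<gamma>(1)])
        fix t :: real and w :: "real ^ 2" assume t: "t \<in> {0..1}"
        then have "\<bar>\<gamma> t $ 1 - r\<bar> \<le> \<delta>" using False by (metis not_less)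
        then have "\<gamma> t $ 1 \<in> {r - \<delta>..r + \<delta>}" by (simp add: abs_le_iff)
        then have "m \<le> \<phi> (\<gamma> t $ 1)" unfolding m_def by (rule s(2))
        then have "m * \<bar>w $ 2\<bar> \<le> \<bar>\<phi> (\<gamma> t $ 1)\<bar> * \<bar>w $ 2\<bar>" using m by (intro mult_right_mono) auto
        then show "m * \<bar>w $ 2\<bar> \<le> tangent_norm (\<gamma> t) w" using tangent_norm_angular[of "\<gamma> t" w] by linarith
      qed (use m in auto)
      moreover have "\<eta> \<le> \<bar>\<gamma> 1 $ 2 - \<gamma> 0 $ 2\<bar>"
      proof -
        obtain k j :: int where kj: "x $ 2 - \<gamma> 0 $ 2 = 2 * pi * of_int k" "y $ 2 - \<gamma> 1 $ 2 = 2 * pi * of_int j"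
          using \<gamma>(2,3) ph True by (auto simp: mem_point_of same_point_iff r_def)
        have "2 * pi * of_int (k - j) = 2 * pi * of_int k - 2 * pi * of_int j"
          by (simp add: right_diff_distrib)
        then have "\<gamma> 0 $ 2 - \<gamma> 1 $ 2 = x $ 2 - y $ 2 - 2 * pi * of_int (k - j)"
          using kj by linarith
        then show ?thesis using far[of "k - j"] by (simp only: abs_minus_commute[of "\<gamma> 1 $ 2"])
      qed
      then have "m * \<eta> \<le> m * \<bar>\<gamma> 1 $ 2 - \<gamma> 0 $ 2\<bar>" using m by simp
      ultimately show ?thesis by (simp add: curve_length_def)
    qed
  qed
  moreover have "0 < min (a * \<delta>) (m * \<eta>)" using a_pos \<delta>(1) m \<eta> by simp
  ultimately show ?thesis by linarith
qed

lemma Metric_space_riem_dist: "Metric_space X d"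
proof
  fix P Q assume PQ: "P \<in> X" "Q \<in> X"
  obtain x y where xy: "x \<in> coords" "P = pt x" "y \<in> coords" "Q = pt y"
    using PQ by (metis pointsE)
  show "d P Q = 0 \<longleftrightarrow> P = Q"
  proof
    assume "d P Q = 0"
    then have "(x, y) \<in> same" using riem_dist_pos[OF xy(1,3)] xy(2,4) by fastforce
    then show "P = Q" using xy point_of_eq_iff by simp
  next
    assume "P = Q"
    then have "d P Q \<le> 0" using riem_dist_le_coords[OF xy(1) xy(1)] xy(2) by simp
    then show "d P Q = 0" using riem_dist_nonneg[of P Q] by simp
  qed
qed (use riem_dist_nonneg riem_dist_commute riem_dist_triangle in auto)

sublocale M: Metric_space X d
  by (rule Metric_space_riem_dist)

subsection \<open>Completeness\<close>

lemma bounded_angle: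
  assumes x: "x \<in> coords"
  obtains y where "y \<in> coords" "pt y = pt x" "y $ 1 = x $ 1" "0 \<le> y $ 2" "y $ 2 \<le> 2 * pi"
proof -
  define w where "w = x $ 2 / (2 * pi)"
  define y :: "real ^ 2" where "y = vector [x $ 1, 2 * pi * frac w]"
  have y: "y \<in> coords" "y $ 1 = x $ 1" using x by (simp_all add: strip_iff y_def)
  have "x $ 2 - y $ 2 = 2 * pi * of_int \<lfloor>w\<rfloor>"
    by (simp add: y_def frac_def w_def right_diff_distrib)
  then have "(x, y) \<in> same" using x y by (auto simp: same_point_iff)
  then have "pt y = pt x" using x y point_of_eq_iff by metis
  moreover have "0 \<le> y $ 2" "y $ 2 \<le> 2 * pi"
    using frac_ge_0[of w] frac_lt_1[of w] by (simp_all add: y_def)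
  ultimately show ?thesis using that y by blast
qed

lemma closed_strip: "closed coords"
proof -
  have "coords = {x. 0 \<le> x $ 1} \<inter> {x. ereal (x $ 1) \<le> b}" by (auto simp: strip_iff)
  moreover have "closed {x :: real ^ 2. 0 \<le> x $ 1}" by (intro closed_Collect_le continuous_intros)
  moreover have "closed {x :: real ^ 2. ereal (x $ 1) \<le> b}" by (intro closed_Collect_le continuous_intros)
  ultimately show ?thesis by auto
qed

text \<open>Radii of a Cauchy sequence stay bounded and angles can be taken in \<open>[0, 2\<pi>]\<close>, so the
  coordinates converge along a subsequence, within the closed strip. The upper bound for the
  distance in terms of coordinates turns this into convergence of the points.\<close>

lemma complete: "M.mcomplete"
  unfolding M.mcomplete_def
proof (intro allI impI)
  fix \<sigma> assume \<sigma>: "M.MCauchy \<sigma>"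
  have "\<forall>n. \<exists>y. y \<in> coords \<and> pt y = \<sigma> n \<and> 0 \<le> y $ 2 \<and> y $ 2 \<le> 2 * pi"
  proof
    fix n
    have "\<sigma> n \<in> X" using \<sigma> by (auto simp: M.MCauchy_def)
    then obtain x where "x \<in> coords" "\<sigma> n = pt x" by (rule pointsE)
    then show "\<exists>y. y \<in> coords \<and> pt y = \<sigma> n \<and> 0 \<le> y $ 2 \<and> y $ 2 \<le> 2 * pi"
      using bounded_angle by metis
  qed
  then obtain y where y: "\<And>n. y n \<in> coords" "\<And>n. pt (y n) = \<sigma> n" "\<And>n. 0 \<le> y n $ 2" "\<And>n. y n $ 2 \<le> 2 * pi"
    by metis
  obtain N where N: "\<And>n n'. n \<ge> N \<Longrightarrow> n' \<ge> N \<Longrightarrow> d (\<sigma> n) (\<sigma> n') < 1"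
    using \<sigma> unfolding M.MCauchy_def by (meson zero_less_one)
  define z where "z n = y (n + N)" for n
  define R where "R = y N $ 1 + 1 / a"
  have zR: "0 \<le> z n $ 1 \<and> z n $ 1 \<le> R" for n
  proof -
    have "a * \<bar>z n $ 1 - y N $ 1\<bar> < 1"
      using riem_dist_radial[OF y(1)[of "n + N"] y(1)[of N]] N[of "n + N" N] by (simp add: y(2) z_def)
    then have "\<bar>z n $ 1 - y N $ 1\<bar> < 1 / a" using a_pos by (simp add: field_simps)
    then show ?thesis using y(1)[of "n + N"] by (auto simp: strip_iff z_def R_def)
  qed
  have "bounded (range z)"
  proof (rule boundedI)
    fix w assume "w \<in> range z"
    then obtain n where w: "w = z n" by blast
    have "norm w \<le> \<bar>w $ 1\<bar> + \<bar>w $ 2\<bar>" using norm_le_l1_cart[of w] by (simp add: sum_2)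
    then show "norm w \<le> R + 2 * pi" using zR[of n] y(3,4)[of "n + N"] by (simp add: w z_def)
  qed
  then obtain l s where s: "strict_mono s" "(z \<circ> s) \<longlonglongrightarrow> l"
    using bounded_imp_convergent_subsequence by blast
  have l: "l \<in> coords"
    by (rule closed_sequentially[OF closed_strip _ s(2)]) (simp add: z_def y(1))
  have "strict_mono (\<lambda>n. s n + N)" using s(1) by (simp add: strict_mono_def)
  moreover have "limitin M.mtopology (\<sigma> \<circ> (\<lambda>n. s n + N)) (pt l) sequentially"
    unfolding M.limitin_metric
  proof (intro conjI allI impI)
    show "pt l \<in> X" by (rule point_of_points[OF l])
    fix e :: real assume "0 < e"
    have "((\<lambda>n. a * \<bar>(z \<circ> s) n $ 1 - l $ 1\<bar> + \<phi> (l $ 1) * \<bar>(z \<circ> s) n $ 2 - l $ 2\<bar>) \<longlongrightarrow>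
        a * \<bar>l $ 1 - l $ 1\<bar> + \<phi> (l $ 1) * \<bar>l $ 2 - l $ 2\<bar>) sequentially"
      by (intro tendsto_intros s(2))
    then have "\<forall>\<^sub>F n in sequentially. a * \<bar>(z \<circ> s) n $ 1 - l $ 1\<bar> + \<phi> (l $ 1) * \<bar>(z \<circ> s) n $ 2 - l $ 2\<bar> < e"
      using \<open>0 < e\<close> by (intro order_tendstoD(2)) auto
    then show "\<forall>\<^sub>F n in sequentially. (\<sigma> \<circ> (\<lambda>n. s n + N)) n \<in> X \<and> d ((\<sigma> \<circ> (\<lambda>n. s n + N)) n) (pt l) < e"
    proof (rule eventually_mono)
      fix n assume n: "a * \<bar>(z \<circ> s) n $ 1 - l $ 1\<bar> + \<phi> (l $ 1) * \<bar>(z \<circ> s) n $ 2 - l $ 2\<bar> < e"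
      have "d (\<sigma> (s n + N)) (pt l) \<le> a * \<bar>z (s n) $ 1 - l $ 1\<bar> + \<phi> (l $ 1) * \<bar>z (s n) $ 2 - l $ 2\<bar>"
        using riem_dist_le_coords[OF y(1)[of "s n + N"] l] by (simp add: y(2) z_def)
      moreover have "\<sigma> (s n + N) \<in> X" using point_of_points[OF y(1)] y(2) by metis
      ultimately show "(\<sigma> \<circ> (\<lambda>n. s n + N)) n \<in> X \<and> d ((\<sigma> \<circ> (\<lambda>n. s n + N)) n) (pt l) < e"
        using n by simp
    qed
  qed
  ultimately have "limitin M.mtopology \<sigma> (pt l) sequentially"
    by (rule M.MCauchy_convergent_subsequence[OF \<sigma>])
  then show "\<exists>x. limitin M.mtopology \<sigma> x sequentially" by blast
qed

lemma zero_strip: "0 \<in> coords"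
  using b_pos by (simp add: strip_iff zero_ereal_def)

lemma base_point_eq: "base_point b g = pt 0"
  using zero_strip \<phi>_0 by (auto simp: base_point_def mem_point_of same_point_iff)

lemma riem_dist_base:
  assumes x: "x \<in> coords"
  shows "d (pt 0) (pt x) = a * x $ 1"
proof (rule antisym)
  define z :: "real ^ 2" where "z = vector [0, x $ 2]"
  have z: "z \<in> coords" using zero_strip by (simp add: strip_iff z_def)
  have "pt z = pt 0"
    using z zero_strip \<phi>_0 by (auto simp: point_of_eq_iff same_point_iff z_def)
  then show "d (pt 0) (pt x) \<le> a * x $ 1"
    using riem_dist_le_coords[OF z x] x by (simp add: z_def strip_iff)
  show "a * x $ 1 \<le> d (pt 0) (pt x)"
    using riem_dist_radial[OF zero_strip x] x by (simp add: strip_iff)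
qed

lemma riem_dist_le_radii:
  assumes x: "x \<in> coords" and y: "y \<in> coords"
  shows "d (pt x) (pt y) \<le> a * (x $ 1 + y $ 1)"
  using M.triangle[OF point_of_points[OF x] point_of_points[OF zero_strip] point_of_points[OF y]]
    riem_dist_base[OF x] riem_dist_base[OF y] riem_dist_commute[of "pt x" "pt 0"]
  by (simp add: distrib_left)

end

text \<open>The warping functions have to be compared only along curves that are almost minimal, up to an
  arbitrary \<open>e0\<close>; on noncompact surfaces this confines the comparison to a ball.\<close>

lemma riem_dist_affine_chart:
  assumes 1: "rot_surface b1 a1 \<phi>1" and 2: "rot_surface b2 a2 \<phi>2"
    and x: "x \<in> rot_surface.coords b1 a1 \<phi>1" and y: "y \<in> rot_surface.coords b1 a1 \<phi>1"
    and s: "0 < s" and K: "0 \<le> K" "a2 * s \<le> K * a1" and e0: "0 < e0"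
    and le: "\<And>\<gamma> t. rot_surface.adm b1 a1 \<phi>1 \<gamma> \<Longrightarrow> \<gamma> 0 $ 1 = x $ 1 \<Longrightarrow> \<gamma> 1 $ 1 = y $ 1 \<Longrightarrow>
       rot_surface.len a1 \<phi>1 \<gamma> < rot_surface.d b1 a1 \<phi>1
         (rot_surface.pt b1 a1 \<phi>1 x) (rot_surface.pt b1 a1 \<phi>1 y) + e0 \<Longrightarrow> t \<in> {0..1} \<Longrightarrow>
       ereal (s * \<gamma> t $ 1) \<le> b2 \<and> \<phi>2 (s * \<gamma> t $ 1) \<le> K * \<phi>1 (\<gamma> t $ 1)"
  shows "rot_surface.d b2 a2 \<phi>2 (rot_surface.pt b2 a2 \<phi>2 (affine_chart s 0 x))
        (rot_surface.pt b2 a2 \<phi>2 (affine_chart s 0 y))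
     \<le> K * rot_surface.d b1 a1 \<phi>1 (rot_surface.pt b1 a1 \<phi>1 x) (rot_surface.pt b1 a1 \<phi>1 y)"
proof -
  interpret s1: rot_surface b1 a1 \<phi>1 by (rule 1)
  interpret s2: rot_surface b2 a2 \<phi>2 by (rule 2)
  let ?P = "s1.pt x" and ?Q = "s1.pt y" and ?T = "affine_chart s 0"
  let ?P' = "s2.pt (?T x)" and ?Q' = "s2.pt (?T y)"
  have *: "s2.d ?P' ?Q' \<le> K * (s1.d ?P ?Q + e)" if e: "0 < e" "e \<le> e0" for e
  proof -
    obtain \<gamma> where \<gamma>: "s1.adm \<gamma>" "\<gamma> 0 \<in> ?P" "\<gamma> 1 \<in> ?Q" "s1.len \<gamma> < s1.d ?P ?Q + e"
      by (rule s1.riem_dist_approx[OF s1.point_of_points[OF x] s1.point_of_points[OF y] e(1)])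
    have ends: "\<gamma> 0 $ 1 = x $ 1" "\<gamma> 1 $ 1 = y $ 1"
      using \<gamma>(2,3) by (auto simp: s1.mem_point_of s1.same_point_iff)
    have lt: "ereal (s * \<gamma> t $ 1) \<le> b2 \<and> \<phi>2 (s * \<gamma> t $ 1) \<le> K * \<phi>1 (\<gamma> t $ 1)" if "t \<in> {0..1}" for t
      using le[OF \<gamma>(1) ends _ that] \<gamma>(4) e(2) by simp
    have T: "s2.adm (\<lambda>t. ?T (\<gamma> t))" "s2.len (\<lambda>t. ?T (\<gamma> t)) \<le> K * s1.len \<gamma>"
      by (rule admissible_affine_chart[OF 1 2 \<gamma>(1) s K]; use lt in blast)+
    have sp: "(?T u, ?T v) \<in> s2.same"
      if uv: "(u, v) \<in> s1.same" and b2: "ereal (s * u $ 1) \<le> b2" "\<phi>2 (s * u $ 1) \<le> K * \<phi>1 (u $ 1)" for u v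
    proof -
      have st: "?T u \<in> s2.coords" "?T v \<in> s2.coords"
        using uv b2 s by (auto simp: s1.same_point_iff s1.strip_iff s2.strip_iff)
      have "\<phi>2 (s * u $ 1) = 0" if "\<phi>1 (u $ 1) = 0"
        using s2.\<phi>_nonneg[OF st(1)] b2(2) that by simp
      then show ?thesis using uv st by (auto simp: s1.same_point_iff s2.same_point_iff)
    qed
    have "(?T x, ?T (\<gamma> 0)) \<in> s2.same" "(?T y, ?T (\<gamma> 1)) \<in> s2.same"
      using \<gamma>(2,3) lt[of 0] lt[of 1] ends by (auto intro!: sp simp: s1.mem_point_of)
    then have mem: "?T (\<gamma> 0) \<in> ?P'" "?T (\<gamma> 1) \<in> ?Q'" "?T x \<in> s2.coords" "?T y \<in> s2.coords"
      by (auto simp: s2.mem_point_of s2.same_point_iff)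
    have "s2.d ?P' ?Q' \<le> s2.len (\<lambda>t. ?T (\<gamma> t))"
      by (rule s2.riem_dist_le[OF s2.point_of_points[OF mem(3)] s2.point_of_points[OF mem(4)] T(1) mem(1,2)])
    also have "\<dots> \<le> K * s1.len \<gamma>" by (rule T(2))
    also have "\<dots> \<le> K * (s1.d ?P ?Q + e)" using \<gamma>(4) K(1) by (intro mult_left_mono) auto
    finally show ?thesis .
  qed
  show "s2.d ?P' ?Q' \<le> K * s1.d ?P ?Q"
  proof (rule field_le_epsilon)
    fix e :: real assume e: "0 < e"
    define e' where "e' = min e0 (e / (K + 1))"
    have e': "0 < e'" "e' \<le> e0" using e e0 K(1) by (auto simp: e'_def)
    have "K * e' \<le> K * (e / (K + 1))" using K(1) by (intro mult_left_mono) (auto simp: e'_def)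
    also have "\<dots> \<le> e" using K(1) e by (simp add: field_simps)
    finally show "s2.d ?P' ?Q' \<le> K * s1.d ?P ?Q + e" using *[OF e'] by (simp add: distrib_left)
  qed
qed

section \<open>Completeness of the solitons\<close>

lemma rot_surface_soliton:
  assumes p: "p > 0" and c: "0 < c"
  shows "rot_surface (soliton_radius l) c (\<lambda>r. c * (tip_warp (1 / real p) l r / real p))"
proof
  show "continuous_on {r. 0 \<le> r \<and> ereal r \<le> soliton_radius l} (\<lambda>r. c * (tip_warp (1 / real p) l r / real p))"
    using p by (intro continuous_intros) auto
  fix r :: real
  show "0 < c * (tip_warp (1 / real p) l r / real p)" if "0 < r" "ereal r < soliton_radius l"
    using tip_warp_pos[of "1 / p" r l] that p c by simp
  show "c * (tip_warp (1 / real p) l r / real p) = 0" if "ereal r = soliton_radius l"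
  proof -
    have l: "0 < l" "r = pi / sqrt l" using that by (auto simp: soliton_radius_def split: if_splits)
    have "csin l r = 0" using csin_far[OF l, of 0] by (simp add: csin_def)
    then show ?thesis by (simp add: tip_warp_def)
  qed
qed (simp_all add: soliton_radius_pos c tip_warp_def csin_def)

lemma complete_soliton:
  assumes "p > 0"
  shows "complete_surface (radius (soliton p l)) (metric_of (soliton p l))"
proof -
  interpret rot_surface "soliton_radius l" 1 "\<lambda>r. 1 * (tip_warp (1 / real p) l r / real p)"
    by (rule rot_surface_soliton[OF assms]) simp
  have "g x = metric_of (soliton p l) x" for x unfolding g_def by (simp add: warped_eq_diag2)
  then have "g = metric_of (soliton p l)" by blast
  then show ?thesis using complete by (simp add: complete_surface_def)
qed

section \<open>Pointed Gromov-Hausdorff convergence to the cusp\<close>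

text \<open>A curve between radii less than \<open>R\<close> whose length is at most \<open>R\<close> above the distance is shorter
  than \<open>3R\<close>, and so does not leave the ball of radius \<open>3R\<close>.\<close>

lemma riem_dist_compare:
  assumes 1: "rot_surface b1 1 \<phi>1" and 2: "rot_surface b2 1 \<phi>2"
    and R: "0 < R" "ereal (3 * R) \<le> b2" and K: "1 \<le> K"
    and le: "\<And>r. 0 \<le> r \<Longrightarrow> r \<le> 3 * R \<Longrightarrow> \<phi>2 r \<le> K * \<phi>1 r"
    and x: "x \<in> rot_surface.coords b1 1 \<phi>1" "x $ 1 < R" and y: "y \<in> rot_surface.coords b1 1 \<phi>1" "y $ 1 < R"
  shows "rot_surface.d b2 1 \<phi>2 (rot_surface.pt b2 1 \<phi>2 x) (rot_surface.pt b2 1 \<phi>2 y)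
     \<le> K * rot_surface.d b1 1 \<phi>1 (rot_surface.pt b1 1 \<phi>1 x) (rot_surface.pt b1 1 \<phi>1 y)"
proof -
  interpret s1: rot_surface b1 1 \<phi>1 by (rule 1)
  interpret s2: rot_surface b2 1 \<phi>2 by (rule 2)
  have id: "affine_chart 1 0 z = z" for z by (simp add: vec_eq_2)
  have lt: "ereal (1 * \<gamma> t $ 1) \<le> b2 \<and> \<phi>2 (1 * \<gamma> t $ 1) \<le> K * \<phi>1 (\<gamma> t $ 1)"
    if \<gamma>: "s1.adm \<gamma>" "\<gamma> 0 $ 1 = x $ 1" "\<gamma> 1 $ 1 = y $ 1"
      "s1.len \<gamma> < s1.d (s1.pt x) (s1.pt y) + R" and t: "t \<in> {0..1}" for \<gamma> t
  proof -
    have "\<bar>\<gamma> t $ 1 - x $ 1\<bar> + \<bar>y $ 1 - \<gamma> t $ 1\<bar> \<le> s1.len \<gamma>"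
      using s1.radial_bound[OF \<gamma>(1) t] \<gamma>(2,3) by simp
    moreover have "s1.d (s1.pt x) (s1.pt y) \<le> x $ 1 + y $ 1"
      using s1.riem_dist_le_radii[OF x(1) y(1)] by simp
    ultimately have "\<gamma> t $ 1 \<le> 3 * R" using x(2) y(2) \<gamma>(4) by linarith
    moreover have "0 \<le> \<gamma> t $ 1"
      using s1.admissible_strip[OF \<gamma>(1) t] by (simp add: s1.strip_iff)
    ultimately show ?thesis using le[of "\<gamma> t $ 1"] R(2) by (auto intro: order_trans[of _ "ereal (3 * R)"])
  qed
  show ?thesis
    using riem_dist_affine_chart[OF 1 2 x(1) y(1), of 1 K R] lt K R(1) unfolding id by simp
qed

lemma tip_warp_compare:
  assumes p: "p > 0" and K: "1 < K" and \<rho>: "0 < \<rho>"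
  shows "\<forall>\<^sub>F l in at_right 0. \<forall>r\<in>{0..\<rho>}.
    tip_warp (1 / real p) l r \<le> K * tip_warp (1 / real p) 0 r \<and> tip_warp (1 / real p) 0 r \<le> K * tip_warp (1 / real p) l r"
proof -
  \<comment> \<open>the quotient of the two profiles, which extends continuously to \<open>r = 0\<close>\<close>
  define q where "q l r = stumpff 1 (l * r\<^sup>2) * (1 + 1 / real p * vers 0 r) / (1 + 1 / real p * vers l r)" for l r
  have pos: "0 < 1 + 1 / real p * vers l r" for l r by (rule one_plus_vers_pos) simp
  have q: "tip_warp (1 / real p) l r = q l r * tip_warp (1 / real p) 0 r" for l r
    using pos[of 0 r] by (simp add: tip_warp_def q_def csin_def)
  have q0: "q 0 r = 1" for r using pos[of 0 r] by (simp add: q_def)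
  have nz: "\<forall>x\<in>{0..1} \<times> {0..\<rho>}. 1 + 1 / real p * vers (fst x) (snd x) \<noteq> 0"
    using pos by (metis less_irrefl)
  have "continuous_on ({0..1} \<times> {0..\<rho>}) (\<lambda>x. q (fst x) (snd x))"
    unfolding q_def using p by (intro continuous_intros continuous_on_stumpff nz) auto
  then have "uniformly_continuous_on ({0..1} \<times> {0..\<rho>}) (\<lambda>x. q (fst x) (snd x))"
    by (intro compact_uniformly_continuous compact_Times) auto
  moreover have "0 < 1 - 1 / K" using K by simp
  ultimately obtain \<delta> where \<delta>: "0 < \<delta>" and uc: "\<And>x x'. x \<in> {0..1} \<times> {0..\<rho>} \<Longrightarrow> x' \<in> {0..1} \<times> {0..\<rho>} \<Longrightarrow>
      dist x' x < \<delta> \<Longrightarrow> dist (q (fst x') (snd x')) (q (fst x) (snd x)) < 1 - 1 / K"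
    unfolding uniformly_continuous_on_def by meson
  have "\<forall>\<^sub>F l in at_right (0::real). l \<in> {0<..<min 1 \<delta>}"
    using \<delta> by (intro eventually_at_right_real) simp
  then show ?thesis
  proof (rule eventually_mono)
    fix l assume l: "l \<in> {0<..<min 1 \<delta>}"
    show "\<forall>r\<in>{0..\<rho>}. tip_warp (1 / real p) l r \<le> K * tip_warp (1 / real p) 0 r
        \<and> tip_warp (1 / real p) 0 r \<le> K * tip_warp (1 / real p) l r"
    proof
      fix r assume r: "r \<in> {0..\<rho>}"
      have "dist (q l r) (q 0 r) < 1 - 1 / K"
        using uc[of "(0, r)" "(l, r)"] l r by (simp add: dist_Pair_Pair)
      then have b: "\<bar>q l r - 1\<bar> < 1 - 1 / K" by (simp add: q0 dist_real_def)
      have "0 < (K - 1)\<^sup>2" using K by simp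
      then have "2 - 1 / K \<le> K" using K by (simp add: field_simps power2_eq_square)
      then have 1: "q l r \<le> K" and "1 / K \<le> q l r" using b by linarith+
      then have 2: "1 \<le> K * q l r" using K by (simp add: field_simps)
      have t: "0 \<le> tip_warp (1 / real p) 0 r"
        using r pos[of 0 r] by (simp add: tip_warp_def csin_def)
      show "tip_warp (1 / real p) l r \<le> K * tip_warp (1 / real p) 0 r
        \<and> tip_warp (1 / real p) 0 r \<le> K * tip_warp (1 / real p) l r"
        using mult_right_mono[OF 1 t] mult_right_mono[OF 2 t] by (simp add: q[of l] mult.assoc)
    qed
  qed
qed

text \<open>A ball of fixed radius in a football with small \<open>l\<close> stays away from the second tip. Points of the
  football and of the cusp are identified if they have the same coordinates; the two metrics are
  close there up to a factor near 1, uniformly also at the tip.\<close>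

lemma pointed_gh_cusp:
  assumes p: "p > 0"
  shows "pointed_gh_surfaces (soliton p) \<infinity> (cusp_metric p) (at_right 0)"
  unfolding pointed_gh_surfaces_def pointed_gh_conv_def Let_def
proof (intro allI impI, goal_cases)
  case (1 R \<epsilon>)
  then have R: "0 < R" and \<epsilon>: "0 < \<epsilon>" by simp_all
  \<comment> \<open>distances within the ball are at most \<open>2R\<close>, so a factor \<open>K\<close> changes them by at most \<open>\<epsilon> / 2\<close>\<close>
  define K where "K = 1 + \<epsilon> / (4 * R)"
  have K: "1 < K" using R \<epsilon> by (simp add: K_def)
  have "\<forall>\<^sub>F l in at_right (0::real). l \<in> {0<..<(pi / (3 * R))\<^sup>2}"
    using R by (intro eventually_at_right_real) simp
  moreover have "\<forall>\<^sub>F l in at_right 0. \<forall>r\<in>{0..3 * R}.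
      tip_warp (1 / real p) l r \<le> K * tip_warp (1 / real p) 0 r \<and> tip_warp (1 / real p) 0 r \<le> K * tip_warp (1 / real p) l r"
    using R by (intro tip_warp_compare p K) simp
  ultimately show ?case
  proof eventually_elim
    case (elim l)
    define \<phi>1 where "\<phi>1 r = 1 * (tip_warp (1 / real p) l r / real p)" for r
    define \<phi>2 where "\<phi>2 r = 1 * (tip_warp (1 / real p) 0 r / real p)" for r
    have S1: "rot_surface (soliton_radius l) 1 \<phi>1"
      unfolding \<phi>1_def by (rule rot_surface_soliton[OF p]) simp
    have S2: "rot_surface \<infinity> 1 \<phi>2"
      using rot_surface_soliton[OF p, of 1 0] unfolding \<phi>2_def by (simp add: soliton_radius_def)
    interpret s1: rot_surface "soliton_radius l" 1 \<phi>1 by (rule S1)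
    interpret s2: rot_surface \<infinity> 1 \<phi>2 by (rule S2)
    have g1: "metric_of (soliton p l) = s1.g"
      by (simp add: fun_eq_iff s1.g_def warped_eq_diag2 \<phi>1_def)
    have g2: "cusp_metric p = s2.g"
      by (simp add: cusp_metric_eq[OF p] fun_eq_iff s2.g_def warped_eq_diag2 \<phi>2_def)
    have cmp: "\<phi>1 r \<le> K * \<phi>2 r" "\<phi>2 r \<le> K * \<phi>1 r" if "0 \<le> r" "r \<le> 3 * R" for r
      using elim(2) that p by (auto simp: \<phi>1_def \<phi>2_def divide_right_mono)
    have b1: "ereal (3 * R) \<le> soliton_radius l"
    proof -
      have "sqrt l < pi / (3 * R)" using elim(1) R by (intro real_less_lsqrt) auto
      then show ?thesis using elim(1) R by (simp add: soliton_radius_def field_simps)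
    qed
    have same: "s1.pt x = s2.pt x" if x: "0 \<le> x $ 1" "x $ 1 < R" for x
    proof -
      have st: "y \<in> s1.coords" "y \<in> s2.coords" if "y $ 1 = x $ 1" for y
      proof -
        have "ereal (x $ 1) \<le> ereal (3 * R)" using x by simp
        also note b1
        finally show "y \<in> s1.coords" "y \<in> s2.coords"
          using that x by (auto simp: s1.strip_iff s2.strip_iff)
      qed
      have "\<phi>1 (x $ 1) = 0 \<longleftrightarrow> \<phi>2 (x $ 1) = 0"
        using cmp[of "x $ 1"] x s1.\<phi>_nonneg[OF st(1)[OF refl]] s2.\<phi>_nonneg[OF st(2)[OF refl]]
        by (auto intro: antisym)
      then show ?thesis
        using st by (auto simp: s1.mem_point_of s2.mem_point_of s1.same_point_iff s2.same_point_iff)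
    qed
    have base: "base_point (soliton_radius l) s1.g = base_point \<infinity> s2.g"
      unfolding s1.base_point_eq s2.base_point_eq using same[of 0] R by simp
    let ?B = "{x \<in> s1.X. s1.d (base_point (soliton_radius l) s1.g) x < R}"
    have ball: "\<exists>x. x \<in> s1.coords \<and> x \<in> s2.coords \<and> 0 \<le> x $ 1 \<and> x $ 1 < R \<and>
        P = s1.pt x \<and> P = s2.pt x" if P: "P \<in> ?B" for P
    proof -
      obtain x where x: "x \<in> s1.coords" "P = s1.pt x"
        using P s1.pointsE by blast
      then have "0 \<le> x $ 1" "x $ 1 < R"
        using P s1.riem_dist_base[OF x(1)] by (auto simp: s1.base_point_eq s1.strip_iff)
      then show ?thesis using x same[of x] by (auto simp: s2.strip_iff)
    qed
    have close: "\<bar>s2.d P Q - s1.d P Q\<bar> < \<epsilon>" if PQ: "P \<in> ?B" "Q \<in> ?B" for P Q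
    proof -
      obtain x where x: "x \<in> s1.coords" "x \<in> s2.coords" "x $ 1 < R"
        "P = s1.pt x" "P = s2.pt x" using ball[OF PQ(1)] by blast
      obtain y where y: "y \<in> s1.coords" "y \<in> s2.coords" "y $ 1 < R"
        "Q = s1.pt y" "Q = s2.pt y" using ball[OF PQ(2)] by blast
      have "s2.d P Q \<le> K * s1.d P Q"
        using riem_dist_compare[OF S1 S2 R _ _ cmp(2) x(1,3) y(1,3)] K x(4,5) y(4,5) by simp
      moreover have "s1.d P Q \<le> K * s2.d P Q"
        using riem_dist_compare[OF S2 S1 R b1 _ cmp(1) x(2,3) y(2,3)] K x(4,5) y(4,5) by simp
      moreover have "s1.d P Q \<le> 2 * R" "s2.d P Q \<le> 2 * R"
        using s1.riem_dist_le_radii[OF x(1) y(1)] s2.riem_dist_le_radii[OF x(2) y(2)] x(3-5) y(3-5) by auto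
      then have "(K - 1) * s1.d P Q \<le> (K - 1) * (2 * R)" "(K - 1) * s2.d P Q \<le> (K - 1) * (2 * R)"
        using K by (auto intro: mult_left_mono)
      moreover have "(K - 1) * (2 * R) = \<epsilon> / 2" using R by (simp add: K_def)
      ultimately show ?thesis using \<epsilon> by (simp add: algebra_simps abs_if split: if_splits)
    qed
    have cover: "y \<in> ?B" if y: "y \<in> s2.X" "s2.d (base_point \<infinity> s2.g) y < R - \<epsilon>" for y
    proof -
      obtain x where x: "x \<in> s2.coords" "y = s2.pt x" using y(1) s2.pointsE by blast
      then have x1: "0 \<le> x $ 1" "x $ 1 < R"
        using y(2) s2.riem_dist_base[OF x(1)] \<epsilon> by (auto simp: s2.base_point_eq s2.strip_iff)
      have "ereal (x $ 1) \<le> ereal (3 * R)" using x1 by simp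
      also note b1
      finally have st: "x \<in> s1.coords"
        using x1 by (simp add: s1.strip_iff)
      then show ?thesis
        using x(2) same[OF x1] s1.riem_dist_base[OF st] s1.point_of_points[OF st] x1
        by (simp add: s1.base_point_eq)
    qed
    have "?B \<subseteq> s2.X"
    proof
      fix P assume "P \<in> ?B"
      from ball[OF this] obtain x where "x \<in> s2.coords" "P = s2.pt x" by blast
      then show "P \<in> s2.X" using s2.point_of_points by simp
    qed
    moreover have "\<exists>x\<in>?B. s2.d (id x) y < \<epsilon>" if "y \<in> s2.X" "s2.d (base_point \<infinity> s2.g) y < R - \<epsilon>" for y
      using \<epsilon> that(1) cover[OF that] by (intro bexI[of _ y]) simp_all
    ultimately show ?case
      unfolding soliton_simps(1) g1 g2 using base close by (intro exI[of _ id]) simp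
  qed
qed

section \<open>Gromov-Hausdorff convergence to the round football\<close>

text \<open>The two spaces are glued along \<open>h\<close> by putting \<open>x\<close> and \<open>h x\<close> at distance \<open>\<delta> / 2\<close> and measuring
  paths from one space to the other with the smaller metric \<open>dX\<close>.\<close>

lemma gh_dist_le:
  assumes X: "Metric_space X dX" and Y: "Metric_space Y dY" and h: "bij_betw h X Y" and \<delta>: "0 < \<delta>"
    and le: "\<And>x x'. x \<in> X \<Longrightarrow> x' \<in> X \<Longrightarrow> dX x x' \<le> dY (h x) (h x') \<and> dY (h x) (h x') \<le> dX x x' + \<delta>"
  shows "gh_dist X dX Y dY \<le> ennreal \<delta>"
proof -
  interpret X: Metric_space X dX by (rule X)
  interpret Y: Metric_space Y dY by (rule Y)
  define k where "k = inv_into X h"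
  have k: "k y \<in> X" "h (k y) = y" if "y \<in> Y" for y
    using h that by (auto simp: k_def bij_betw_def inv_into_into f_inv_into_f)
  have kh: "k (h x) = x" if "x \<in> X" for x
    using h that by (simp add: k_def bij_betw_def)
  have hY: "h x \<in> Y" if "x \<in> X" for x using h that by (auto simp: bij_betw_def)
  have le': "dX (k y) (k y') \<le> dY y y'" "dY y y' \<le> dX (k y) (k y') + \<delta>" if "y \<in> Y" "y' \<in> Y" for y y'
    using le[of "k y" "k y'"] k that by auto
  define D where "D u v = (case u of
      Inl x \<Rightarrow> (case v of Inl x' \<Rightarrow> dX x x' | Inr y \<Rightarrow> dX x (k y) + \<delta> / 2)
    | Inr y \<Rightarrow> (case v of Inl x \<Rightarrow> dX x (k y) + \<delta> / 2 | Inr y' \<Rightarrow> dY y y'))" for u v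
  have D: "D (Inl x) (Inl x') = dX x x'" "D (Inr y) (Inr y') = dY y y'"
    "D (Inl x) (Inr y) = dX x (k y) + \<delta> / 2" "D (Inr y) (Inl x) = dX x (k y) + \<delta> / 2" for x x' y y'
    by (simp_all add: D_def)
  have "Metric_space (X <+> Y) D"
  proof
    fix u v
    show "0 \<le> D u v" using \<delta> by (cases u; cases v) (simp_all add: D add_nonneg_nonneg)
    show "D u v = D v u" by (cases u; cases v) (simp_all add: D X.commute Y.commute)
    assume u: "u \<in> X <+> Y" and v: "v \<in> X <+> Y"
    have nz: "dX x y + \<delta> / 2 \<noteq> 0" for x y using X.nonneg[of x y] \<delta> by linarith
    show "D u v = 0 \<longleftrightarrow> u = v" using u v nz by (cases u; cases v) (auto simp: D)
    fix w assume w: "w \<in> X <+> Y"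
    show "D u w \<le> D u v + D v w"
    proof (cases u; cases v; cases w)
      fix x x' x'' assume [simp]: "u = Inl x" "v = Inl x'" "w = Inl x''"
      show ?thesis using u v w X.triangle by (auto simp: D)
    next
      fix x x' y assume [simp]: "u = Inl x" "v = Inl x'" "w = Inr y"
      show ?thesis using u v w X.triangle[of x x' "k y"] k by (auto simp: D)
    next
      fix x y x' assume [simp]: "u = Inl x" "v = Inr y" "w = Inl x'"
      show ?thesis using u v w X.triangle[of x "k y" x'] k \<delta> X.commute[of x' "k y"] by (auto simp: D)
    next
      fix x y y' assume [simp]: "u = Inl x" "v = Inr y" "w = Inr y'"
      show ?thesis using u v w X.triangle[of x "k y" "k y'"] k le'[of y y'] by (auto simp: D)
    next
      fix y x x' assume [simp]: "u = Inr y" "v = Inl x" "w = Inl x'"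
      show ?thesis using u v w X.triangle[of x' x "k y"] k X.commute[of x x'] by (auto simp: D)
    next
      fix y x y' assume [simp]: "u = Inr y" "v = Inl x" "w = Inr y'"
      show ?thesis using u v w X.triangle[of "k y" x "k y'"] k le'[of y y'] X.commute[of x "k y"] by (auto simp: D)
    next
      fix y y' x assume [simp]: "u = Inr y" "v = Inr y'" "w = Inl x"
      show ?thesis using u v w X.triangle[of x "k y'" "k y"] k le'[of y y'] X.commute[of "k y'" "k y"] by (auto simp: D)
    next
      fix y y' y'' assume [simp]: "u = Inr y" "v = Inr y'" "w = Inr y''"
      show ?thesis using u v w Y.triangle by (auto simp: D)
    qed
  qed
  moreover have "\<exists>y\<in>Y. D (Inl x) (Inr y) < \<delta>" if "x \<in> X" for x
    using hY[OF that] kh[OF that] that \<delta> by (intro bexI[of _ "h x"]) (simp_all add: D)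
  moreover have "\<exists>x\<in>X. D (Inl x) (Inr y) < \<delta>" if "y \<in> Y" for y
    using k[OF that] \<delta> by (intro bexI[of _ "k y"]) (simp_all add: D)
  ultimately show ?thesis
    unfolding gh_dist_def by (intro Inf_lower) (use \<delta> D in blast)
qed

text \<open>Multiplication of the radius by \<open>s\<close> identifies the two surfaces and respects the radial part of
  the metrics. Distances do not decrease and grow at most by the factor \<open>K\<close>, while the diameter of
  the first surface is at most \<open>2 a1 B\<close>.\<close>

lemma gh_dist_surfaces:
  assumes 1: "rot_surface (ereal B) a1 \<phi>1" and 2: "rot_surface b2 a2 \<phi>2"
    and s: "0 < s" "a2 * s = a1" and K: "1 \<le> K"
    and range: "\<And>r. 0 \<le> r \<Longrightarrow> r \<le> B \<longleftrightarrow> ereal (s * r) \<le> b2"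
    and le: "\<And>r. 0 \<le> r \<Longrightarrow> r \<le> B \<Longrightarrow> \<phi>1 r \<le> \<phi>2 (s * r) \<and> \<phi>2 (s * r) \<le> K * \<phi>1 r"
    and \<delta>: "0 < \<delta>" "(K - 1) * (2 * (a1 * B)) \<le> \<delta>"
  shows "gh_dist (rot_surface.X (ereal B) a1 \<phi>1) (rot_surface.d (ereal B) a1 \<phi>1)
      (rot_surface.X b2 a2 \<phi>2) (rot_surface.d b2 a2 \<phi>2) \<le> ennreal \<delta>"
proof -
  interpret s1: rot_surface "ereal B" a1 \<phi>1 by (rule 1)
  interpret s2: rot_surface b2 a2 \<phi>2 by (rule 2)
  let ?T = "affine_chart s 0" and ?T' = "affine_chart (1 / s) 0"
  let ?c1 = "s1.pt" and ?c2 = "s2.pt"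
  have TT': "?T (?T' y) = y" "?T' (?T y) = y" for y using s by (simp_all add: vec_eq_2)
  have st: "?T x \<in> s2.coords \<longleftrightarrow> x \<in> s1.coords" for x
    using s range[of "x $ 1"] by (auto simp: s1.strip_iff s2.strip_iff zero_le_mult_iff)
  have sp: "(?T x, ?T y) \<in> s2.same \<longleftrightarrow> (x, y) \<in> s1.same" for x y
  proof -
    have "\<phi>2 (s * x $ 1) = 0 \<longleftrightarrow> \<phi>1 (x $ 1) = 0" if x: "x \<in> s1.coords"
      using le[of "x $ 1"] s1.\<phi>_nonneg[OF x] s2.\<phi>_nonneg[of "?T x"] st[of x] x
      by (auto simp: s1.strip_iff intro: antisym)
    then show ?thesis using s st[of x] st[of y] by (auto simp: s1.same_point_iff s2.same_point_iff)
  qed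
  \<comment> \<open>by \<open>sp\<close> the value does not depend on the representative\<close>
  define h where "h P = ?c2 (?T (SOME x. x \<in> P))" for P
  have h: "h (?c1 x) = ?c2 (?T x)" if x: "x \<in> s1.coords" for x
  proof -
    have "(SOME u. u \<in> ?c1 x) \<in> ?c1 x" by (rule someI) (rule s1.point_of_self[OF x])
    then have "?T (SOME u. u \<in> ?c1 x) \<in> ?c2 (?T x)" by (simp add: s1.mem_point_of s2.mem_point_of sp)
    then show ?thesis unfolding h_def by (rule s2.point_of_eq)
  qed
  have "bij_betw h s1.X s2.X"
  proof (rule bij_betwI')
    fix P Q assume PQ: "P \<in> s1.X" "Q \<in> s1.X"
    obtain x where x: "x \<in> s1.coords" "P = ?c1 x" using PQ(1) by (rule s1.pointsE)
    obtain y where y: "y \<in> s1.coords" "Q = ?c1 y" using PQ(2) by (rule s1.pointsE)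
    show "h P = h Q \<longleftrightarrow> P = Q"
      using x y st by (simp add: h s1.point_of_eq_iff s2.point_of_eq_iff sp)
  next
    fix P assume "P \<in> s1.X"
    then obtain x where x: "x \<in> s1.coords" "P = ?c1 x" by (rule s1.pointsE)
    then show "h P \<in> s2.X" using st by (simp add: h s2.point_of_points)
  next
    fix Q assume "Q \<in> s2.X"
    then obtain y where y: "y \<in> s2.coords" "Q = ?c2 y" by (rule s2.pointsE)
    then have "?T' y \<in> s1.coords" using st[of "?T' y"] by (simp add: TT')
    then show "\<exists>P\<in>s1.X. Q = h P" using y by (intro bexI[of _ "?c1 (?T' y)"]) (simp_all add: h TT' s1.point_of_points)
  qed
  moreover have "s1.d P Q \<le> s2.d (h P) (h Q) \<and> s2.d (h P) (h Q) \<le> s1.d P Q + \<delta>"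
    if PQ: "P \<in> s1.X" "Q \<in> s1.X" for P Q
  proof -
    obtain x where x: "x \<in> s1.coords" "P = ?c1 x" using PQ(1) by (rule s1.pointsE)
    obtain y where y: "y \<in> s1.coords" "Q = ?c1 y" using PQ(2) by (rule s1.pointsE)
    have "s2.d (?c2 (?T x)) (?c2 (?T y)) \<le> K * s1.d (?c1 x) (?c1 y)"
    proof (rule riem_dist_affine_chart[OF 1 2 x(1) y(1) s(1), where ?e0.0 = 1])
      show "a2 * s \<le> K * a1" using s(2) K s1.a_pos by simp
      fix \<gamma> and t :: real assume "s1.adm \<gamma>" "t \<in> {0..1}"
      then have "\<gamma> t \<in> s1.coords" by (rule s1.admissible_strip)
      then show "ereal (s * \<gamma> t $ 1) \<le> b2 \<and> \<phi>2 (s * \<gamma> t $ 1) \<le> K * \<phi>1 (\<gamma> t $ 1)"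
        using range[of "\<gamma> t $ 1"] le[of "\<gamma> t $ 1"] by (simp add: s1.strip_iff)
    qed (use K in auto)
    then have u: "s2.d (h P) (h Q) \<le> K * s1.d P Q" using x y by (simp add: h)
    have "s1.d (?c1 (?T' (?T x))) (?c1 (?T' (?T y))) \<le> 1 * s2.d (?c2 (?T x)) (?c2 (?T y))"
    proof (rule riem_dist_affine_chart[OF 2 1, where ?e0.0 = 1])
      show "?T x \<in> s2.coords" "?T y \<in> s2.coords" using x y st by simp_all
      show "a1 * (1 / s) \<le> 1 * a2" using s by (simp add: s(2)[symmetric])
      fix \<gamma> and t :: real assume "s2.adm \<gamma>" "t \<in> {0..1}"
      then have "\<gamma> t \<in> s2.coords" by (rule s2.admissible_strip)
      then have "0 \<le> 1 / s * \<gamma> t $ 1" "1 / s * \<gamma> t $ 1 \<le> B"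
        using s range[of "1 / s * \<gamma> t $ 1"] by (simp_all add: s2.strip_iff)
      then show "ereal (1 / s * \<gamma> t $ 1) \<le> ereal B \<and> \<phi>1 (1 / s * \<gamma> t $ 1) \<le> 1 * \<phi>2 (\<gamma> t $ 1)"
        using le[of "1 / s * \<gamma> t $ 1"] s by simp
    qed (use s in auto)
    then have l: "s1.d P Q \<le> s2.d (h P) (h Q)" using x y by (simp add: h TT')
    have "a1 * (x $ 1 + y $ 1) \<le> a1 * (2 * B)"
      using x(1) y(1) s1.a_pos by (intro mult_left_mono) (auto simp: s1.strip_iff)
    then have "s1.d P Q \<le> 2 * (a1 * B)"
      using s1.riem_dist_le_radii[OF x(1) y(1)] x(2) y(2) by simp
    then have "(K - 1) * s1.d P Q \<le> (K - 1) * (2 * (a1 * B))" using K by (intro mult_left_mono) auto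
    then show ?thesis using u l \<delta>(2) by (simp add: left_diff_distrib)
  qed
  ultimately show ?thesis
    by (intro gh_dist_le[OF s1.Metric_space_riem_dist s2.Metric_space_riem_dist _ \<delta>(1)]) auto
qed

lemma rot_surface_football: "p > 0 \<Longrightarrow> rot_surface (ereal pi) 1 (\<lambda>r. sin r / real p)"
  by unfold_locales (auto intro!: continuous_intros sin_gt_zero divide_pos_pos)

text \<open>After rescaling, the warping function is that of the round football divided by
  \<open>1 + vers l r / p\<close>, which lies between \<open>1\<close> and \<open>1 + 2 / (p l)\<close>.\<close>

lemma gh_dist_football:
  assumes p: "p > 0" and l: "0 < l"
  shows "gh_dist (points (radius (soliton p l)) (\<lambda>x. l *\<^sub>R metric_of (soliton p l) x))
     (riem_dist (radius (soliton p l)) (\<lambda>x. l *\<^sub>R metric_of (soliton p l) x))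
     (points (ereal pi) (round_football p)) (riem_dist (ereal pi) (round_football p)) \<le> ennreal (4 * pi / (p * l))"
proof -
  define \<phi>1 where "\<phi>1 r = sqrt l * (tip_warp (1 / real p) l r / real p)" for r
  define \<phi>2 where "\<phi>2 r = sin r / real p" for r
  have rad: "soliton_radius l = ereal (pi / sqrt l)" using l by (simp add: soliton_radius_def)
  have S1: "rot_surface (ereal (pi / sqrt l)) (sqrt l) \<phi>1"
    using rot_surface_soliton[OF p, of "sqrt l" l] l unfolding \<phi>1_def rad by simp
  have S2: "rot_surface (ereal pi) 1 \<phi>2"
    using rot_surface_football[OF p] unfolding \<phi>2_def .
  interpret s1: rot_surface "ereal (pi / sqrt l)" "sqrt l" \<phi>1 by (rule S1)
  interpret s2: rot_surface "ereal pi" 1 \<phi>2 by (rule S2)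
  have g1: "(\<lambda>x. l *\<^sub>R metric_of (soliton p l) x) = s1.g"
    using l by (simp add: fun_eq_iff s1.g_def warped_eq_diag2 \<phi>1_def vec_eq_2 power_mult_distrib power_divide)
  have g2: "round_football p = s2.g"
    by (simp add: fun_eq_iff round_football_def s2.g_def warped_eq_diag2 \<phi>2_def)
  let ?K = "1 + 2 / (real p * l)"
  show ?thesis
    unfolding g1 g2 soliton_simps(1) rad
  proof (rule gh_dist_surfaces[OF S1 S2, where s = "sqrt l" and K = ?K])
    fix r :: real assume r: "0 \<le> r"
    show "r \<le> pi / sqrt l \<longleftrightarrow> ereal (sqrt l * r) \<le> ereal pi"
      using l by (simp add: field_simps)
    assume "r \<le> pi / sqrt l"
    then have "sqrt l * r \<le> pi" using l by (simp add: field_simps)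
    then have sin: "0 \<le> \<phi>2 (sqrt l * r)"
      using r l by (simp add: \<phi>2_def sin_ge_zero)
    define v where "v = 1 + 1 / real p * vers l r"
    have v: "1 \<le> v" using vers_nonneg[of l r] by (simp add: v_def)
    have "1 - cos (sqrt l * r) \<le> 2" using cos_ge_minus_one[of "sqrt l * r"] by linarith
    then have "vers l r \<le> 2 / l" using l by (simp add: vers_eq_cos divide_right_mono)
    then have "v \<le> 1 + 1 / real p * (2 / l)" unfolding v_def by (intro add_left_mono mult_left_mono) auto
    then have vK: "v \<le> ?K" by simp
    have e: "\<phi>1 r * v = \<phi>2 (sqrt l * r)"
      unfolding \<phi>1_def \<phi>2_def tip_warp_def v_def[symmetric] csin_eq_sin[OF l] using l v by simp
    then have "0 \<le> \<phi>1 r" using sin v by (metis less_le_trans mult_less_0_iff not_less zero_less_one)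
    then have "\<phi>1 r * 1 \<le> \<phi>1 r * v" "\<phi>1 r * v \<le> \<phi>1 r * ?K"
      using v vK by (intro mult_left_mono; simp)+
    then show "\<phi>1 r \<le> \<phi>2 (sqrt l * r) \<and> \<phi>2 (sqrt l * r) \<le> ?K * \<phi>1 r"
      using e by (simp add: mult.commute)
  qed (use l p in \<open>simp_all add: field_simps\<close>)
qed

lemma rescaled_gh_football:
  assumes p: "p > 0"
  shows "rescaled_gh_surfaces (\<lambda>l. if 0 < l then l else 1) (soliton p) (ereal pi) (round_football p) at_top"
  unfolding rescaled_gh_surfaces_def
proof -
  have le: "\<forall>\<^sub>F l::real in at_top. gh_dist
         (points (radius (soliton p l)) (\<lambda>x. (if 0 < l then l else 1) *\<^sub>R metric_of (soliton p l) x))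
         (riem_dist (radius (soliton p l)) (\<lambda>x. (if 0 < l then l else 1) *\<^sub>R metric_of (soliton p l) x))
         (points (ereal pi) (round_football p)) (riem_dist (ereal pi) (round_football p)) \<le> ennreal (4 * pi / (p * l))"
    using eventually_gt_at_top[of 0]
    by (rule eventually_mono) (use gh_dist_football[OF p] in auto)
  have "((\<lambda>l::real. 4 * pi / p * inverse l) \<longlongrightarrow> 4 * pi / p * 0) at_top"
    by (intro tendsto_intros tendsto_inverse_0_at_top filterlim_ident)
  then have "((\<lambda>l::real. 4 * pi / (p * l)) \<longlongrightarrow> 0) at_top" by (simp add: field_simps)
  then have "((\<lambda>l::real. ennreal (4 * pi / (p * l))) \<longlongrightarrow> 0) at_top"
    using tendsto_ennrealI by fastforce
  from tendsto_sandwich[OF _ le tendsto_const this]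
  show "((\<lambda>l. gh_dist
         (points (radius (soliton p l)) (\<lambda>x. (if 0 < l then l else 1) *\<^sub>R metric_of (soliton p l) x))
         (riem_dist (radius (soliton p l)) (\<lambda>x. (if 0 < l then l else 1) *\<^sub>R metric_of (soliton p l) x))
         (points (ereal pi) (round_football p)) (riem_dist (ereal pi) (round_football p))) \<longlongrightarrow> 0) at_top"
    by simp
qed

theorem theorem1p1:
  fixes p :: nat
  assumes "p > 1"
  shows "\<exists>S :: real \<Rightarrow> rot_rym.
    continuous_family {- 2 / real p..} S \<and>
    (\<forall>l \<ge> - 2 / real p.
       rot_steady_soliton p (S l) \<and> complete_surface (radius (S l)) (metric_of (S l))) \<and>
    cheeger_gromov_conv p S \<infinity> (\<lambda>x. (2 * real p) *\<^sub>R cigar_quotient p x) (at_right (- 2 / real p)) \<and>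
    cheeger_gromov_conv p S \<infinity> (cusp_metric p) (at_left 0) \<and>
    pointed_gh_surfaces S \<infinity> (cusp_metric p) (at_right 0) \<and>
    (\<exists>c :: real \<Rightarrow> real. (\<forall>l. 0 < c l) \<and>
       rescaled_gh_surfaces c S (ereal pi) (round_football p) at_top) \<and>
    (\<forall>q :: nat. p < q \<longrightarrow> football_orbifold p q (S (2 / (real q - real p))))"
proof (intro exI[of _ "soliton p"] conjI allI impI)
  have p: "p > 0" using assms by simp
  show "continuous_family {- 2 / real p..} (soliton p)" by (rule continuous_family_soliton[OF p])
  show "rot_steady_soliton p (soliton p l)" if "- 2 / real p \<le> l" for l
    by (rule rot_steady_soliton_soliton[OF p that])
  show "complete_surface (radius (soliton p l)) (metric_of (soliton p l))" for l
    by (rule complete_soliton[OF p])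
  show "cheeger_gromov_conv p (soliton p) \<infinity> (\<lambda>x. (2 * real p) *\<^sub>R cigar_quotient p x) (at_right (- 2 / real p))"
    by (rule cheeger_gromov_cigar[OF assms])
  show "cheeger_gromov_conv p (soliton p) \<infinity> (cusp_metric p) (at_left 0)"
    by (rule cheeger_gromov_cusp[OF p])
  show "pointed_gh_surfaces (soliton p) \<infinity> (cusp_metric p) (at_right 0)"
    by (rule pointed_gh_cusp[OF p])
  \<comment> \<open>the limit concerns large \<open>l\<close>, where the factor is \<open>l\<close>; elsewhere any positive value will do\<close>
  show "\<exists>c :: real \<Rightarrow> real. (\<forall>l. 0 < c l) \<and>
       rescaled_gh_surfaces c (soliton p) (ereal pi) (round_football p) at_top"
    using rescaled_gh_football[OF p] by (intro exI[of _ "\<lambda>l. if 0 < l then l else 1"]) simp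
  show "football_orbifold p q (soliton p (2 / (real q - real p)))" if "p < q" for q
    by (rule football_soliton[OF p that])
qed

end
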